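(* Let $\mathcal{O}$ be an order in an imaginary quadratic field and let $\ell$ be a prime. Let $\mathfrak{a}$ be an ideal of $\mathcal{O}$ in a well-rounded (proper ideal) class $\mathcal{C}$. Suppose $\mathfrak{p}_\ell$ is a prime proper ideal of $\mathcal{O}$ of norm $\ell$, and suppose $\mathfrak{p}_\ell\mathfrak{a}$ is in a well-rounded class $\mathcal{C}'$. Then $(L,M)=(\mathfrak{a},\mathfrak{p}_\ell\mathfrak{a})$ is a doubly well-rounded form of index $\ell$. Conversely, every doubly well-rounded form of prime index $\ell$ occurs in this way, up to orthogonal transformations and homotheties, for some such $\mathcal{O}$, $\mathfrak{a}$, $\mathfrak{p}_\ell$.
   Context: A lattice in $\mathbb{R}^2\cong\mathbb{C}$ is the $\mathbb{Z}$-span of an $\mathbb{R}$-basis; $\langle\,,\rangle$ is the standard dot product; a homothety is multiplication by a positive real scalar. Let $\ell$ be a prime, $L$ a lattice and $M\subset L$ a sublattice of index $\ell$. The pair $(L,M)$ is a tempered perfect lattice (or form) of index $\ell$ if, after rescaling $L$ and $M$ by a common positive scalar, there exist non-empty sets $S\subset L-M$ and $S'\subset M-\{0\}$ such that, with $A(v)=\langle v,v\rangle$: (i) $A(v)=1$ for all $v\in S$; (ii) $A(v)>1$ for all $v\in L-M$ with $v\notin S$; (iii) $A(v)$ has a common value $u\geqslant 1$ for all $v\in S'$; (iv) $A(v)>u$ for all $v\in M-\{0\}$ with $v\notin S'$; (v) if $B$ is any positive definite quadratic form on $\mathbb{R}^2$ satisfying (i)--(iv) in place of $A$ with the same $S,S'$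 and with common value $u'$ on $S'$, then $B=A$ and $u'=u$. It is an $s$-and-$s'$ form if $S$ consists of $s$ pairs $\pm v$ and $S'$ consists of $s'$ pairs $\pm v$, and doubly well-rounded if $s\geqslant2$ and $s'\geqslant2$. For an imaginary quadratic field $K\subset\mathbb{C}$, a fractional ideal in $K$ is a finitely generated $\mathbb{Z}$-submodule $L$ of $K$ spanning $K$ over $\mathbb{Q}$; its coefficient ring is $\{\alpha\in K\mid\alpha L\subseteq L\}$. It is proper for the order $\mathcal{O}$ if its coefficient ring equals $\mathcal{O}$. Two fractional ideals are similar if they differ by multiplication by a nonzero element of $K$; proper ideal classes are similarity classes of proper fractional ideals of $\mathcal{O}$. The norm of a proper ideal $I\subseteq\mathcal{O}$ is $[\mathcal{O}:I]$. A lattice is well rounded if its nonzero vectors of minimal length contain a $\mathbb{Z}$-basis of it; a class is well rounded if its members are well-rounded lattices in $\mathbb{C}$. *)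

theory Defs
  imports "HOL-Algebra.Algebraic_Closure_Type" "HOL-Algebra.Ideal_Product" "HOL-Analysis.Analysis"
begin

global_interpretation zmod: Modules.module "\<lambda>(k::int) (z::complex). of_int k * z"
  by unfold_locales (auto simp: algebra_simps)

global_interpretation qvec: vector_space "\<lambda>(q::rat) (z::complex). of_rat q * z"
  by unfold_locales (auto simp: algebra_simps of_rat_add of_rat_mult)

definition is_lattice :: "complex set \<Rightarrow> bool" where
  "is_lattice L \<longleftrightarrow> (\<exists>B. Real_Vector_Spaces.independent B \<and> Real_Vector_Spaces.span B = UNIV \<and> L = zmod.span B)"

definition z_basis :: "complex set \<Rightarrow> complex set \<Rightarrow> bool" where
  "z_basis B L \<longleftrightarrow> zmod.independent B \<and> zmod.span B = L"

definition min_vectors :: "complex set \<Rightarrow> complex set" where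
  "min_vectors L = {v \<in> L - {0}. \<forall>w \<in> L - {0}. norm v \<le> norm w}"

definition well_rounded :: "complex set \<Rightarrow> bool" where
  "well_rounded L \<longleftrightarrow> is_lattice L \<and> (\<exists>B \<subseteq> min_vectors L. z_basis B L)"

text \<open>Number of additive cosets of \<open>M\<close> in \<open>L\<close>; an infinite index is recorded as \<open>0\<close>.\<close>

definition add_index :: "complex set \<Rightarrow> complex set \<Rightarrow> nat" where
  "add_index L M = card (a_rcosets\<^bsub>ring_of_type_algebra\<lparr>carrier := L\<rparr>\<^esub> M)"

definition pos_def_quadratic_form :: "(complex \<Rightarrow> real) \<Rightarrow> bool" where
  "pos_def_quadratic_form Q \<longleftrightarrow>
     (\<exists>b. bilinear b \<and> (\<forall>x y. b x y = b y x) \<and> (\<forall>x. Q x = b x x)) \<and> (\<forall>x. x \<noteq> 0 \<longrightarrow> Q x > 0)"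

definition form_conditions ::
    "complex set \<Rightarrow> complex set \<Rightarrow> complex set \<Rightarrow> complex set \<Rightarrow> (complex \<Rightarrow> real) \<Rightarrow> real \<Rightarrow> bool" where
  "form_conditions L M S S' Q u \<longleftrightarrow>
     (\<forall>v\<in>S. Q v = 1) \<and> (\<forall>v\<in>L - M. v \<notin> S \<longrightarrow> Q v > 1) \<and>
     u \<ge> 1 \<and> (\<forall>v\<in>S'. Q v = u) \<and> (\<forall>v\<in>M - {0}. v \<notin> S' \<longrightarrow> Q v > u)"

definition tempered_perfect_with ::
    "complex set \<Rightarrow> complex set \<Rightarrow> complex set \<Rightarrow> complex set \<Rightarrow> bool" where
  "tempered_perfect_with L M S S' \<longleftrightarrow>
     S \<noteq> {} \<and> S \<subseteq> L - M \<and> S' \<noteq> {} \<and> S' \<subseteq> M - {0} \<and>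
     (\<exists>u. form_conditions L M S S' (\<lambda>v. v \<bullet> v) u \<and>
       (\<forall>B u'. pos_def_quadratic_form B \<and> form_conditions L M S S' B u' \<longrightarrow>
          B = (\<lambda>v. v \<bullet> v) \<and> u' = u))"

definition consists_of_pairs :: "nat \<Rightarrow> complex set \<Rightarrow> bool" where
  "consists_of_pairs s S \<longleftrightarrow>
     (\<exists>P. finite P \<and> card P = s \<and> (\<forall>p\<in>P. \<exists>v. p = {v, - v}) \<and> S = \<Union>P)"

text \<open>\<open>tempered_form_of_type l s s' L M\<close>: the pair is an \<open>s\<close>-and-\<open>s'\<close> tempered perfect form of
  index \<open>l\<close>; both lattices are rescaled by the same \<open>c\<close>.\<close>

definition tempered_form_of_type :: "nat \<Rightarrow> nat \<Rightarrow> nat \<Rightarrow> complex set \<Rightarrow> complex set \<Rightarrow> bool" where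
  "tempered_form_of_type l s s' L M \<longleftrightarrow>
     Factorial_Ring.prime l \<and> is_lattice L \<and> is_lattice M \<and> M \<subseteq> L \<and> add_index L M = l \<and>
     (\<exists>c>0. \<exists>S S'. tempered_perfect_with ((*\<^sub>R) c ` L) ((*\<^sub>R) c ` M) S S' \<and>
        consists_of_pairs s S \<and> consists_of_pairs s' S')"

definition doubly_well_rounded :: "nat \<Rightarrow> complex set \<Rightarrow> complex set \<Rightarrow> bool" where
  "doubly_well_rounded l L M \<longleftrightarrow> (\<exists>s\<ge>2. \<exists>s'\<ge>2. tempered_form_of_type l s s' L M)"

definition imaginary_quadratic_field :: "complex set \<Rightarrow> bool" where
  "imaginary_quadratic_field K \<longleftrightarrow>
     subfield K ring_of_type_algebra \<and> qvec.dim K = 2 \<and> \<not> K \<subseteq> \<real>"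

definition fractional_ideal :: "complex set \<Rightarrow> complex set \<Rightarrow> bool" where
  "fractional_ideal K L \<longleftrightarrow> (\<exists>B. finite B \<and> L = zmod.span B) \<and> qvec.span L = K"

definition is_order :: "complex set \<Rightarrow> complex set \<Rightarrow> bool" where
  "is_order K R \<longleftrightarrow> subring R ring_of_type_algebra \<and> fractional_ideal K R"

abbreviation order_ring :: "complex set \<Rightarrow> complex ring" where
  "order_ring R \<equiv> ring_of_type_algebra\<lparr>carrier := R\<rparr>"

definition coefficient_ring :: "complex set \<Rightarrow> complex set \<Rightarrow> complex set" where
  "coefficient_ring K L = {\<alpha> \<in> K. \<forall>x\<in>L. \<alpha> * x \<in> L}"

text \<open>Proper means that the coefficient ring equals the order, not that the ideal is a proper subset.\<close>

definition proper_fractional_ideals :: "complex set \<Rightarrow> complex set \<Rightarrow> complex set set" where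
  "proper_fractional_ideals K R = {L. fractional_ideal K L \<and> coefficient_ring K L = R}"

definition proper_ideal_classes :: "complex set \<Rightarrow> complex set \<Rightarrow> complex set set set" where
  "proper_ideal_classes K R = proper_fractional_ideals K R //
     {(I, J). I \<in> proper_fractional_ideals K R \<and> J \<in> proper_fractional_ideals K R \<and>
              (\<exists>\<gamma>\<in>K. \<gamma> \<noteq> 0 \<and> J = (*) \<gamma> ` I)}"

definition well_rounded_class :: "complex set set \<Rightarrow> bool" where
  "well_rounded_class \<C> \<longleftrightarrow> (\<forall>L\<in>\<C>. well_rounded L)"

definition well_rounded_ideal_pair ::
    "nat \<Rightarrow> complex set \<Rightarrow> complex set \<Rightarrow> complex set \<Rightarrow> complex set \<Rightarrow> bool" where
  "well_rounded_ideal_pair l K R \<aa> \<pp> \<longleftrightarrow>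
     ideal \<aa> (order_ring R) \<and>
     (\<exists>\<C>\<in>proper_ideal_classes K R. well_rounded_class \<C> \<and> \<aa> \<in> \<C>) \<and>
     primeideal \<pp> (order_ring R) \<and> \<pp> \<in> proper_fractional_ideals K R \<and> add_index R \<pp> = l \<and>
     (\<exists>\<C>'\<in>proper_ideal_classes K R. well_rounded_class \<C>' \<and> \<pp> \<cdot>\<^bsub>order_ring R\<^esub> \<aa> \<in> \<C>')"

end

theory Submission
  imports Defs
begin

text \<open>
  Two independent minimal vectors of a planar lattice generate it, so a well-rounded \<open>L\<close> has
  the form \<open>\<int>v\<^sub>1 + \<int>v\<^sub>2\<close> with \<open>\<bar>v\<^sub>1\<bar> = \<bar>v\<^sub>2\<bar>\<close>. If \<open>M \<subset> L\<close> has prime index and both are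
  well rounded, no minimal vector of \<open>L\<close> lies in \<open>M\<close>. A form taking equal values on \<open>v\<^sub>1, v\<^sub>2\<close>
  and on the basis \<open>w\<^sub>1, w\<^sub>2\<close> of \<open>M\<close> is then determined up to scaling, unless \<open>M\<close> is
  rhombic along the axes of \<open>L\<close>; in that case \<open>l = 3\<close>, \<open>L\<close> is hexagonal, and the third pair of
  minimal vectors of \<open>L\<close> supplies the missing equation. It remains to compare indices: ideals
  proper for an order in a quadratic field are invertible, so multiplication by \<open>\<aa>\<close> turns
  \<open>[\<O> : \<pp>] = l\<close> into \<open>[\<aa> : \<pp>\<aa>] = l\<close>.

  For the converse, the reflection exchanging \<open>w\<^sub>1\<close> and \<open>w\<^sub>2\<close> maps \<open>L\<close> to a multiple \<open>\<gamma>L\<close>. If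
  \<open>\<gamma>L \<noteq> L\<close>, then \<open>M = L \<inter> \<gamma>L\<close>, so multipliers of \<open>L\<close> are multipliers of \<open>M\<close>, and \<open>l\<gamma>\<close> is a
  non-real multiplier; if \<open>\<gamma>L = L\<close>, then \<open>L\<close> is square or hexagonal. Applied to \<open>(L, M)\<close>
  and to \<open>(M, lL)\<close> this shows that \<open>L\<close> and \<open>M\<close> have the same multiplier ring \<open>\<O>\<close>, an
  imaginary quadratic order, and \<open>\<pp> = ML\<^sup>-\<^sup>1\<close> is the required prime ideal.
\<close>

section \<open>Reduced bases of planar lattices\<close>


text \<open>As rewrite rules, the scaling laws of the interpretations \<open>zmod\<close> and \<open>qvec\<close> undo
  the normal forms of products and make the simplifier loop.\<close>

declare zmod.scale_scale [simp del] qvec.scale_scale [simp del]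

text \<open>After normalising \<open>v1\<close> and \<open>v2\<close>, a quadratic form has one free
  parameter, its mixed coefficient. Equality on \<open>w1\<close> and \<open>w2\<close> is a linear
  equation for it, which becomes vacuous exactly when \<open>w2\<close> has the coordinates of
  \<open>w1\<close> exchanged, up to a common sign. Then the diagonals of the two basis rhombi are
  parallel. For a reduced basis the ratio of the squared diagonals lies between 1/3 and 3, and
  passing from \<open>L\<close> to \<open>M\<close> changes it by the factor
  \<open>l\<^sup>2\<close> or \<open>1 / l\<^sup>2\<close>; so \<open>l \<le> 3\<close>, and parity
  leaves 3. This is the origin of the hexagonal exception.

  The obstacle in the converse is to produce complex multiplication from mere equality of lengths. A
  reflection is antilinear, but since \<open>v1\<close> and \<open>v2\<close> are equally long,
  \<open>L\<close> has a reflection of its own that exchanges them, and the composite of two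
  reflections is complex linear, hence multiplication by some \<gamma>.\<close>

definition lat :: "complex \<Rightarrow> complex \<Rightarrow> complex set" where
  "lat u v = {of_int a * u + of_int b * v | a b. True}"

text \<open>\<open>Im (cnj u * v)\<close> is the determinant of \<open>u\<close> and
  \<open>v\<close> as vectors of the real plane; the real part of the same product is
  \<open>u \<bullet> v\<close>.\<close>

definition indep_pair :: "complex \<Rightarrow> complex \<Rightarrow> bool" where
  "indep_pair u v \<longleftrightarrow> Im (cnj u * v) \<noteq> 0"

text \<open>Lagrange-Gauss reduction for a basis of two equally long vectors: the angle between them
  lies between 60 and 120 degrees.\<close>

definition reduced_pair :: "complex \<Rightarrow> complex \<Rightarrow> bool" where
  "reduced_pair u v \<longleftrightarrow> indep_pair u v \<and> norm u = norm v \<and> 2 * \<bar>u \<bullet> v\<bar> \<le> (norm u)\<^sup>2"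

lemma latI: "of_int a * u + of_int b * v \<in> lat u v"
  by (auto simp: lat_def)

lemma latE:
  assumes "z \<in> lat u v"
  obtains a b where "z = of_int a * u + of_int b * v"
  using assms by (auto simp: lat_def)

lemma lat_eq_span: "lat u v = zmod.span {u, v}"
proof
  show "lat u v \<subseteq> zmod.span {u, v}"
    by (auto simp: lat_def intro!: zmod.span_add zmod.span_scale[OF zmod.span_base])
next
  have "zmod.subspace (lat u v)"
  proof (rule zmod.subspaceI)
    show "0 \<in> lat u v" using latI[of 0 u 0 v] by simp
  next
    fix x y assume "x \<in> lat u v" "y \<in> lat u v"
    then obtain a b c d where "x = of_int a * u + of_int b * v" "y = of_int c * u + of_int d * v"
      by (auto simp: lat_def)
    then show "x + y \<in> lat u v" using latI[of "a + c" u "b + d" v] by (simp add: algebra_simps)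
  next
    fix c x assume "x \<in> lat u v"
    then obtain a b where "x = of_int a * u + of_int b * v"
      by (auto simp: lat_def)
    then show "of_int c * x \<in> lat u v"
      using latI[of "c * a" u "c * b" v] by (simp add: algebra_simps)
  qed
  moreover have "{u, v} \<subseteq> lat u v"
    using latI[of 1 u 0 v] latI[of 0 u 1 v] by simp
  ultimately show "zmod.span {u, v} \<subseteq> lat u v"
    by (rule zmod.span_minimal[rotated])
qed

lemma subspace_lat [simp, intro]: "zmod.subspace (lat u v)"
  by (simp add: lat_eq_span)

lemma lat_gens [simp]: "u \<in> lat u v" "v \<in> lat u v"
  by (simp_all add: lat_eq_span zmod.span_base)

lemma lat_subset:
  assumes "zmod.subspace M" "u \<in> M" "v \<in> M"
  shows "lat u v \<subseteq> M"
  unfolding lat_eq_span using assms by (intro zmod.span_minimal) auto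

lemma image_mult_lat: "(*) \<gamma> ` lat u v = lat (\<gamma> * u) (\<gamma> * v)"
proof -
  have "(\<lambda>z. \<gamma> * z) (of_int a * u + of_int b * v) = of_int a * (\<gamma> * u) + of_int b * (\<gamma> * v)" for a b
    by (simp add: algebra_simps)
  then show ?thesis unfolding lat_def by (auto simp: image_def) metis+
qed

lemma indep_pair_sym: "indep_pair u v \<Longrightarrow> indep_pair v u"
  by (auto simp: indep_pair_def algebra_simps)

lemma indep_pair_nz: assumes "indep_pair u v" shows "u \<noteq> 0" "v \<noteq> 0"
  using assms by (auto simp: indep_pair_def)

lemma indep_pair_unique_real:
  assumes "indep_pair u v" "of_real a * u + of_real b * v = of_real c * u + of_real d * v"
  shows "a = c" "b = d"
proof -
  define x where "x = of_real (a - c) * u + of_real (b - d) * v"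
  have "x = 0" using assms(2) by (simp add: x_def algebra_simps)
  have "Im (cnj x * v) = (a - c) * Im (cnj u * v)" "Im (cnj u * x) = (b - d) * Im (cnj u * v)"
    by (simp_all add: x_def algebra_simps)
  then have "(a - c) * Im (cnj u * v) = 0" "(b - d) * Im (cnj u * v) = 0"
    unfolding \<open>x = 0\<close> by auto
  then show "a = c" "b = d"
    using assms(1) unfolding indep_pair_def by (metis mult_eq_0_iff eq_iff_diff_eq_0)+
qed

lemma indep_pair_unique:
  assumes "indep_pair u v" "of_int a * u + of_int b * v = of_int c * u + of_int d * v"
  shows "a = c" "b = d"
  using indep_pair_unique_real[OF assms(1), of "of_int a" "of_int b" "of_int c" "of_int d"] assms(2) by auto

lemma indep_pair_coords:
  assumes "indep_pair u v"
  obtains a b where "z = of_real a * u + of_real b * v"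
proof -
  let ?D = "Im (cnj u * v)"
  have D: "?D \<noteq> 0" using assms by (simp add: indep_pair_def)
  have *: "of_real ?D * z = of_real (- Im (cnj v * z)) * u + of_real (Im (cnj u * z)) * v"
    by (simp add: complex_eq_iff algebra_simps)
  have "z = (of_real ?D * z) / of_real ?D" using D by (simp del: times_complex.sel)
  also have "\<dots> = of_real (- Im (cnj v * z) / ?D) * u + of_real (Im (cnj u * z) / ?D) * v"
    unfolding * by (simp add: add_divide_distrib diff_divide_distrib del: times_complex.sel)
  finally have "z = of_real (- Im (cnj v * z) / ?D) * u + of_real (Im (cnj u * z) / ?D) * v" .
  then show ?thesis by (rule that)
qed

lemma Im_of_real_mult: "Im (of_real r * z) = r * Im z"
  by simp

lemma indep_pair_mult: "\<gamma> \<noteq> 0 \<Longrightarrow> indep_pair (\<gamma> * u) (\<gamma> * v) \<longleftrightarrow> indep_pair u v"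
proof -
  assume "\<gamma> \<noteq> 0"
  have "cnj (\<gamma> * u) * (\<gamma> * v) = of_real ((norm \<gamma>)\<^sup>2) * (cnj u * v)"
    by (simp add: complex_norm_square algebra_simps del: of_real_power)
  then have "Im (cnj (\<gamma> * u) * (\<gamma> * v)) = (norm \<gamma>)\<^sup>2 * Im (cnj u * v)"
    by (simp only: Im_of_real_mult)
  then show ?thesis using \<open>\<gamma> \<noteq> 0\<close> by (simp add: indep_pair_def)
qed

lemma is_lattice_iff: "is_lattice L \<longleftrightarrow> (\<exists>u v. indep_pair u v \<and> L = lat u v)"
proof
  assume "is_lattice L"
  then obtain B where B: "independent B" "span B = UNIV" "L = zmod.span B"
    by (auto simp: is_lattice_def)
  have "card B = dim (UNIV :: complex set)"
    using B dim_eq_card[of B UNIV] by simp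
  then have "card B = 2" by simp
  then obtain u v where uv: "B = {u, v}" by (auto simp: card_2_iff)
  have "u \<noteq> 0" using B(1) dependent_zero[of B] uv by auto
  have "indep_pair u v"
  proof (rule ccontr)
    assume "\<not> indep_pair u v"
    then have "{u, v} \<subseteq> {z. Im (cnj u * z) = 0}" by (auto simp: indep_pair_def)
    moreover have "subspace {z. Im (cnj u * z) = 0}"
      by (auto simp: subspace_def distrib_left right_diff_distrib simp del: times_complex.sel)
    ultimately have "span {u, v} \<subseteq> {z. Im (cnj u * z) = 0}"
      by (rule span_minimal)
    then have "Im (cnj u * (\<i> * u)) = 0" using B(2) uv by blast
    then have "(Re u)\<^sup>2 + (Im u)\<^sup>2 = 0" by (simp add: power2_eq_square)
    then show False using \<open>u \<noteq> 0\<close> by (simp add: sum_power2_eq_zero_iff complex_eq_iff)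
  qed
  then show "\<exists>u v. indep_pair u v \<and> L = lat u v" using B uv by (auto simp: lat_eq_span)
next
  assume "\<exists>u v. indep_pair u v \<and> L = lat u v"
  then obtain u v where uv: "indep_pair u v" "L = lat u v" by blast
  have "span {u, v} = UNIV"
  proof safe
    fix z :: complex obtain a b where "z = of_real a * u + of_real b * v"
      using indep_pair_coords[OF uv(1)] .
    then have "z = a *\<^sub>R u + b *\<^sub>R v" by (simp add: scaleR_conv_of_real)
    then show "z \<in> span {u, v}" by (simp add: span_add span_scale span_base)
  qed simp
  moreover have "independent {u, v}"
  proof -
    have "card {u, v} \<le> dim (UNIV :: complex set)"
      by (simp add: card_insert_if)
    then show ?thesis
      using card_le_dim_spanning[of "{u,v}" UNIV] \<open>span {u, v} = UNIV\<close> by auto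
  qed
  ultimately show "is_lattice L" unfolding is_lattice_def uv(2) lat_eq_span by blast
qed

lemma norm_comb:
  fixes u v :: complex
  shows
  "(norm (of_real a * u + of_real b * v))\<^sup>2 = a\<^sup>2 * (norm u)\<^sup>2 + b\<^sup>2 * (norm v)\<^sup>2 + 2 * a * b * (u \<bullet> v)"
  by (simp add: cmod_power2 inner_complex_def) (simp add: power2_eq_square algebra_simps)

lemma norm_comb_int:
  fixes u v :: complex
  shows
  "(norm (of_int a * u + of_int b * v))\<^sup>2
    = of_int a^2 * (norm u)\<^sup>2 + of_int b^2 * (norm v)\<^sup>2 + 2 * of_int a * of_int b * (u \<bullet> v)"
  using norm_comb[of "of_int a" u "of_int b" v] by simp

lemma int_form_ge: "\<lbrakk>a \<noteq> 0 \<or> b \<noteq> 0\<rbrakk> \<Longrightarrow> a^2 + b^2 - \<bar>a * b\<bar> \<ge> (1::int)"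
proof -
  assume *: "a \<noteq> 0 \<or> b \<noteq> 0"
  have "a^2 + b^2 - \<bar>a * b\<bar> = (\<bar>a\<bar> - \<bar>b\<bar>)^2 + \<bar>a\<bar> * \<bar>b\<bar>"
    by (simp add: power2_eq_square abs_mult algebra_simps)
  moreover have "\<dots> > 0"
  proof (cases "a = 0 \<or> b = 0")
    case False
    then have "\<bar>a\<bar> * \<bar>b\<bar> > 0" by simp
    then show ?thesis by (smt (verit) zero_le_power2)
  qed (use * in auto)
  ultimately show ?thesis by linarith
qed

text \<open>The bound is the form of the hexagonal lattice with the same minimal length, the extreme
  case of the angle condition, with the mixed term taken negative.\<close>

lemma reduced_pair_lower:
  assumes "reduced_pair u v"
  shows "(norm (of_int a * u + of_int b * v))\<^sup>2 \<ge> of_int (a^2 + b^2 - \<bar>a * b\<bar>) * (norm u)\<^sup>2"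
proof -
  have *: "norm v = norm u" "2 * \<bar>u \<bullet> v\<bar> \<le> (norm u)\<^sup>2" using assms by (auto simp: reduced_pair_def)
  have "\<bar>2 * of_int a * of_int b * (u \<bullet> v)\<bar> = \<bar>of_int a * of_int b\<bar> * (2 * \<bar>u \<bullet> v\<bar>)"
    by (simp add: abs_mult)
  also have "\<dots> \<le> \<bar>of_int a * of_int b\<bar> * (norm u)\<^sup>2"
    by (intro mult_left_mono *) auto
  finally show ?thesis unfolding norm_comb_int *(1) by (simp add: algebra_simps)
qed

lemma reduced_pair_min:
  assumes "reduced_pair u v" "z \<in> lat u v" "z \<noteq> 0"
  shows "norm z \<ge> norm u"
proof -
  obtain a b where z: "z = of_int a * u + of_int b * v" using assms(2) by (rule latE)
  have "a \<noteq> 0 \<or> b \<noteq> 0" using z assms(3) by auto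
  then have "1 * (norm u)\<^sup>2 \<le> of_int (a^2 + b^2 - \<bar>a * b\<bar>) * (norm u)\<^sup>2"
    using int_form_ge[of a b] by (intro mult_right_mono) (auto simp del: of_int_diff of_int_add)
  then have "(norm u)\<^sup>2 \<le> (norm z)\<^sup>2"
    using reduced_pair_lower[OF assms(1), of a b] unfolding z mult_1 by (rule order_trans)
  then show ?thesis by (simp add: abs_le_square_iff)
qed

lemma reduced_pair_finite:
  assumes "reduced_pair u v"
  shows "finite {z \<in> lat u v. norm z \<le> C}"
proof -
  have r: "norm u > 0" using assms by (auto simp: reduced_pair_def indep_pair_def)
  \<comment> \<open>The factor 2 stems from a^2 + b^2 \<le> 2 (a^2 + b^2 - |ab|), which says that
    (|a| - |b|)^2 \<ge> 0.\<close>
  define N where "N = \<lceil>2 * (C / norm u)\<^sup>2\<rceil>"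
  have "{z \<in> lat u v. norm z \<le> C} \<subseteq>
    (\<lambda>(a,b). of_int a * u + of_int b * v) ` ({- N..N} \<times> {- N..N})"
  proof safe
    fix z assume "z \<in> lat u v" and C: "norm z \<le> C"
    then obtain a b where z: "z = of_int a * u + of_int b * v" by (auto elim: latE)
    have "a^2 + b^2 \<le> 2 * (a^2 + b^2 - \<bar>a * b\<bar>)"
      using zero_le_power2[of "\<bar>a\<bar> - \<bar>b\<bar>"] by (simp add: power2_eq_square abs_mult algebra_simps)
    then have "real_of_int (a^2 + b^2) * (norm u)\<^sup>2 \<le> of_int (2 * (a^2 + b^2 - \<bar>a * b\<bar>)) * (norm u)\<^sup>2"
      by (intro mult_right_mono) (auto simp only: of_int_le_iff zero_le_power2)
    also have "\<dots> \<le> 2 * (norm z)\<^sup>2"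
      using reduced_pair_lower[OF assms, of a b] unfolding z of_int_mult mult.assoc by simp
    also have "\<dots> \<le> 2 * C\<^sup>2" using C by (simp add: power_mono)
    finally have "real_of_int (a^2 + b^2) \<le> 2 * (C / norm u)\<^sup>2"
      using r by (simp add: field_simps)
    then have "a^2 + b^2 \<le> N" unfolding N_def by linarith
    moreover have "\<bar>a\<bar> \<le> a^2" "\<bar>b\<bar> \<le> b^2"
      by (metis abs_ge_zero power2_abs self_le_power pos2 abs_0 linorder_not_le order_less_le
        power_zero_numeral zero_less_abs_iff int_one_le_iff_zero_less order_refl)+
    moreover have "a^2 \<ge> 0" "b^2 \<ge> 0" by simp_all
    ultimately have "a \<in> {-N..N}" "b \<in> {-N..N}" by (auto simp: abs_le_iff)
    then show "z \<in> (\<lambda>(a,b). of_int a * u + of_int b * v) ` ({- N..N} \<times> {- N..N})"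
      using z by force
  qed
  then show ?thesis by (rule finite_subset) auto
qed

text \<open>Lagrange's identity: the squared inner product and the squared determinant add up to
  \<open>(norm u * norm v)\<^sup>2\<close>.\<close>

lemma indep_pair_inner_less:
  assumes "indep_pair u v"
  shows "\<bar>u \<bullet> v\<bar> < norm u * norm v"
proof -
  have "(u \<bullet> v)\<^sup>2 + (Im (cnj u * v))\<^sup>2 = (norm u * norm v)\<^sup>2"
    by (simp add: power_mult_distrib cmod_power2 inner_complex_def) (simp add: power2_eq_square algebra_simps)
  moreover have "(Im (cnj u * v))\<^sup>2 > 0" using assms by (simp add: indep_pair_def)
  ultimately have "(u \<bullet> v)\<^sup>2 < (norm u * norm v)\<^sup>2" by linarith
  then show ?thesis using abs_le_square_iff[of "norm u * norm v" "u \<bullet> v"] by (simp add: abs_mult)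
qed

text \<open>Rounding the real coordinates of a lattice vector leaves a remainder in \<open>L\<close>
  whose coordinates are at most 1/2 in absolute value. Such a remainder is strictly shorter than
  \<open>u\<close>, hence zero. The angle bound follows because \<open>u + v\<close> and
  \<open>u - v\<close> are nonzero vectors of \<open>L\<close>.\<close>

lemma min_vectors_generate:
  assumes "zmod.subspace L" "u \<in> min_vectors L" "v \<in> min_vectors L" "indep_pair u v"
  shows "L = lat u v" "reduced_pair u v"
proof -
  have uv: "u \<in> L" "v \<in> L" "u \<noteq> 0" "v \<noteq> 0"
    and min: "\<And>w. w \<in> L \<Longrightarrow> w \<noteq> 0 \<Longrightarrow> norm u \<le> norm w"
    using assms by (auto simp: min_vectors_def)
  have eq: "norm v = norm u" using assms(2,3) by (auto simp: min_vectors_def intro!: antisym)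
  show "L = lat u v"
  proof
    show "lat u v \<subseteq> L" using assms(1) uv by (intro lat_subset)
  next
    show "L \<subseteq> lat u v"
    proof
      fix z assume "z \<in> L"
      obtain x y where z: "z = of_real x * u + of_real y * v" using indep_pair_coords[OF assms(4)] .
      define a b where "a = x - of_int (round x)" and "b = y - of_int (round y)"
      let ?w = "of_real a * u + of_real b * v"
      let ?l = "of_int (round x) * u + of_int (round y) * v"
      have "?l \<in> L" using lat_subset[OF assms(1) uv(1,2)] latI by blast
      moreover have w: "?w = z - ?l" unfolding z a_def b_def by (simp add: algebra_simps)
      ultimately have "?w \<in> L" using assms(1) \<open>z \<in> L\<close> zmod.subspace_diff by metis
      have ab: "\<bar>a\<bar> \<le> 1/2" "\<bar>b\<bar> \<le> 1/2"
        using of_int_round_abs_le[of x] of_int_round_abs_le[of y] unfolding a_def b_def by linarith+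
      have sq: "(norm ?w)\<^sup>2 = (a\<^sup>2 + b\<^sup>2) * (norm u)\<^sup>2 + 2 * a * b * (u \<bullet> v)"
        unfolding norm_comb eq by (simp add: algebra_simps)
      have "(norm ?w)\<^sup>2 < (norm u)\<^sup>2"
      \<comment> \<open>Strictness has two sources: if a coordinate vanishes, a^2 + b^2 is at most
        1/2; otherwise strict Cauchy-Schwarz puts the squared norm below (|a| + |b|)^2 |u|^2, and
        |a| + |b| \<le> 1.\<close>
      proof (cases "a * b = 0")
        case True
        have "a\<^sup>2 \<le> (1/2)\<^sup>2" "b\<^sup>2 \<le> (1/2)\<^sup>2"
          using ab by (metis abs_le_square_iff abs_of_pos half_gt_zero zero_less_one)+
        then have "(a\<^sup>2 + b\<^sup>2) * (norm u)\<^sup>2 \<le> (1/2) * (norm u)\<^sup>2"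
          by (intro mult_right_mono) (auto simp: power2_eq_square)
        moreover have "2 * a * b = 0" using True by simp
        moreover have "(norm u)\<^sup>2 > 0" using uv by simp
        ultimately show ?thesis unfolding sq \<open>2 * a * b = 0\<close> mult_zero_left by linarith
      next
        case False
        have "2 * a * b * (u \<bullet> v) \<le> \<bar>2 * a * b * (u \<bullet> v)\<bar>" by simp
        also have "\<dots> = 2 * \<bar>a * b\<bar> * \<bar>u \<bullet> v\<bar>" by (simp add: abs_mult)
        also have "\<dots> < 2 * \<bar>a * b\<bar> * (norm u)\<^sup>2"
          using indep_pair_inner_less[OF assms(4)] False eq by (intro mult_strict_left_mono) (auto simp: power2_eq_square)
        finally have "(norm ?w)\<^sup>2 < (\<bar>a\<bar> + \<bar>b\<bar>)\<^sup>2 * (norm u)\<^sup>2"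
          unfolding sq by (simp add: power2_eq_square abs_mult algebra_simps)
        also have "\<dots> \<le> 1\<^sup>2 * (norm u)\<^sup>2"
          using ab by (intro mult_right_mono power_mono) auto
        finally show ?thesis by simp
      qed
      then have "norm ?w < norm u" by (rule power_less_imp_less_base) simp
      then have "?w = 0" using min \<open>?w \<in> L\<close> by fastforce
      then have "z = ?l" using w by simp
      then show "z \<in> lat u v" using latI by simp
    qed
  qed
  have "u + v \<in> L" "u - v \<in> L"
    using assms(1) uv by (auto intro: zmod.subspace_add zmod.subspace_diff)
  moreover have "u + v \<noteq> 0" "u - v \<noteq> 0"
    using indep_pair_unique[OF assms(4), of 1 1 0 0] indep_pair_unique[OF assms(4), of 1 "-1" 0 0] by auto
  ultimately have "(norm u)\<^sup>2 \<le> (norm (u + v))\<^sup>2" "(norm u)\<^sup>2 \<le> (norm (u - v))\<^sup>2"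
    using min by (auto intro!: power_mono)
  moreover have "(norm (u + v))\<^sup>2 = 2 * (norm u)\<^sup>2 + 2 * (u \<bullet> v)"
    "(norm (u - v))\<^sup>2 = 2 * (norm u)\<^sup>2 - 2 * (u \<bullet> v)"
    using norm_comb_int[of 1 u 1 v] norm_comb_int[of 1 u "-1" v] eq by simp_all
  ultimately have "2 * \<bar>u \<bullet> v\<bar> \<le> (norm u)\<^sup>2" by linarith
  then show "reduced_pair u v" using assms(4) eq by (simp add: reduced_pair_def)
qed

lemma reduced_pair_gens_min:
  assumes "reduced_pair u v"
  shows "u \<in> min_vectors (lat u v)" "v \<in> min_vectors (lat u v)"
  using assms reduced_pair_min[OF assms] by (auto simp: min_vectors_def reduced_pair_def indep_pair_def)

lemma z_independent_pair:
  assumes "indep_pair u v"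
  shows "zmod.independent {u, v}"
proof -
  have "u \<noteq> v" using assms by (auto simp: indep_pair_def)
  have "f s = 0" if S: "S \<subseteq> {u, v}" "(\<Sum>x\<in>S. of_int (f x) * x) = (0 :: complex)" "s \<in> S" for S f s
  proof -
    define g where "g x = (if x \<in> S then f x else 0)" for x
    have "(\<Sum>x\<in>S. of_int (f x) * x) = (\<Sum>x\<in>{u, v}. of_int (g x) * x)"
      using S by (intro sum.mono_neutral_cong_left) (auto simp: g_def)
    then have "of_int (g u) * u + of_int (g v) * v = of_int 0 * u + of_int 0 * v"
      using S \<open>u \<noteq> v\<close> by simp
    then have "g u = 0" "g v = 0" using indep_pair_unique[OF assms] by blast+
    then show "f s = 0" using S by (auto simp: g_def split: if_splits)
  qed
  then show ?thesis unfolding zmod.dependent_explicit by blast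
qed

text \<open>The working form of well-roundedness. A basis of minimal vectors, of unspecified size,
  must contain two independent ones, since otherwise the whole lattice would lie on one line; such a
  pair already generates.\<close>

lemma well_rounded_iff: "well_rounded L \<longleftrightarrow> (\<exists>u v. reduced_pair u v \<and> L = lat u v)"
proof
  assume L: "well_rounded L"
  then obtain B where B: "B \<subseteq> min_vectors L" "zmod.span B = L"
    by (auto simp: well_rounded_def z_basis_def)
  obtain p q where pq: "indep_pair p q" "L = lat p q"
    using L by (auto simp: well_rounded_def is_lattice_iff)
  have "\<exists>u\<in>B. \<exists>v\<in>B. indep_pair u v"
  proof (rule ccontr)
    assume *: "\<not> (\<exists>u\<in>B. \<exists>v\<in>B. indep_pair u v)"
    have "B \<noteq> {}" using B pq lat_gens[of p q] indep_pair_nz[OF pq(1)] by auto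
    then obtain u where u: "u \<in> B" by auto
    have "u \<noteq> 0" using u B by (auto simp: min_vectors_def)
    let ?H = "{z. Im (cnj u * z) = 0}"
    have "B \<subseteq> ?H" using * u by (auto simp: indep_pair_def)
    moreover have "zmod.subspace ?H"
      by (rule zmod.subspaceI)
        (auto simp: distrib_left mult.left_commute[of "cnj u"] Im_of_real_mult[of "of_int _", unfolded of_real_of_int_eq]
          simp del: times_complex.sel)
    ultimately have "L \<subseteq> ?H" using B(2) zmod.span_minimal[of B ?H] by simp
    then have 0: "Im (cnj u * p) = 0" "Im (cnj u * q) = 0" using pq lat_gens by auto
    have "of_real ((norm u)\<^sup>2) * (cnj p * q) = cnj (cnj u * p) * (cnj u * q)"
      by (simp add: complex_norm_square algebra_simps del: of_real_power)
    then have "(norm u)\<^sup>2 * Im (cnj p * q) = Im (cnj (cnj u * p) * (cnj u * q))"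
      by (metis Im_of_real_mult)
    also have "\<dots> = 0"
      unfolding times_complex.sel(2)[of "cnj (cnj u * p)"] cnj.sel 0 by simp
    finally have "(norm u)\<^sup>2 * Im (cnj p * q) = 0" .
    then show False using pq(1) \<open>u \<noteq> 0\<close> by (simp add: indep_pair_def)
  qed
  then obtain u v where uv: "u \<in> B" "v \<in> B" "indep_pair u v" by blast
  have "zmod.subspace L" using pq by simp
  then show "\<exists>u v. reduced_pair u v \<and> L = lat u v"
    using min_vectors_generate[of L u v] uv B by blast
next
  assume "\<exists>u v. reduced_pair u v \<and> L = lat u v"
  then obtain u v where uv: "reduced_pair u v" "L = lat u v" by blast
  have "indep_pair u v" using uv by (simp add: reduced_pair_def)
  then show "well_rounded L"
    unfolding well_rounded_def is_lattice_iff z_basis_def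
    using reduced_pair_gens_min[OF uv(1)] z_independent_pair uv(2) lat_eq_span
    by (metis empty_subsetI insert_subset)
qed

lemma reduced_pair_mult: "\<gamma> \<noteq> 0 \<Longrightarrow> reduced_pair u v \<Longrightarrow> reduced_pair (\<gamma> * u) (\<gamma> * v)"
proof -
  assume g: "\<gamma> \<noteq> 0" and uv: "reduced_pair u v"
  have "(\<gamma> * u) \<bullet> (\<gamma> * v) = (norm \<gamma>)\<^sup>2 * (u \<bullet> v)"
    by (simp add: cmod_power2 inner_complex_def) (simp add: power2_eq_square algebra_simps)
  then have "2 * \<bar>(\<gamma> * u) \<bullet> (\<gamma> * v)\<bar> = (norm \<gamma>)\<^sup>2 * (2 * \<bar>u \<bullet> v\<bar>)"
    by (simp add: abs_mult)
  also have "\<dots> \<le> (norm \<gamma>)\<^sup>2 * (norm u)\<^sup>2"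
    using uv by (intro mult_left_mono) (auto simp: reduced_pair_def)
  finally show ?thesis
    using uv g by (simp add: reduced_pair_def indep_pair_mult norm_mult power_mult_distrib)
qed

lemma well_rounded_mult: "\<gamma> \<noteq> 0 \<Longrightarrow> well_rounded L \<Longrightarrow> well_rounded ((*) \<gamma> ` L)"
  unfolding well_rounded_iff using reduced_pair_mult image_mult_lat by blast


section \<open>Sublattices of prime index\<close>

text \<open>For a lattice \<open>L\<close> and a prime \<open>l\<close> this says \<open>[L : M] = l\<close>. In this form it passes
  from \<open>(L, M)\<close> to \<open>(M, lL)\<close> and is preserved under multiplication by an invertible ideal.\<close>

definition neighbour :: "nat \<Rightarrow> complex set \<Rightarrow> complex set \<Rightarrow> bool" where
  "neighbour l L M \<longleftrightarrow> zmod.subspace M \<and> M \<subseteq> L \<and> (\<forall>x\<in>L. of_nat l * x \<in> M) \<and>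
     M \<noteq> L \<and> \<not> M \<subseteq> (*) (of_nat l) ` L"

lemma subspace_image_mult:
  assumes "zmod.subspace M"
  shows "zmod.subspace ((*) c ` M)"
proof (rule zmod.subspaceI)
  show "0 \<in> (*) c ` M" using zmod.subspace_0[OF assms] by (auto intro!: image_eqI[of _ _ 0])
  show "x + y \<in> (*) c ` M" if "x \<in> (*) c ` M" "y \<in> (*) c ` M" for x y
    using that zmod.subspace_add[OF assms] by (auto simp: distrib_left[symmetric])
  show "of_int k * x \<in> (*) c ` M" if "x \<in> (*) c ` M" for k x
    using that zmod.subspace_scale[OF assms] by (auto simp: mult.left_commute)
qed

lemma neighbour_mult:
  assumes "\<gamma> \<noteq> 0" "neighbour l L M"
  shows "neighbour l ((*) \<gamma> ` L) ((*) \<gamma> ` M)"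
proof -
  have inj: "inj ((*) \<gamma>)" using assms(1) by (simp add: inj_on_def)
  have "zmod.subspace ((*) \<gamma> ` M)" using assms(2) by (simp add: neighbour_def subspace_image_mult)
  moreover have "(*) (of_nat l) ` (*) \<gamma> ` L = (*) \<gamma> ` (*) (of_nat l) ` L"
    by (simp add: image_image mult.left_commute)
  ultimately show ?thesis
    using assms(2) unfolding neighbour_def
    by (auto simp: inj_image_eq_iff[OF inj] inj_image_subset_iff[OF inj] mult.left_commute)
qed

text \<open>The negative clauses of \<open>neighbour\<close> exchange roles: \<open>M\<close> not
  being inside \<open>lL\<close> makes \<open>lL\<close> different from \<open>M\<close>, and
  \<open>M\<close> being smaller than \<open>L\<close> keeps \<open>lL\<close> from lying inside
  \<open>lM\<close>.\<close>

lemma neighbour_swap: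
  assumes "neighbour l L M" "zmod.subspace L" "l > 0"
  shows "neighbour l M ((*) (of_nat l) ` L)"
proof -
  have inj: "inj ((*) (of_nat l :: complex))" using assms(3) by (simp add: inj_on_def)
  have "zmod.subspace ((*) (of_nat l) ` L)" by (rule subspace_image_mult[OF assms(2)])
  then show ?thesis
    using assms(1) unfolding neighbour_def by (auto simp: inj_image_subset_iff[OF inj])
qed

text \<open>If two vectors of a lattice are independent modulo the prime \<open>l\<close>, Cramer's rule and Bezout
  show that together with \<open>l\<close> times the lattice they generate everything.\<close>

lemma generate_mod_prime:
  fixes a b c d :: int
  assumes "Factorial_Ring.prime l" "\<not> int l dvd a * d - b * c" "zmod.subspace Q"
    and "of_int a * u + of_int b * v \<in> Q" "of_int c * u + of_int d * v \<in> Q"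
    and l: "of_nat l * u \<in> Q" "of_nat l * v \<in> Q"
  shows "lat u v \<subseteq> Q"
proof -
  let ?D = "a * d - b * c"
  have "coprime (int l) ?D" using assms(1,2) by (simp add: prime_imp_coprime)
  then obtain x y where xy: "x * int l + y * ?D = 1"
    by (metis bezout_int coprime_imp_gcd_eq_1)
  note cl = zmod.subspace_add[OF assms(3)] zmod.subspace_diff[OF assms(3)] zmod.subspace_scale[OF assms(3)]
  have 1: "(of_int x * of_nat l + of_int y * (of_int a * of_int d - of_int b * of_int c)) = (1 :: complex)"
    using arg_cong[OF xy, of "of_int :: int \<Rightarrow> complex"] by simp
  have "u = (of_int x * of_nat l + of_int y * (of_int a * of_int d - of_int b * of_int c)) * u"
    unfolding 1 by simp
  also have "\<dots> = of_int x * (of_nat l * u) + of_int y *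
      (of_int d * (of_int a * u + of_int b * v) - of_int b * (of_int c * u + of_int d * v))"
    by (simp add: algebra_simps)
  also have "\<dots> \<in> Q" using assms(4,5) l cl by metis
  finally have u: "u \<in> Q" .
  have "v = (of_int x * of_nat l + of_int y * (of_int a * of_int d - of_int b * of_int c)) * v"
    unfolding 1 by simp
  also have "\<dots> = of_int x * (of_nat l * v) + of_int y *
      (of_int a * (of_int c * u + of_int d * v) - of_int c * (of_int a * u + of_int b * v))"
    by (simp add: algebra_simps)
  also have "\<dots> \<in> Q" using assms(4,5) l cl by metis
  finally have "v \<in> Q" .
  then show ?thesis using u assms(3) by (intro lat_subset)
qed

text \<open>\<open>L / lL\<close> has dimension at most 2 over the field with \<open>l\<close>
  elements, and \<open>M / lL\<close> is neither zero nor everything, so nothing lies strictly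
  between \<open>M\<close> and \<open>L\<close>. In coordinates: for \<open>q\<close> outside
  \<open>M\<close> and \<open>x\<close> in \<open>M\<close> outside \<open>lL\<close>, either the
  determinant is prime to \<open>l\<close>, or \<open>q\<close> is congruent to a multiple of
  \<open>x\<close> and hence lies in \<open>M\<close>.\<close>

lemma neighbour_maximal:
  assumes "Factorial_Ring.prime l" "L = lat u v" "neighbour l L M" "zmod.subspace Q" "M \<subseteq> Q" "Q \<subseteq> L" "Q \<noteq> M"
  shows "Q = L"
proof -
  note nbr = assms(3)[unfolded neighbour_def]
  have M: "zmod.subspace M" using nbr by blast
  obtain q where q: "q \<in> Q" "q \<notin> M" using assms(5,7) by blast
  obtain x where x: "x \<in> M" "x \<notin> (*) (of_nat l) ` L" using nbr by blast
  have "q \<in> L" "x \<in> L" using q x assms(5,6) by auto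
  then obtain a b c d where eq: "x = of_int a * u + of_int b * v" "q = of_int c * u + of_int d * v"
    by (auto simp: assms(2) lat_def)
  have lM: "of_nat l * u \<in> M" "of_nat l * v \<in> M" using nbr assms(2) by auto
  show ?thesis
  proof (cases "int l dvd a * d - b * c")
    case False
    have "L \<subseteq> Q" unfolding assms(2)
      using generate_mod_prime[OF assms(1) False assms(4)] x q lM assms(5) eq by blast
    then show ?thesis using assms(6) by blast
  next
    case True
    have "\<not> (int l dvd a \<and> int l dvd b)"
    proof
      assume "int l dvd a \<and> int l dvd b"
      then obtain a' b' where "a = int l * a'" "b = int l * b'" by (auto elim!: dvdE)
      then have "x = of_nat l * (of_int a' * u + of_int b' * v)" by (simp add: eq algebra_simps)
      then show False using x latI assms(2) by blast
    qed
    then have "coprime (int l) a \<or> coprime (int l) b"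
      using prime_imp_coprime[of "int l" a] prime_imp_coprime[of "int l" b] assms(1) by auto
    \<comment> \<open>\<open>e\<close> is a coordinate of \<open>x\<close> that is invertible modulo
      \<open>l\<close>, and \<open>f\<close> is the same coordinate of \<open>q\<close>. With
      \<open>t\<close> the inverse of \<open>e\<close> modulo \<open>l\<close>, the vector
      \<open>q\<close> is congruent to \<open>t * f\<close> times \<open>x\<close>.\<close>
    then obtain e f where "coprime (int l) e" and e: "e = a \<and> f = c \<or> e = b \<and> f = d"
      by blast
    then obtain s t where st: "s * int l + t * e = 1"
      by (metis bezout_int coprime_imp_gcd_eq_1)
    have "int l dvd e * c - f * a" "int l dvd e * d - f * b"
      using e True by (auto simp: algebra_simps dvd_diff_commute)
    then obtain c0 d0 where "e * c - f * a = int l * c0" "e * d - f * b = int l * d0"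
      unfolding dvd_def by blast
    then have 0: "e * c = int l * c0 + f * a" "e * d = int l * d0 + f * b" by simp_all
    define c' d' where "c' = s * c + t * c0" and "d' = s * d + t * d0"
    have "c = (s * int l + t * e) * c" unfolding st by simp
    also have "\<dots> = int l * (s * c) + t * (e * c)" by (simp add: algebra_simps)
    also have "\<dots> = int l * c' + t * f * a"
      unfolding 0 c'_def by (simp add: algebra_simps)
    finally have c: "c = int l * c' + t * f * a" .
    have "d = (s * int l + t * e) * d" unfolding st by simp
    also have "\<dots> = int l * (s * d) + t * (e * d)" by (simp add: algebra_simps)
    also have "\<dots> = int l * d' + t * f * b"
      unfolding 0 d'_def by (simp add: algebra_simps)
    finally have d: "d = int l * d' + t * f * b" .
    have "q = of_int (int l * c' + t * f * a) * u + of_int (int l * d' + t * f * b) * v"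
      using eq(2) unfolding c[symmetric] d[symmetric] .
    then have "q = of_nat l * (of_int c' * u + of_int d' * v) + of_int (t * f) * x"
      by (simp add: eq(1) algebra_simps)
    moreover have "of_nat l * (of_int c' * u + of_int d' * v) \<in> M"
      using nbr latI assms(2) by blast
    ultimately have "q \<in> M"
      using zmod.subspace_add[OF M] zmod.subspace_scale[OF M] x(1) by metis
    then show ?thesis using q by blast
  qed
qed

text \<open>The matrix expressing \<open>lu\<close>, \<open>lv\<close> through \<open>w\<close>,
  \<open>z\<close>, times the coordinate matrix of \<open>w\<close>, \<open>z\<close>, is
  \<open>l\<close> times the identity, so the determinant divides \<open>l\<^sup>2\<close>. The
  extreme absolute values 1 and \<open>l\<^sup>2\<close> would mean \<open>M = L\<close> and
  \<open>M \<subseteq> lL\<close>.\<close>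

lemma neighbour_det:
  assumes "Factorial_Ring.prime l" "neighbour l (lat u v) (lat w z)"
    and "w = of_int a * u + of_int b * v" "z = of_int c * u + of_int d * v" "indep_pair u v"
  shows "\<bar>a * d - b * c\<bar> = int l"
proof -
  note nbr = assms(2)[unfolded neighbour_def]
  have l0: "l > 0" using assms(1) prime_gt_0_nat by blast
  let ?D = "a * d - b * c"
  have l: "of_nat l * x \<in> lat w z" if "x \<in> lat u v" for x
    using assms(2) that by (simp add: neighbour_def)
  obtain p q where lu: "of_nat l * u = of_int p * w + of_int q * z"
    using l[OF lat_gens(1)] by (rule latE)
  obtain r s where lv: "of_nat l * v = of_int r * w + of_int s * z"
    using l[OF lat_gens(2)] by (rule latE)
  have "of_int (int l) * u + of_int 0 * v = of_int (p * a + q * c) * u + of_int (p * b + q * d) * v"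
    using lu assms(3,4) by (simp add: algebra_simps)
  note 1 = indep_pair_unique[OF assms(5) this]
  have "of_int 0 * u + of_int (int l) * v = of_int (r * a + s * c) * u + of_int (r * b + s * d) * v"
    using lv assms(3,4) by (simp add: algebra_simps)
  note 2 = indep_pair_unique[OF assms(5) this]
  have "(p * s - q * r) * ?D = (p * a + q * c) * (r * b + s * d) - (p * b + q * d) * (r * a + s * c)"
    by (simp add: algebra_simps)
  also have "\<dots> = int l * int l" by (simp flip: 1 2)
  finally have "int l * int l = (p * s - q * r) * ?D" by simp
  then have "\<bar>?D\<bar> dvd int l ^ 2" by (simp add: power2_eq_square)
  then obtain i where i: "i \<le> 2" "\<bar>?D\<bar> = int l ^ i"
    using assms(1) divides_primepow[of "int l" "\<bar>?D\<bar>" 2] by auto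
  have D: "of_int ?D * u = of_int d * w - of_int b * z" "of_int ?D * v = of_int a * z - of_int c * w"
    by (simp_all add: assms(3,4) algebra_simps)
  have "i \<noteq> 0"
  proof
    assume "i = 0"
    then have D1: "?D * ?D = 1" using i by (metis abs_mult_self_eq mult_1 power_0)
    have "of_int ?D * u \<in> lat w z" "of_int ?D * v \<in> lat w z"
      unfolding D by (intro zmod.subspace_diff subspace_lat zmod.subspace_scale lat_gens)+
    then have "of_int ?D * (of_int ?D * u) \<in> lat w z" "of_int ?D * (of_int ?D * v) \<in> lat w z"
      by (blast intro: zmod.subspace_scale subspace_lat)+
    then have "u \<in> lat w z" "v \<in> lat w z"
      unfolding mult.assoc[symmetric] of_int_mult[symmetric] D1 by simp_all
    then have "lat u v \<subseteq> lat w z" by (intro lat_subset) auto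
    then show False using nbr by blast
  qed
  moreover have "i \<noteq> 2"
  proof
    assume "i = 2"
    then have "?D = int l * int l \<or> - ?D = int l * int l" using i by (auto simp: power2_eq_square)
    then obtain e :: int where e: "e = 1 \<or> e = -1" "?D * e = int l * int l"
      by (metis mult.right_neutral mult_minus1_right)
    \<comment> \<open>Comparison with the adjugate: \<open>l\<close> times each of \<open>a\<close>,
      \<open>b\<close>, \<open>c\<close>, \<open>d\<close> is, up to sign, the determinant times an
      entry of the other matrix. As the determinant is \<open>l\<^sup>2\<close> up to sign,
      \<open>l\<close> divides all four.\<close>
    have neg: "s * c = - (r * a)" "r * a = - (s * c)" "q * d = - (p * b)" "p * b = - (q * d)"
      using 1 2 by simp_all
    have "(a * d - b * c) * s = a * (s * d) - b * (s * c)" by (simp add: algebra_simps)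
    also have "\<dots> = a * (r * b + s * d)" unfolding neg(1) by (simp add: algebra_simps)
    finally have s: "(a * d - b * c) * s = a * (r * b + s * d)" .
    have "(a * d - b * c) * r = d * (r * a) - c * (r * b)" by (simp add: algebra_simps)
    also have "\<dots> = - (c * (r * b + s * d))" unfolding neg(2) by (simp add: algebra_simps)
    finally have r: "(a * d - b * c) * r = - (c * (r * b + s * d))" .
    have "(a * d - b * c) * q = a * (q * d) - b * (q * c)" by (simp add: algebra_simps)
    also have "\<dots> = - (b * (p * a + q * c))" unfolding neg(3) by (simp add: algebra_simps)
    finally have q: "(a * d - b * c) * q = - (b * (p * a + q * c))" .
    have "(a * d - b * c) * p = d * (p * a) - c * (p * b)" by (simp add: algebra_simps)
    also have "\<dots> = d * (p * a + q * c)" unfolding neg(4) by (simp add: algebra_simps)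
    finally have p: "(a * d - b * c) * p = d * (p * a + q * c)" .
    have "a * int l = (a * d - b * c) * s" "b * int l = - ((a * d - b * c) * q)"
       "c * int l = - ((a * d - b * c) * r)" "d * int l = (a * d - b * c) * p"
      unfolding p q r s by (simp_all flip: 1 2)
    then have 3: "a * int l * e = int l * int l * s" "b * int l * e = int l * int l * (- q)"
       "c * int l * e = int l * int l * (- r)" "d * int l * e = int l * int l * p"
      using e by (metis mult.assoc mult.commute mult_minus_left mult_minus_right)+
    have cancel: "x = int l * (e * y)" if "x * int l * e = int l * int l * y" for x y
    proof -
      have "int l * x = x * int l * e * e" using e(1) by auto
      also have "\<dots> = int l * (int l * (e * y))" unfolding that by (simp add: algebra_simps)
      finally show ?thesis using l0 by simp
    qed
    have "a = int l * (e * s)" "b = int l * (- e * q)" "c = int l * (- e * r)" "d = int l * (e * p)"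
      using cancel[OF 3(1)] cancel[OF 3(2)] cancel[OF 3(3)] cancel[OF 3(4)] by simp_all
    then have "w = of_nat l * (of_int (e * s) * u + of_int (- e * q) * v)"
      "z = of_nat l * (of_int (- e * r) * u + of_int (e * p) * v)"
      using assms(3,4) by (simp_all add: algebra_simps)
    then have "w \<in> (*) (of_nat l) ` lat u v" "z \<in> (*) (of_nat l) ` lat u v"
      using latI by blast+
    then have "lat w z \<subseteq> (*) (of_nat l) ` lat u v"
      unfolding image_mult_lat by (intro lat_subset) auto
    then show False using nbr by blast
  qed
  ultimately have "i = 1" using i by linarith
  then show ?thesis using i by simp
qed


section \<open>Cosets and the index\<close>

lemma a_rcosets_eq:
  "a_rcosets\<^bsub>order_ring L\<^esub> M = (\<lambda>x. (\<lambda>m. m + x) ` M) ` L"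
  by (auto simp: A_RCOSETS_def RCOSETS_def r_coset_def ring_of_type_algebra_def image_def)

lemma translate_eq_iff:
  assumes "zmod.subspace M"
  shows "(\<lambda>m. m + x) ` M = (\<lambda>m. m + y) ` M \<longleftrightarrow> x - y \<in> M"
proof
  assume "(\<lambda>m. m + x) ` M = (\<lambda>m. m + y) ` M"
  moreover have "0 + x \<in> (\<lambda>m. m + x) ` M" using zmod.subspace_0[OF assms] by blast
  ultimately show "x - y \<in> M" by (auto simp: image_iff)
next
  assume xy: "x - y \<in> M"
  have "m + x \<in> (\<lambda>m. m + y) ` M" if "m \<in> M" for m
    using zmod.subspace_add[OF assms that xy] by (intro image_eqI[of _ _ "m + (x - y)"]) auto
  moreover have "m + y \<in> (\<lambda>m. m + x) ` M" if "m \<in> M" for m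
    using zmod.subspace_diff[OF assms that xy] by (intro image_eqI[of _ _ "m - (x - y)"]) auto
  ultimately show "(\<lambda>m. m + x) ` M = (\<lambda>m. m + y) ` M" by blast
qed

lemma comm_group_add_order_ring:
  assumes "zmod.subspace L"
  shows "comm_group (add_monoid (order_ring L))"
proof (rule comm_groupI)
  fix x assume "x \<in> carrier (add_monoid (order_ring L))"
  then have "- x \<in> L" using zmod.subspace_neg[OF assms] by (simp add: ring_of_type_algebra_def)
  then show "\<exists>y\<in>carrier (add_monoid (order_ring L)). y \<otimes>\<^bsub>add_monoid (order_ring L)\<^esub> x = \<one>\<^bsub>add_monoid (order_ring L)\<^esub>"
    by (intro bexI[of _ "- x"]) (auto simp: ring_of_type_algebra_def)
qed (use zmod.subspace_0[OF assms] zmod.subspace_add[OF assms] in \<open>auto simp: ring_of_type_algebra_def algebra_simps\<close>)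

lemma subgroup_add_order_ring:
  assumes "zmod.subspace L" "zmod.subspace M" "M \<subseteq> L"
  shows "subgroup M (add_monoid (order_ring L))"
proof (rule group.subgroupI)
  show "Group.group (add_monoid (order_ring L))"
    using comm_group_add_order_ring[OF assms(1)] by (simp add: comm_group_def)
  then interpret G: Group.group "add_monoid (order_ring L)" .
  show "inv\<^bsub>add_monoid (order_ring L)\<^esub> a \<in> M" if "a \<in> M" for a
  proof -
    have "- a \<in> M" using zmod.subspace_neg[OF assms(2)] that .
    moreover have "inv\<^bsub>add_monoid (order_ring L)\<^esub> a = - a"
      by (rule G.inv_equality) (use that \<open>- a \<in> M\<close> assms(3) in \<open>auto simp: ring_of_type_algebra_def\<close>)
    ultimately show ?thesis by simp
  qed
qed (use assms zmod.subspace_0 zmod.subspace_add in \<open>auto simp: ring_of_type_algebra_def\<close>)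

text \<open>Lagrange's theorem in the quotient group. An infinite index is recorded as 0, and then
  the claim reads that 0 lies in \<open>M\<close>.\<close>

lemma index_mult_mem:
  assumes "zmod.subspace L" "zmod.subspace M" "M \<subseteq> L" "x \<in> L"
  shows "of_nat (add_index L M) * x \<in> M"
proof -
  let ?G = "add_monoid (order_ring L)"
  interpret G: comm_group ?G by (rule comm_group_add_order_ring[OF assms(1)])
  interpret N: normal M ?G
    by (rule G.subgroup_imp_normal[OF subgroup_add_order_ring[OF assms(1-3)]])
  interpret Q: Group.group "?G Mod M" by (rule N.factorgroup_is_group)
  have x: "x \<in> carrier ?G" using assms(4) by (simp add: ring_of_type_algebra_def)
  have pow: "x [^]\<^bsub>?G\<^esub> n = of_nat n * x" for n :: nat
    by (induction n) (auto simp: ring_of_type_algebra_def algebra_simps)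
  have "Coset.order (?G Mod M) = add_index L M"
    by (simp add: Coset.order_def FactGroup_def add_index_def A_RCOSETS_def)
  moreover have "M #>\<^bsub>?G\<^esub> x \<in> carrier (?G Mod M)"
    using x by (auto simp: FactGroup_def RCOSETS_def)
  ultimately have "(M #>\<^bsub>?G\<^esub> x) [^]\<^bsub>?G Mod M\<^esub> add_index L M = \<one>\<^bsub>?G Mod M\<^esub>"
    using Q.pow_order_eq_1 by metis
  then have "M #>\<^bsub>?G\<^esub> (of_nat (add_index L M) * x) = M"
    unfolding N.FactGroup_pow[OF x] pow by (simp add: FactGroup_def)
  then have "(\<lambda>m. m + of_nat (add_index L M) * x) ` M = (\<lambda>m. m + 0) ` M"
    by (auto simp: r_coset_def ring_of_type_algebra_def)
  then show ?thesis unfolding translate_eq_iff[OF assms(2)] by simp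
qed

lemma subspace_adjoin:
  assumes "zmod.subspace M"
  shows "zmod.subspace {m + of_int k * y | m k. m \<in> M}"
proof (rule zmod.subspaceI)
  show "0 \<in> {m + of_int k * y | m k. m \<in> M}"
    using zmod.subspace_0[OF assms] by (auto intro!: exI[of _ 0])
next
  fix a b assume "a \<in> {m + of_int k * y | m k. m \<in> M}" "b \<in> {m + of_int k * y | m k. m \<in> M}"
  then obtain m k m' k' where "a = m + of_int k * y" "b = m' + of_int k' * y" "m \<in> M" "m' \<in> M"
    by blast
  then show "a + b \<in> {m + of_int k * y | m k. m \<in> M}"
    using zmod.subspace_add[OF assms, of m m']
    by (auto intro!: exI[of _ "m + m'"] exI[of _ "k + k'"] simp: algebra_simps)
next
  fix c a assume "a \<in> {m + of_int k * y | m k. m \<in> M}"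
  then obtain m k where "a = m + of_int k * y" "m \<in> M" by blast
  then show "of_int c * a \<in> {m + of_int k * y | m k. m \<in> M}"
    using zmod.subspace_scale[OF assms, of m c]
    by (auto intro!: exI[of _ "of_int c * m"] exI[of _ "c * k"] simp: algebra_simps)
qed

lemma mem_of_prime_mult:
  assumes "Factorial_Ring.prime l" "zmod.subspace M" "of_nat l * y \<in> M" "of_int k * y \<in> M" "\<not> int l dvd k"
  shows "y \<in> M"
proof -
  have "coprime (int l) k" using assms(1,5) by (simp add: prime_imp_coprime)
  then obtain s t where st: "s * int l + t * k = 1"
    by (metis bezout_int coprime_imp_gcd_eq_1)
  have "of_int s * (of_nat l * y) + of_int t * (of_int k * y) \<in> M"
    using assms zmod.subspace_add zmod.subspace_scale by metis
  also have "of_int s * (of_nat l * y) + of_int t * (of_int k * y) = of_int (s * int l + t * k) * y"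
    by (simp add: algebra_simps)
  finally show ?thesis by (simp only: st of_int_1 mult_1)
qed

text \<open>By maximality, adjoining any \<open>y\<close> outside \<open>M\<close> gives
  \<open>L\<close>. So the quotient is cyclic, and its elements are the cosets of the multiples
  \<open>k * y\<close> with \<open>k < l\<close>.\<close>

lemma neighbour_imp_index:
  assumes "Factorial_Ring.prime l" "L = lat u v" "neighbour l L M"
  shows "add_index L M = l"
proof -
  have M: "zmod.subspace M" "M \<subseteq> L" and lM: "\<And>x. x \<in> L \<Longrightarrow> of_nat l * x \<in> M" and "M \<noteq> L"
    using assms(3) by (auto simp: neighbour_def)
  then obtain y where y: "y \<in> L" "y \<notin> M" by blast
  let ?Q = "{m + of_int k * y | m k. m \<in> M}" and ?C = "\<lambda>x. (\<lambda>m. m + x) ` M"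
  have "m = m + of_int 0 * y" for m by simp
  then have "M \<subseteq> ?Q" by blast
  moreover have "?Q \<subseteq> L"
    using y(1) M(2) by (auto simp: assms(2) intro!: zmod.subspace_add zmod.subspace_scale)
  moreover have "0 + of_int 1 * y \<in> ?Q" using zmod.subspace_0[OF M(1)] by blast
  then have "?Q \<noteq> M" using y by auto
  ultimately have Q: "?Q = L"
    using neighbour_maximal[OF assms subspace_adjoin[OF M(1)]] by blast
  have "bij_betw (\<lambda>k. ?C (of_nat k * y)) {..<l} (?C ` L)"
  proof (rule bij_betwI')
    fix i j assume ij: "i \<in> {..<l}" "j \<in> {..<l}"
    show "?C (of_nat i * y) = ?C (of_nat j * y) \<longleftrightarrow> i = j"
    proof
      assume "?C (of_nat i * y) = ?C (of_nat j * y)"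
      then have "of_nat i * y - of_nat j * y \<in> M" by (simp add: translate_eq_iff[OF M(1)])
      then have "of_int (int i - int j) * y \<in> M" by (simp add: algebra_simps)
      then have "int l dvd int i - int j"
        using mem_of_prime_mult[OF assms(1) M(1) lM[OF y(1)]] y(2) by blast
      then show "i = j" using ij zdvd_imp_le[of "int l" "\<bar>int i - int j\<bar>"] by (cases "i = j") auto
    qed simp
  next
    fix k assume "k \<in> {..<l}"
    have "of_int (int k) * y \<in> L"
      unfolding assms(2) using y(1) assms(2) by (intro zmod.subspace_scale) auto
    then show "?C (of_nat k * y) \<in> ?C ` L" by simp
  next
    fix T assume "T \<in> ?C ` L"
    then obtain x where x: "x \<in> L" "T = ?C x" by blast
    then obtain m k where mk: "m \<in> M" "x = m + of_int k * y" using Q by blast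
    have l: "l > 0" using assms(1) prime_gt_0_nat by blast
    define j where "j = nat (k mod int l)"
    have j: "j < l" "int j = k mod int l" using l by (simp_all add: j_def nat_less_iff)
    have "k = int l * (k div int l) + int j" using j(2) by simp
    then have "of_int k = (of_int (int l * (k div int l) + int j) :: complex)" by simp
    then have "x - of_nat j * y = m + of_int (k div int l) * (of_nat l * y)"
      unfolding mk by (simp add: algebra_simps)
    also have "\<dots> \<in> M" using mk(1) lM[OF y(1)] M(1) zmod.subspace_add zmod.subspace_scale by metis
    finally have "T = ?C (of_nat j * y)" unfolding x(2) translate_eq_iff[OF M(1)] .
    then show "\<exists>k\<in>{..<l}. T = ?C (of_nat k * y)" using j by blast
  qed
  then have "card (?C ` L) = card {..<l}" by (metis bij_betw_same_card)
  then show ?thesis by (simp add: add_index_def a_rcosets_eq)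
qed

text \<open>\<open>M = L\<close> would have index 1. If \<open>M\<close> were inside
  \<open>lL\<close>, the vectors \<open>i * u + j * v\<close> with \<open>i\<close>,
  \<open>j\<close> below \<open>l\<close> would lie in different cosets, giving at least
  \<open>l\<^sup>2\<close> of them.\<close>

lemma index_imp_neighbour:
  assumes "Factorial_Ring.prime l" "L = lat u v" "indep_pair u v" "zmod.subspace M" "M \<subseteq> L" "add_index L M = l"
  shows "neighbour l L M"
  unfolding neighbour_def
proof (intro conjI ballI)
  let ?C = "\<lambda>x. (\<lambda>m. m + x) ` M"
  have l: "l > 1" using assms(1) prime_gt_1_nat by blast
  have c: "card (?C ` L) = l" using assms(6) by (simp add: add_index_def a_rcosets_eq)
  show "of_nat l * x \<in> M" if "x \<in> L" for x
    using index_mult_mem[OF _ assms(4,5) that] assms(2,6) by simp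
  show "M \<noteq> L"
  proof
    assume "M = L"
    then have "?C x = ?C 0" if "x \<in> L" for x
      using that unfolding translate_eq_iff[OF assms(4)] by simp
    then have "?C ` L \<subseteq> {?C 0}" by blast
    then have "card (?C ` L) \<le> 1" using card_mono[of "{?C 0}"] by simp
    then show False using c l by simp
  qed
  show "\<not> M \<subseteq> (*) (of_nat l) ` L"
  proof
    assume M: "M \<subseteq> (*) (of_nat l) ` L"
    let ?f = "\<lambda>(i, j). ?C (of_nat i * u + of_nat j * v)"
    have "inj_on ?f ({..<l} \<times> {..<l})"
    proof (rule inj_onI, safe)
      fix i j i' j' assume ij: "i < l" "j < l" "i' < l" "j' < l"
        and "?C (of_nat i * u + of_nat j * v) = ?C (of_nat i' * u + of_nat j' * v)"
      then have "of_nat i * u + of_nat j * v - (of_nat i' * u + of_nat j' * v) \<in> (*) (of_nat l) ` L"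
        using M unfolding translate_eq_iff[OF assms(4)] by blast
      then obtain a b where "of_nat i * u + of_nat j * v - (of_nat i' * u + of_nat j' * v) =
          of_nat l * (of_int a * u + of_int b * v)"
        unfolding assms(2) lat_def by blast
      then have "of_int (int i - int i') * u + of_int (int j - int j') * v =
          of_int (int l * a) * u + of_int (int l * b) * v"
        by (simp add: algebra_simps)
      from indep_pair_unique[OF assms(3) this] have "int l dvd int i - int i'" "int l dvd int j - int j'"
        by simp_all
      then show "i = i'" "j = j'"
        using ij zdvd_imp_le[of "int l" "\<bar>int i - int i'\<bar>"] zdvd_imp_le[of "int l" "\<bar>int j - int j'\<bar>"]
        by (cases "i = i'"; cases "j = j'"; auto)+
    qed
    moreover have "?f ` ({..<l} \<times> {..<l}) \<subseteq> ?C ` L"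
    proof -
      have "of_nat i * u + of_nat j * v \<in> L" for i j
        using latI[of "int i" u "int j" v] assms(2) by simp
      then show ?thesis by auto
    qed
    moreover have "finite (?C ` L)" using c l by (intro card_ge_0_finite) simp
    ultimately have "card ({..<l} \<times> {..<l}) \<le> card (?C ` L)" by (metis card_inj_on_le)
    then have "l * l \<le> l" using c by simp
    then show False using l by simp
  qed
qed (use assms in auto)


section \<open>Multiplier rings of well-rounded lattices\<close>

text \<open>The coefficient ring computed in all of the complex numbers, so that it makes sense
  before any field is chosen. For a nonzero \<open>L\<close> inside a subfield the two agree, by
  \<open>coefficient_ring_eq_multiplier_ring\<close>.\<close>

definition multiplier_ring :: "complex set \<Rightarrow> complex set" where
  "multiplier_ring L = {\<alpha>. \<forall>x\<in>L. \<alpha> * x \<in> L}"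

lemma multiplier_ring_mult:
  assumes "\<gamma> \<noteq> 0"
  shows "multiplier_ring ((*) \<gamma> ` L) = multiplier_ring L"
proof -
  have "\<alpha> * (\<gamma> * x) \<in> (*) \<gamma> ` L \<longleftrightarrow> \<alpha> * x \<in> L" for \<alpha> x
    using assms by (auto simp: image_iff mult.left_commute)
  then show ?thesis by (auto simp: multiplier_ring_def)
qed

lemma multiplier_ring_latI:
  assumes "\<alpha> * u \<in> lat u v" "\<alpha> * v \<in> lat u v"
  shows "\<alpha> \<in> multiplier_ring (lat u v)"
proof -
  have "\<alpha> * (of_int a * u + of_int b * v) = of_int a * (\<alpha> * u) + of_int b * (\<alpha> * v)" for a b
    by (simp add: algebra_simps)
  then have "\<alpha> * (of_int a * u + of_int b * v) \<in> lat u v" for a b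
    using assms zmod.subspace_add[OF subspace_lat] zmod.subspace_scale[OF subspace_lat] by metis
  then show ?thesis by (auto simp: multiplier_ring_def elim!: latE)
qed

text \<open>The orthogonal diagonals \<open>u + v\<close>, \<open>u - v\<close> are multiplied by
  \<open>a + b\<close> and \<open>a - b\<close> to give \<open>w + z\<close> and
  \<open>w - z\<close>. In a reduced pair the squared diagonals differ by a factor of at most 3, so
  \<open>a + b\<close> and \<open>a - b\<close> also differ by a factor of at most 3 in absolute
  value, while their product is the prime \<open>l\<close> up to sign. Parity excludes 2, and 3 is
  possible only with equality throughout, that is, for the hexagonal lattice.\<close>

lemma rhombic_sublattice:
  assumes "reduced_pair u v" "reduced_pair w z" and w: "w = of_int a * u + of_int b * v"
    and z: "z = of_int b * u + of_int a * v"
    and l: "Factorial_Ring.prime l" "\<bar>a * a - b * b\<bar> = int l"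
  shows "2 * (u \<bullet> v) = - (norm u)\<^sup>2 \<and> (a = 2 * b \<or> b = 2 * a) \<or>
         2 * (u \<bullet> v) = (norm u)\<^sup>2 \<and> (a = - 2 * b \<or> b = - 2 * a)"
proof -
  \<comment> \<open>Half the squared lengths of \<open>u + v\<close> and \<open>u - v\<close>;
    reducedness says \<open>p \<le> 3 * q\<close> and \<open>q \<le> 3 * p\<close>.\<close>
  define p q where "p = (norm u)\<^sup>2 + u \<bullet> v" and "q = (norm u)\<^sup>2 - u \<bullet> v"
  define P Q where "P = a + b" and "Q = a - b"
  have uv: "norm v = norm u" "2 * \<bar>u \<bullet> v\<bar> \<le> (norm u)\<^sup>2" "(norm u)\<^sup>2 > 0"
    using assms(1) indep_pair_nz by (auto simp: reduced_pair_def)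
  have "2 * (u \<bullet> v) \<le> (norm u)\<^sup>2" "- (2 * (u \<bullet> v)) \<le> (norm u)\<^sup>2"
    using uv(2) by (simp_all add: abs_le_iff)
  then have "p > 0 \<and> q > 0" "p \<le> 3 * q \<and> q \<le> 3 * p"
    using uv(3) unfolding p_def q_def right_diff_distrib distrib_left by (linarith, simp)
  then have pq: "p > 0" "q > 0" "p \<le> 3 * q" "q \<le> 3 * p" by auto
  have nw: "2 * (norm w)\<^sup>2 = of_int (P^2) * p + of_int (Q^2) * q"
    unfolding w norm_comb_int uv(1) p_def q_def P_def Q_def
    by (simp add: power2_eq_square algebra_simps)
  have vv: "u \<bullet> u = (norm u)\<^sup>2" "v \<bullet> v = (norm u)\<^sup>2" "v \<bullet> u = u \<bullet> v"
    by (metis power2_norm_eq_inner uv(1) inner_commute)+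
  have "w \<bullet> z = (of_int a * of_int b) * (u \<bullet> u) + (of_int a * of_int a + of_int b * of_int b) * (u \<bullet> v)
      + (of_int a * of_int b) * (v \<bullet> v)"
    unfolding w z by (simp add: inner_complex_def algebra_simps)
  then have wz: "2 * (w \<bullet> z) = of_int (P^2) * p - of_int (Q^2) * q"
    unfolding vv p_def q_def P_def Q_def by (simp add: power2_eq_square algebra_simps)
  have "2 * \<bar>w \<bullet> z\<bar> \<le> (norm w)\<^sup>2" using assms(2) unfolding reduced_pair_def by blast
  then have 1: "of_int (P^2) * p \<le> 3 * (of_int (Q^2) * q)" "of_int (Q^2) * q \<le> 3 * (of_int (P^2) * p)"
    using nw wz by linarith+
  have "of_int (Q^2) * q \<le> of_int (Q^2) * (3 * p)" "of_int (P^2) * p \<le> of_int (P^2) * (3 * q)"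
    using pq by (intro mult_left_mono; simp)+
  then have "of_int (P^2) * p \<le> of_int (9 * Q^2) * p" "of_int (Q^2) * q \<le> of_int (9 * P^2) * q"
    using 1 by simp_all
  then have "P^2 \<le> 9 * Q^2" "Q^2 \<le> 9 * P^2"
    using pq by (simp_all only: mult_le_cancel_right of_int_le_iff)
  then have le: "\<bar>P\<bar> \<le> 3 * \<bar>Q\<bar>" "\<bar>Q\<bar> \<le> 3 * \<bar>P\<bar>"
    using abs_le_square_iff[of P "3 * Q"] abs_le_square_iff[of Q "3 * P"]
    by (simp_all add: abs_mult power_mult_distrib)
  have "P * Q = a * a - b * b" by (simp add: P_def Q_def algebra_simps)
  then have PQ: "\<bar>P\<bar> * \<bar>Q\<bar> = int l" using l(2) by (metis abs_mult)
  then have "nat \<bar>P\<bar> * nat \<bar>Q\<bar> = l" by (metis nat_int nat_mult_distrib abs_ge_zero)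
  then have "nat \<bar>P\<bar> = 1 \<or> nat \<bar>P\<bar> = l"
    using l(1) by (metis dvd_triv_left prime_nat_iff)
  then have "\<bar>P\<bar> = 1 \<or> \<bar>P\<bar> = int l" by auto
  then have "\<bar>P\<bar> = 1 \<and> \<bar>Q\<bar> = int l \<or> \<bar>P\<bar> = int l \<and> \<bar>Q\<bar> = 1"
    using PQ l(1) prime_gt_0_nat[OF l(1)] by auto
  moreover have l1: "l > 1" using l(1) prime_gt_1_nat by blast
  \<comment> \<open>\<open>P\<close> and \<open>Q\<close> differ by \<open>2 * b\<close>; since one
    of them is 1 up to sign, both are odd, and so is \<open>l\<close>.\<close>
  moreover have "odd P \<longleftrightarrow> odd Q" by (simp add: P_def Q_def)
  ultimately consider "\<bar>P\<bar> = 1 \<and> \<bar>Q\<bar> = int l \<and> odd l" | "\<bar>P\<bar> = int l \<and> \<bar>Q\<bar> = 1 \<and> odd l"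
    by (metis dvd_abs_iff even_of_nat odd_one)
  then show ?thesis
  proof cases
    case 1
    then have "int l \<le> 3" using le by linarith
    then have "l = 3" using 1 l1 by (cases "l = 2") auto
    then have "P = 1 \<or> P = -1" "Q = 3 \<or> Q = -3" using 1 by linarith+
    moreover from this have "P^2 = 1" "Q^2 = 9" by auto
    then have "9 * q \<le> 3 * p" using \<open>of_int (Q^2) * q \<le> 3 * (of_int (P^2) * p)\<close> by simp
    then have "p = 3 * q" using pq(3) by linarith
    then have "2 * (u \<bullet> v) = (norm u)\<^sup>2" unfolding p_def q_def by (simp add: algebra_simps)
    moreover have "2 * a = P + Q" "2 * b = P - Q" by (simp_all add: P_def Q_def)
    ultimately show ?thesis by auto
  next
    case 2
    then have "int l \<le> 3" using le by linarith
    then have "l = 3" using 2 l1 by (cases "l = 2") auto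
    then have "P = 3 \<or> P = -3" "Q = 1 \<or> Q = -1" using 2 by linarith+
    moreover from this have "P^2 = 9" "Q^2 = 1" by auto
    then have "9 * p \<le> 3 * q" using \<open>of_int (P^2) * p \<le> 3 * (of_int (Q^2) * q)\<close> by simp
    then have "q = 3 * p" using pq(4) by linarith
    then have "2 * (u \<bullet> v) = - (norm u)\<^sup>2" unfolding p_def q_def by (simp add: algebra_simps)
    moreover have "2 * a = P + Q" "2 * b = P - Q" by (simp_all add: P_def Q_def)
    ultimately show ?thesis by auto
  qed
qed

lemma norm_eq_imp_indep_pair:
  assumes "norm x = norm y" "x \<noteq> y" "x \<noteq> - y"
  shows "indep_pair x y"
proof (rule ccontr)
  assume "\<not> indep_pair x y"
  then have 0: "Im (cnj x * y) = 0" by (simp add: indep_pair_def)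
  have "x \<noteq> 0" using assms by auto
  define r where "r = Re (cnj x * y)"
  have "cnj x * y = of_real r" using 0 by (simp add: r_def complex_eq_iff)
  moreover have "\<bar>r\<bar> = norm x * norm x"
    using arg_cong[OF \<open>cnj x * y = of_real r\<close>, of norm] assms(1) by (simp add: norm_mult)
  moreover have "cnj x * x = of_real (norm x * norm x)"
    using complex_norm_square[of x] by (simp add: power2_eq_square mult.commute)
  ultimately have "cnj x * y = cnj x * x \<or> cnj x * y = cnj x * (- x)"
    by (metis abs_if minus_mult_right of_real_minus minus_minus)
  then have "y = x \<or> y = - x"
    using \<open>x \<noteq> 0\<close> unfolding mult_cancel_left by simp
  then show False using assms by auto
qed

text \<open>The equation \<tau>^2 - (2 (u \<bullet> v) / |u|^2) \<tau> + 1 = 0 of the number \<tau>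
  = \<open>v / u\<close> of modulus 1, with denominators cleared.\<close>

lemma equal_norm_quadratic:
  fixes u v :: complex
  assumes "norm u = norm v"
  shows "of_real ((norm u)\<^sup>2) * (u * u + v * v) = of_real (2 * (u \<bullet> v)) * (u * v)"
proof -
  have "of_real (2 * (u \<bullet> v)) = cnj u * v + u * cnj v"
    by (simp add: complex_eq_iff inner_complex_def)
  then have "of_real (2 * (u \<bullet> v)) * (u * v) = (u * cnj u) * (v * v) + (v * cnj v) * (u * u)"
    by (simp add: algebra_simps)
  also have "\<dots> = of_real ((norm u)\<^sup>2) * (u * u + v * v)"
  proof -
    have "u * cnj u = of_real ((norm u)\<^sup>2)" "v * cnj v = of_real ((norm u)\<^sup>2)"
      using complex_norm_square[of u] complex_norm_square[of v] assms by simp_all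
    then show ?thesis by (simp only: distrib_left add.commute)
  qed
  finally show ?thesis ..
qed

text \<open>A multiplier \<rho> is determined by the image of \<open>u\<close>: it equals
  \<open>x + y * (v / u)\<close> with integers \<open>x\<close> and \<open>y\<close>. So only the
  number \<open>v / u\<close> has to be tested, on two generators of \<open>M\<close>.\<close>

lemma multiplier_ring_subset_of_generator:
  assumes "indep_pair u v" "zmod.subspace M" "M = lat w z" "(v / u) * w \<in> M" "(v / u) * z \<in> M"
  shows "multiplier_ring (lat u v) \<subseteq> multiplier_ring M"
proof
  fix \<rho> assume "\<rho> \<in> multiplier_ring (lat u v)"
  then have "\<rho> * u \<in> lat u v" by (simp add: multiplier_ring_def)
  then obtain x y where xy: "\<rho> * u = of_int x * u + of_int y * v" by (rule latE)
  have "\<rho> = (\<rho> * u) / u" using indep_pair_nz[OF assms(1)] by simp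
  also have "\<dots> = of_int x + of_int y * (v / u)"
    unfolding xy using indep_pair_nz[OF assms(1)] by (simp add: add_divide_distrib)
  finally have \<rho>: "\<rho> = of_int x + of_int y * (v / u)" .
  have "\<rho> * m = of_int x * m + of_int y * ((v / u) * m)" for m
    by (simp add: \<rho> algebra_simps)
  then have "\<rho> * m \<in> M" if "m \<in> M" "(v / u) * m \<in> M" for m
    using that assms(2) zmod.subspace_add zmod.subspace_scale by metis
  then show "\<rho> \<in> multiplier_ring M"
    unfolding assms(3) by (intro multiplier_ring_latI) (use assms(3-5) in auto)
qed

lemma indep_pair_ratio_nonreal: "indep_pair u v \<Longrightarrow> Im (v / u) \<noteq> 0"
proof -
  assume *: "indep_pair u v"
  then have "v / u = (cnj u * v) / of_real ((norm u)\<^sup>2)"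
    using indep_pair_nz[OF *] by (simp add: complex_norm_square field_simps del: of_real_power)
  then have "Im (v / u) = Im (cnj u * v) / (norm u)\<^sup>2"
    by (metis Im_divide_of_real)
  then show ?thesis using * indep_pair_nz[OF *] by (simp add: indep_pair_def)
qed

text \<open>By \<open>rhombic_sublattice\<close> the larger lattice is hexagonal, and
  \<open>v / u\<close> is a primitive third or sixth root of unity. Explicit integer matrices show
  that it preserves the sublattice too.\<close>

lemma multiplier_ring_of_rhombic:
  assumes "Factorial_Ring.prime l" "reduced_pair u v" "reduced_pair w z" "neighbour l (lat u v) (lat w z)"
    and w: "w = of_int a * u + of_int b * v" and z: "z = of_int b * u + of_int a * v"
  shows "multiplier_ring (lat u v) \<subseteq> multiplier_ring (lat w z) \<and> v / u \<in> multiplier_ring (lat u v)"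
proof -
  have ind: "indep_pair u v" and eq: "norm u = norm v"
    using assms(2) by (auto simp: reduced_pair_def)
  note nz = indep_pair_nz[OF ind]
  have "\<bar>a * a - b * b\<bar> = int l" by (rule neighbour_det[OF assms(1,4) w z ind])
  note R = rhombic_sublattice[OF assms(2,3) w z assms(1) this]
  \<comment> \<open>The sign \<open>e\<close> merges the two cases: \<open>v / u\<close> is a root
    of X^2 + e X + 1.\<close>
  have "\<exists>e::int. (e = 1 \<or> e = -1) \<and> 2 * (u \<bullet> v) = - of_int e * (norm u)\<^sup>2 \<and>
      (a = 2 * e * b \<or> b = 2 * e * a)"
    using R by (rule disjE) (rule exI[of _ 1], simp, rule exI[of _ "-1"], simp)
  then obtain e :: int where e: "e = 1 \<or> e = -1" "2 * (u \<bullet> v) = - of_int e * (norm u)\<^sup>2"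
    "a = 2 * e * b \<or> b = 2 * e * a"
    by blast
  have ee: "of_int e * of_int e = (1 :: complex)" "e * e = 1" using e(1) by auto
  let ?\<tau> = "v / u"
  have "of_real ((norm u)\<^sup>2) * (u * u + v * v) = of_real ((norm u)\<^sup>2) * (- of_int e * (u * v))"
    using equal_norm_quadratic[OF eq] e(2) by simp
  then have "u * u + v * v = - of_int e * (u * v)"
    using nz by (simp only: mult_cancel_left of_real_eq_0_iff) simp
  then have vv: "v * v = - of_int e * (u * v) - u * u" by (simp only: eq_diff_eq add.commute)
  have "(?\<tau> * v) * u = v * v" using nz by simp
  also have "\<dots> = (of_int (- e) * v + of_int (- 1) * u) * u"
    unfolding vv by (simp add: algebra_simps)
  finally have "(?\<tau> * v) * u = (of_int (- e) * v + of_int (- 1) * u) * u" .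
  then have \<tau>: "?\<tau> * u = v" "?\<tau> * v = of_int (- e) * v + of_int (- 1) * u"
    using nz by simp_all
  have "?\<tau> \<in> multiplier_ring (lat u v)"
    using latI[of "-1" u "-e" v] by (intro multiplier_ring_latI) (simp_all only: \<tau> lat_gens add.commute)
  have dist: "?\<tau> * (of_int x * u + of_int y * v) = of_int x * (?\<tau> * u) + of_int y * (?\<tau> * v)" for x y
    by (simp only: distrib_left mult.left_commute)
  have "?\<tau> * w \<in> lat w z \<and> ?\<tau> * z \<in> lat w z"
    using e(3)
  proof
    assume a: "a = 2 * e * b"
    have "?\<tau> * w = of_int (- e) * w + of_int 1 * z" "?\<tau> * z = of_int (- 1) * w + of_int 0 * z"
      unfolding w z dist \<tau> a using ee by (simp_all add: algebra_simps)
    then show ?thesis using latI by metis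
  next
    assume a: "b = 2 * e * a"
    have "?\<tau> * w = of_int 0 * w + of_int (- 1) * z" "?\<tau> * z = of_int 1 * w + of_int (- e) * z"
      unfolding w z dist \<tau> a using ee by (simp_all add: algebra_simps)
    then show ?thesis using latI by metis
  qed
  then show ?thesis
    using multiplier_ring_subset_of_generator[OF ind subspace_lat refl] \<open>?\<tau> \<in> multiplier_ring (lat u v)\<close> by blast
qed

text \<open>The larger lattice is square and \<open>w\<close>, \<open>z\<close> are mirror images in
  the axis through \<open>u\<close>. The determinant is \<open>- 2 * a * b\<close>, so
  \<open>l\<close> is 2 and \<open>a\<close>, \<open>b\<close> are 1 or -1. Then
  \<open>v / u\<close> is a square root of -1 and exchanges \<open>w\<close> and \<open>z\<close> up
  to sign.\<close>

lemma multiplier_ring_of_square: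
  assumes "Factorial_Ring.prime l" "reduced_pair u v" "u \<bullet> v = 0" "neighbour l (lat u v) (lat w z)"
    and w: "w = of_int a * u + of_int b * v" and z: "z = of_int a * u + of_int (- b) * v"
  shows "multiplier_ring (lat u v) \<subseteq> multiplier_ring (lat w z) \<and> v / u \<in> multiplier_ring (lat u v)"
proof -
  have ind: "indep_pair u v" and eq: "norm u = norm v"
    using assms(2) by (auto simp: reduced_pair_def)
  note nz = indep_pair_nz[OF ind]
  have "\<bar>a * - b - b * a\<bar> = int l" by (rule neighbour_det[OF assms(1,4) w z ind])
  then have ab: "2 * \<bar>a * b\<bar> = int l" by (simp add: abs_mult algebra_simps)
  then have "even l" by (metis dvd_triv_left even_of_nat)
  then have "l = 2" using assms(1) primes_dvd_imp_eq two_is_prime_nat by blast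
  then have "\<bar>a * b\<bar> = 1" using ab by simp
  then have "a = b \<or> a = - b" "\<bar>a\<bar> = 1"
    by (metis abs_eq_iff abs_mult abs_zmult_eq_1 mult.commute)+
  let ?\<tau> = "v / u"
  have "of_real ((norm u)\<^sup>2) * (u * u + v * v) = 0"
    using equal_norm_quadratic[OF eq] assms(3) by simp
  then have "u * u + v * v = 0"
    using nz by simp
  then have vv: "v * v = - (u * u)" by (metis add_eq_0_iff)
  have "(?\<tau> * v) * u = v * v" using nz by simp
  also have "\<dots> = (of_int (- 1) * u) * u" unfolding vv by simp
  finally have "(?\<tau> * v) * u = (of_int (- 1) * u) * u" .
  then have \<tau>: "?\<tau> * u = v" "?\<tau> * v = of_int (- 1) * u"
    using nz by simp_all
  have "?\<tau> \<in> multiplier_ring (lat u v)"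
    using latI[of "-1" u 0 v] by (intro multiplier_ring_latI) (simp_all only: \<tau> lat_gens, simp)
  have dist: "?\<tau> * (of_int x * u + of_int y * v) = of_int x * (?\<tau> * u) + of_int y * (?\<tau> * v)" for x y
    by (simp only: distrib_left mult.left_commute)
  have "?\<tau> * w \<in> lat w z \<and> ?\<tau> * z \<in> lat w z"
    using \<open>a = b \<or> a = - b\<close>
  proof
    assume a: "a = b"
    have "?\<tau> * w = of_int 0 * w + of_int (- 1) * z" "?\<tau> * z = of_int 1 * w + of_int 0 * z"
      unfolding w z dist \<tau> a by (simp_all add: algebra_simps)
    then show ?thesis using latI by metis
  next
    assume a: "a = - b"
    have "?\<tau> * w = of_int 0 * w + of_int 1 * z" "?\<tau> * z = of_int (- 1) * w + of_int 0 * z"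
      unfolding w z dist \<tau> a by (simp_all add: algebra_simps)
    then show ?thesis using latI by metis
  qed
  then show ?thesis
    using multiplier_ring_subset_of_generator[OF ind subspace_lat refl] \<open>?\<tau> \<in> multiplier_ring (lat u v)\<close> by blast
qed

text \<open>The inclusion is one half of the equality of the two multiplier rings; the non-real
  multiplier is what later gives rise to the imaginary quadratic field.\<close>

lemma well_rounded_neighbour_multiplier_ring:
  assumes "Factorial_Ring.prime l" "reduced_pair v1 v2" "reduced_pair w1 w2" "neighbour l (lat v1 v2) (lat w1 w2)"
  shows "multiplier_ring (lat v1 v2) \<subseteq> multiplier_ring (lat w1 w2) \<and> (\<exists>\<mu>\<in>multiplier_ring (lat v1 v2). Im \<mu> \<noteq> 0)"
proof -
  let ?L = "lat v1 v2" and ?M = "lat w1 w2"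
  have ind: "indep_pair v1 v2" "indep_pair w1 w2" and nv: "norm v1 = norm v2" and nw: "norm w1 = norm w2"
    using assms(2,3) by (auto simp: reduced_pair_def)
  note nz = indep_pair_nz[OF ind(1)] indep_pair_nz[OF ind(2)]
  have M_sub_L: "?M \<subseteq> ?L" and lM: "\<And>x. x \<in> ?L \<Longrightarrow> of_nat l * x \<in> ?M"
    using assms(4) by (auto simp: neighbour_def)
  have vc: "v1 * cnj v1 = v2 * cnj v2" and wc: "w1 * cnj w1 = w2 * cnj w2"
    using nv nw by (metis complex_norm_square)+
  \<comment> \<open>\<open>\<sigma> x = c * cnj x\<close> is to be the reflection taking
    \<open>w1\<close> to \<open>w2\<close>; that \<open>c\<close> has modulus 1 is the equality of
    their lengths.\<close>
  define c where "c = w2 / cnj w1"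
  define \<sigma> where "\<sigma> x = c * cnj x" for x
  define \<gamma> where "\<gamma> = c * cnj v2 / v1"
  have cc: "c * cnj c = 1"
    using wc nz by (simp add: c_def field_simps)
  then have nc: "norm c = 1"
    by (metis complex_norm_square norm_ge_zero of_real_eq_1_iff power2_eq_1_iff order_trans
        neg_0_le_iff_le not_one_le_zero)
  have \<sigma>\<sigma>: "\<sigma> (\<sigma> x) = x" for x
    using cc by (simp add: \<sigma>_def mult.assoc[symmetric])
  have \<sigma>w: "\<sigma> w1 = w2" "\<sigma> w2 = w1"
  proof -
    show "\<sigma> w1 = w2" using nz by (simp add: \<sigma>_def c_def)
    then show "\<sigma> w2 = w1" using \<sigma>\<sigma> by metis
  qed
  \<comment> \<open>Composing with the symmetry of \<open>L\<close> that exchanges \<open>v1\<close>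
    and \<open>v2\<close> undoes the conjugation and leaves multiplication by \<gamma>. The same
    \<gamma> serves both vectors because they are equally long.\<close>
  have \<sigma>v: "\<sigma> v2 = \<gamma> * v1" "\<sigma> v1 = \<gamma> * v2"
  proof -
    show "\<sigma> v2 = \<gamma> * v1" using nz by (simp add: \<sigma>_def \<gamma>_def)
    have "\<gamma> * v2 * v1 = c * (v2 * cnj v2)" using nz by (simp add: \<gamma>_def)
    also have "\<dots> = \<sigma> v1 * v1" by (simp add: \<sigma>_def flip: vc)
    finally show "\<sigma> v1 = \<gamma> * v2" using nz by simp
  qed
  have lin: "\<sigma> (of_int a * x + of_int b * y) = of_int a * \<sigma> x + of_int b * \<sigma> y" for a b x y
    by (simp add: \<sigma>_def algebra_simps)
  have norm_\<sigma>: "norm (\<sigma> x) = norm x" for x by (simp add: \<sigma>_def norm_mult nc)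
  have \<sigma>M: "\<sigma> x \<in> ?M" if "x \<in> ?M" for x
  proof -
    obtain a b where "x = of_int a * w1 + of_int b * w2" using \<open>x \<in> ?M\<close> by (rule latE)
    then have "\<sigma> x = of_int b * w1 + of_int a * w2" by (simp add: lin \<sigma>w)
    then show ?thesis using latI by simp
  qed
  have \<gamma>L: "(*) \<gamma> ` ?L = \<sigma> ` ?L"
  proof -
    have "\<gamma> * (of_int a * v1 + of_int b * v2) = \<sigma> (of_int b * v1 + of_int a * v2)" for a b
      unfolding lin \<sigma>v by (simp add: algebra_simps)
    then show ?thesis unfolding lat_def by (auto simp: image_iff) metis+
  qed
  have M\<gamma>: "?M \<subseteq> (*) \<gamma> ` ?L"
    unfolding \<gamma>L using \<sigma>M \<sigma>\<sigma> M_sub_L by (metis image_iff subset_iff)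
  show ?thesis
  proof (cases "?L \<subseteq> (*) \<gamma> ` ?L")
    case False
    let ?Q = "?L \<inter> (*) \<gamma> ` ?L"
    have sub: "zmod.subspace ?Q"
      unfolding image_mult_lat by (intro zmod.subspace_inter subspace_lat)
    \<comment> \<open>\<open>M\<close> is \<sigma>-stable, hence contained in this intersection,
      which is smaller than \<open>L\<close>; maximality leaves only \<open>M\<close>.\<close>
    have "?Q = ?M"
      using neighbour_maximal[OF assms(1) refl assms(4) sub] M_sub_L M\<gamma> False by blast
    moreover have "\<rho> * x \<in> ?Q" if "\<rho> \<in> multiplier_ring ?L" "x \<in> ?Q" for \<rho> x
      using that by (auto simp: multiplier_ring_def mult.left_commute image_iff)
    ultimately have "multiplier_ring ?L \<subseteq> multiplier_ring ?M" by (auto simp: multiplier_ring_def)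
    \<comment> \<open>\<open>lL\<close> lies in \<open>M\<close>, which \<sigma> preserves, so
      \<open>l\<close> times \<gamma> sends \<open>L\<close> into \<open>M\<close>.\<close>
    moreover have "\<gamma> * (of_nat l * x) \<in> ?L" if "x \<in> ?L" for x
    proof -
      obtain a b where x: "x = of_int a * v1 + of_int b * v2" using \<open>x \<in> ?L\<close> by (rule latE)
      have "\<gamma> * (of_nat l * x) = of_int 0 * x + of_int (int l) * (of_int b * (\<gamma> * v2) + of_int a * (\<gamma> * v1))"
        by (simp add: x algebra_simps)
      also have "\<dots> = \<sigma> (of_nat l * (of_int b * v1 + of_int a * v2))"
        using lin[of 0 x "int l" "of_int b * v1 + of_int a * v2"] by (simp add: lin \<sigma>v)
      also have "\<dots> \<in> ?L" using \<sigma>M[OF lM[OF latI]] M_sub_L by blast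
      finally show ?thesis .
    qed
    then have "of_nat l * \<gamma> \<in> multiplier_ring ?L" by (simp add: multiplier_ring_def mult_ac)
    \<comment> \<open>\<gamma> has modulus 1, so if it were real it would be 1 or -1 and would
      preserve \<open>L\<close>.\<close>
    moreover have "Im \<gamma> \<noteq> 0"
    proof
      assume "Im \<gamma> = 0"
      moreover have "norm \<gamma> = 1" using nz nv nc by (simp add: \<gamma>_def norm_mult norm_divide)
      ultimately have "\<gamma> = 1 \<or> \<gamma> = - 1" by (auto simp: cmod_def complex_eq_iff abs_eq_iff')
      then have "x = \<gamma> * (\<gamma> * x)" "x \<in> ?L \<Longrightarrow> \<gamma> * x \<in> ?L" for x
        using zmod.subspace_neg[OF subspace_lat] by auto
      then show False using False by blast
    qed
    then have "Im (of_nat l * \<gamma>) \<noteq> 0" using prime_gt_0_nat[OF assms(1)] by simp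
    ultimately show ?thesis by blast
  next
    case True
    have \<sigma>L: "\<sigma> x \<in> ?L" if "x \<in> ?L" for x
    proof -
      obtain y where "y \<in> ?L" "x = \<sigma> y" using \<open>x \<in> ?L\<close> True unfolding \<gamma>L by blast
      then show ?thesis by (simp add: \<sigma>\<sigma>)
    qed
    have min: "v1 \<in> min_vectors ?L" "v2 \<in> min_vectors ?L"
      by (rule reduced_pair_gens_min[OF assms(2)])+
    have min\<sigma>: "\<sigma> x \<in> min_vectors ?L" if "x \<in> min_vectors ?L" for x
    proof -
      have "\<sigma> x \<noteq> 0" using that norm_\<sigma>[of x] by (auto simp: min_vectors_def)
      then show ?thesis using that \<sigma>L norm_\<sigma> by (auto simp: min_vectors_def)
    qed
    show ?thesis
    \<comment> \<open>Now \<sigma> preserves the set of minimal vectors of \<open>L\<close>. If it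
      moves \<open>v1\<close> or \<open>v2\<close> off its line, that vector and its image form a
      basis of \<open>L\<close> along which \<open>M\<close> is rhombic.\<close>
    proof (cases "\<exists>u\<in>{v1, v2}. \<sigma> u \<noteq> u \<and> \<sigma> u \<noteq> - u")
      case True
      then obtain u where u: "u \<in> min_vectors ?L" "\<sigma> u \<noteq> u" "\<sigma> u \<noteq> - u" using min by blast
      have indu: "indep_pair u (\<sigma> u)"
        using norm_\<sigma>[of u] u(2,3) norm_eq_imp_indep_pair[of u "\<sigma> u"] by (metis minus_minus)
      note L = min_vectors_generate[OF subspace_lat u(1) min\<sigma>[OF u(1)] indu]
      have "w1 \<in> lat u (\<sigma> u)" using M_sub_L L(1) lat_gens by blast
      then obtain a b where w1: "w1 = of_int a * u + of_int b * \<sigma> u" by (rule latE)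
      then have w2: "w2 = of_int b * u + of_int a * \<sigma> u"
        using \<sigma>w(1) lin[of a u b "\<sigma> u"] by (simp add: \<sigma>\<sigma> add.commute)
      show ?thesis
        using multiplier_ring_of_rhombic[OF assms(1) L(2) assms(3) _ w1 w2] assms(4) indep_pair_ratio_nonreal[OF indu]
        unfolding L(1) by blast
    next
      case False
      \<comment> \<open>Both \<open>v1\<close> and \<open>v2\<close> are eigenvectors. Equal
        eigenvalues would make \<open>w2\<close> equal to \<open>w1\<close> up to sign, so the
        eigenvalues are 1 and -1, and the isometry \<sigma> forces the two vectors to be
        orthogonal.\<close>
      have "\<exists>u v. (u = v1 \<and> v = v2 \<or> u = v2 \<and> v = v1) \<and> \<sigma> u = u \<and> \<sigma> v = - v"
      proof (rule ccontr)
        assume *: "\<not> ?thesis"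
        have "\<exists>e. (e = 1 \<or> e = -1) \<and> \<sigma> v1 = of_int e * v1 \<and> \<sigma> v2 = of_int e * v2"
        proof (cases "\<sigma> v1 = v1")
          case True
          then have "\<sigma> v2 = v2" using * False by auto
          then show ?thesis using True by (intro exI[of _ 1]) auto
        next
          case v1: False
          then have "\<sigma> v1 = - v1" "\<sigma> v2 = - v2" using * False by auto
          then show ?thesis by (intro exI[of _ "-1"]) auto
        qed
        then obtain e :: int where e: "e = 1 \<or> e = -1" "\<sigma> v1 = of_int e * v1" "\<sigma> v2 = of_int e * v2"
          by blast
        obtain a b where "w1 = of_int a * v1 + of_int b * v2"
          using M_sub_L lat_gens(1)[of w1 w2] by (meson latE subsetD)
        then have "w2 = of_int e * w1"
          using \<sigma>w(1) lin[of a v1 b v2] e by (simp add: algebra_simps)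
        then show False using ind(2) e(1) by (auto simp: indep_pair_def)
      qed
      then obtain u v where uv: "u = v1 \<and> v = v2 \<or> u = v2 \<and> v = v1" "\<sigma> u = u" "\<sigma> v = - v" by blast
      have "?L = lat u v" using uv(1) by (auto simp: lat_eq_span insert_commute)
      moreover have "reduced_pair u v"
        using uv(1) assms(2) by (auto simp: reduced_pair_def inner_commute intro: indep_pair_sym)
      moreover have "u \<bullet> v = 0"
      proof -
        have "u \<bullet> v = (norm c)\<^sup>2 * (u \<bullet> v)" by (simp add: nc)
        also have "\<dots> = \<sigma> u \<bullet> \<sigma> v" unfolding \<sigma>_def
          by (simp add: cmod_power2 inner_complex_def) (simp add: power2_eq_square algebra_simps)
        also have "\<dots> = - (u \<bullet> v)" by (simp add: uv)
        finally show ?thesis by simp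
      qed
      moreover obtain a b where w1: "w1 = of_int a * u + of_int b * v"
        using M_sub_L lat_gens(1)[of w1 w2] \<open>?L = lat u v\<close> by (metis latE subsetD)
      moreover have w2: "w2 = of_int a * u + of_int (- b) * v"
        using \<sigma>w(1) lin[of a u b v] w1 uv by simp
      ultimately show ?thesis
        using multiplier_ring_of_square[OF assms(1) _ _ _ w1 w2] assms(4) indep_pair_ratio_nonreal[of u v]
        by (metis reduced_pair_def)
    qed
  qed
qed


section \<open>Products and inverses of lattices\<close>

text \<open>Formed without a surrounding ring, so that an inverse lattice outside the order can also
  be a factor.\<close>

definition module_prod :: "complex set \<Rightarrow> complex set \<Rightarrow> complex set" where
  "module_prod I J = zmod.span {x * y | x y. x \<in> I \<and> y \<in> J}"

lemma subspace_module_prod [simp, intro]: "zmod.subspace (module_prod I J)"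
  by (simp add: module_prod_def)

lemma module_prodI: "x \<in> I \<Longrightarrow> y \<in> J \<Longrightarrow> x * y \<in> module_prod I J"
  unfolding module_prod_def by (rule zmod.span_base) blast

lemma module_prod_subset:
  assumes "zmod.subspace M" "\<And>x y. x \<in> I \<Longrightarrow> y \<in> J \<Longrightarrow> x * y \<in> M"
  shows "module_prod I J \<subseteq> M"
  unfolding module_prod_def using assms by (intro zmod.span_minimal) auto

lemma module_prod_mono: "I \<subseteq> I' \<Longrightarrow> module_prod I J \<subseteq> module_prod I' J"
  unfolding module_prod_def by (rule zmod.span_mono) blast

lemma module_prod_commute: "module_prod I J = module_prod J I"
  unfolding module_prod_def by (rule arg_cong[of _ _ zmod.span]) (metis mult.commute)

lemma subspace_vimage_mult:
  assumes "zmod.subspace M"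
  shows "zmod.subspace {x. c * x \<in> M}"
proof (rule zmod.subspaceI)
  show "0 \<in> {x. c * x \<in> M}" using zmod.subspace_0[OF assms] by simp
  show "x + y \<in> {x. c * x \<in> M}" if "x \<in> {x. c * x \<in> M}" "y \<in> {x. c * x \<in> M}" for x y
    using that zmod.subspace_add[OF assms] by (simp add: distrib_left)
  show "of_int k * x \<in> {x. c * x \<in> M}" if "x \<in> {x. c * x \<in> M}" for k x
    using that zmod.subspace_scale[OF assms, of "c * x" k] by (simp add: mult.left_commute)
qed

text \<open>The preimage of \<open>M\<close> under multiplication by \<open>c\<close> is a subgroup,
  so testing the generating products is enough.\<close>

lemma module_prod_vimage:
  assumes "zmod.subspace M" "\<And>x y. x \<in> I \<Longrightarrow> y \<in> J \<Longrightarrow> c * (x * y) \<in> M" "z \<in> module_prod I J"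
  shows "c * z \<in> M"
  using module_prod_subset[OF subspace_vimage_mult[OF assms(1)], of I J c] assms(2,3) by blast

lemma module_prod_assoc: "module_prod (module_prod I J) H = module_prod I (module_prod J H)"
proof
  show "module_prod (module_prod I J) H \<subseteq> module_prod I (module_prod J H)"
  proof (rule module_prod_subset[OF subspace_module_prod])
    fix z h assume "z \<in> module_prod I J" "h \<in> H"
    have "h * z \<in> module_prod I (module_prod J H)"
    proof (rule module_prod_vimage[OF subspace_module_prod _ \<open>z \<in> module_prod I J\<close>])
      fix x y assume "x \<in> I" "y \<in> J"
      then have "x * (y * h) \<in> module_prod I (module_prod J H)"
        using \<open>h \<in> H\<close> by (intro module_prodI)
      then show "h * (x * y) \<in> module_prod I (module_prod J H)" by (simp add: mult_ac)
    qed
    then show "z * h \<in> module_prod I (module_prod J H)" by (simp add: mult.commute)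
  qed
next
  show "module_prod I (module_prod J H) \<subseteq> module_prod (module_prod I J) H"
  proof (rule module_prod_subset[OF subspace_module_prod])
    fix x z assume "x \<in> I" "z \<in> module_prod J H"
    show "x * z \<in> module_prod (module_prod I J) H"
    proof (rule module_prod_vimage[OF subspace_module_prod _ \<open>z \<in> module_prod J H\<close>])
      fix y h assume "y \<in> J" "h \<in> H"
      then have "(x * y) * h \<in> module_prod (module_prod I J) H"
        using \<open>x \<in> I\<close> by (intro module_prodI)
      then show "x * (y * h) \<in> module_prod (module_prod I J) H" by (simp add: mult_ac)
    qed
  qed
qed

lemma module_prod_multiplier_ring:
  assumes "zmod.subspace I" "R \<subseteq> multiplier_ring I" "1 \<in> R"
  shows "module_prod I R = I"
proof
  show "module_prod I R \<subseteq> I"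
  proof (rule module_prod_subset[OF assms(1)])
    fix x y assume "x \<in> I" "y \<in> R"
    then have "y * x \<in> I" using assms(2) by (auto simp: multiplier_ring_def)
    then show "x * y \<in> I" by (simp add: mult.commute)
  qed
  show "I \<subseteq> module_prod I R"
    using module_prodI[of _ I 1 R] assms(3) by auto
qed

lemma module_prod_image: "module_prod ((*) c ` I) J \<subseteq> (*) c ` module_prod I J"
  by (rule module_prod_subset[OF subspace_image_mult[OF subspace_module_prod]])
    (auto simp: mult.assoc intro!: module_prodI)

text \<open>\<open>ideal_prod\<close> is generated by products under addition only; integer
  multiples, signs included, are absorbed into the left factor.\<close>

lemma ideal_prod_eq_module_prod:
  assumes "zmod.subspace I" "zmod.subspace J"
  shows "I \<cdot>\<^bsub>order_ring R\<^esub> J = module_prod I J"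
proof -
  let ?P = "ideal_prod (order_ring R) I J"
  have ops: "x * y \<in> ?P" if "x \<in> I" "y \<in> J" for x y
    using ideal_prod.prod[OF that, of "order_ring R"] by (simp add: ring_of_type_algebra_def)
  have add: "x + y \<in> ?P" if "x \<in> ?P" "y \<in> ?P" for x y
    using ideal_prod.sum[OF that] by (simp add: ring_of_type_algebra_def)
  show ?thesis
  proof
    show "?P \<subseteq> module_prod I J"
    proof
      fix z assume "z \<in> ?P"
      then show "z \<in> module_prod I J"
        by induction (auto simp: ring_of_type_algebra_def intro!: module_prodI zmod.subspace_add)
    qed
    have "zmod.subspace ?P"
    proof (rule zmod.subspaceI)
      show "0 \<in> ?P" using ops[of 0 0] zmod.subspace_0 assms by simp
      fix k z assume "z \<in> ?P"
      then show "of_int k * z \<in> ?P"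
      proof induction
        case (prod i j)
        then show ?case
          using ops[of "of_int k * i" j] zmod.subspace_scale[OF assms(1)]
          by (simp add: ring_of_type_algebra_def mult.assoc)
      next
        case (sum s1 s2)
        then show ?case using add by (simp add: ring_of_type_algebra_def distrib_left)
      qed
    qed (rule add)
    then show "module_prod I J \<subseteq> ?P" by (rule module_prod_subset) (rule ops)
  qed
qed

lemma subspace_multiplier_ring: "zmod.subspace L \<Longrightarrow> zmod.subspace (multiplier_ring L)"
  by (rule zmod.subspaceI)
    (auto simp: multiplier_ring_def distrib_right mult.assoc zmod.subspace_0 zmod.subspace_add zmod.subspace_scale)

lemma mringD: "x \<in> multiplier_ring L \<Longrightarrow> y \<in> L \<Longrightarrow> x * y \<in> L"
  by (simp add: multiplier_ring_def)

lemma one_multiplier_ring [simp]: "1 \<in> multiplier_ring L"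
  by (simp add: multiplier_ring_def)

lemma mult_multiplier_ring: "x \<in> multiplier_ring L \<Longrightarrow> y \<in> multiplier_ring L \<Longrightarrow> x * y \<in> multiplier_ring L"
  by (simp add: multiplier_ring_def mult.assoc)

text \<open>Multiplication by \<open>J\<close> undoes multiplication by \<open>I\<close> on
  \<open>P\<close> and \<open>N\<close>. Inclusions are therefore reflected as well as preserved,
  and the two negative clauses of \<open>neighbour\<close> carry over.\<close>

lemma neighbour_module_prod:
  assumes "neighbour l P N" "module_prod I J = R" "module_prod P R = P" "module_prod N R = N"
  shows "neighbour l (module_prod P I) (module_prod N I)"
  unfolding neighbour_def
proof (intro conjI ballI subspace_module_prod)
  have nbr: "N \<subseteq> P" "\<And>x. x \<in> P \<Longrightarrow> of_nat l * x \<in> N" "N \<noteq> P" "\<not> N \<subseteq> (*) (of_nat l) ` P"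
    using assms(1) by (auto simp: neighbour_def)
  have P: "module_prod (module_prod P I) J = P" and N: "module_prod (module_prod N I) J = N"
    by (simp_all add: module_prod_assoc assms)
  show "module_prod N I \<subseteq> module_prod P I" using nbr(1) by (rule module_prod_mono)
  show "of_nat l * x \<in> module_prod N I" if "x \<in> module_prod P I" for x
  proof (rule module_prod_vimage[OF subspace_module_prod _ that])
    fix p i assume "p \<in> P" "i \<in> I"
    then have "(of_nat l * p) * i \<in> module_prod N I" using nbr(2) by (intro module_prodI)
    then show "of_nat l * (p * i) \<in> module_prod N I" by (simp add: mult.assoc)
  qed
  show "module_prod N I \<noteq> module_prod P I" using P N nbr(3) by metis
  show "\<not> module_prod N I \<subseteq> (*) (of_nat l) ` module_prod P I"
  proof
    assume "module_prod N I \<subseteq> (*) (of_nat l) ` module_prod P I"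
    then have "module_prod (module_prod N I) J \<subseteq> module_prod ((*) (of_nat l) ` module_prod P I) J"
      by (rule module_prod_mono)
    also have "\<dots> \<subseteq> (*) (of_nat l) ` module_prod (module_prod P I) J" by (rule module_prod_image)
    finally show False using P N nbr(4) by simp
  qed
qed

text \<open>Division by the content. The Bezout coefficients are returned along with the polynomial
  because they will exhibit 1 as an element of the product of a lattice and its inverse.\<close>

lemma primitive_quadratic:
  fixes b d c :: int
  assumes "b \<noteq> 0" "of_int b * (t * t) + of_int d * t + of_int c = (0::complex)"
  obtains A B C x y z where "A \<noteq> 0" "of_int A * (t * t) + of_int B * t + of_int C = 0"
    "x * A + y * B + z * C = 1"
proof -
  define g where "g = gcd b (gcd d c)"
  have "g \<noteq> 0" using assms(1) by (simp add: g_def)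
  obtain p q where 1: "p * b + q * gcd d c = g" unfolding g_def using bezout_int by blast
  obtain r s where 2: "r * d + s * c = gcd d c" using bezout_int by blast
  have "g dvd b" "g dvd d" "g dvd c"
    by (auto simp: g_def intro: dvd_trans[OF gcd_dvd2])
  then obtain A B C where eq: "b = g * A" "d = g * B" "c = g * C" by (elim dvdE)
  have "g * (p * A + q * r * B + q * s * C) = p * (g * A) + q * (r * (g * B) + s * (g * C))"
    by (simp add: algebra_simps)
  also have "\<dots> = g * 1" using 1 2 by (simp flip: eq)
  finally have "p * A + q * r * B + q * s * C = 1" using \<open>g \<noteq> 0\<close> by simp
  moreover have "of_int g * (of_int A * (t * t) + of_int B * t + of_int C) = 0"
    using assms(2) unfolding eq by (simp add: algebra_simps)
  then have "of_int A * (t * t) + of_int B * t + of_int C = 0" using \<open>g \<noteq> 0\<close> by simp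
  moreover have "A \<noteq> 0" using assms(1) eq by auto
  ultimately show ?thesis using that by blast
qed

text \<open>If \<open>L = \<int> + \<int>\<tau>\<close> with
  \<open>A\<tau>\<^sup>2 + B\<tau> + C = 0\<close> primitive, then the multiplier ring is \<open>\<int> + \<int>A\<tau>\<close>, and \<open>A\<close> times
  the conjugate lattice is an inverse, since \<open>A(\<tau> + \<tau>') = -B\<close> and \<open>A\<tau>\<tau>' = C\<close>.\<close>

lemma lattice_invertible:
  assumes ind: "indep_pair u v" and \<mu>: "\<mu> \<in> multiplier_ring (lat u v)" "Im \<mu> \<noteq> 0"
  obtains A B C :: int and J where "A \<noteq> 0"
    "of_int A * ((v / u) * (v / u)) + of_int B * (v / u) + of_int C = 0"
    "multiplier_ring (lat u v) = lat 1 (of_int A * (v / u))"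
    "J = lat (of_int A / u) (of_int A * cnj (v / u) / u)"
    "module_prod (lat u v) J = multiplier_ring (lat u v)"
proof -
  define t where "t = v / u"
  note nz = indep_pair_nz[OF ind]
  have L: "lat u v = (*) u ` lat 1 t" using nz by (simp add: image_mult_lat t_def)
  have mr: "multiplier_ring (lat u v) = multiplier_ring (lat 1 t)"
    unfolding L using nz by (intro multiplier_ring_mult)
  have indt: "indep_pair 1 t"
    using indep_pair_ratio_nonreal[OF ind] by (simp add: indep_pair_def t_def)
  have "\<mu> * 1 \<in> lat 1 t" "\<mu> * t \<in> lat 1 t"
    by (rule mringD[OF \<mu>(1)[unfolded mr]], simp)+
  then obtain a b c d where e: "\<mu> * 1 = of_int a * 1 + of_int b * t" "\<mu> * t = of_int c * 1 + of_int d * t"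
    unfolding lat_def by blast
  have "b \<noteq> 0" using \<mu>(2) e(1) by (cases "b = 0") auto
  moreover have "of_int b * (t * t) + of_int (a - d) * t + of_int (- c) = 0"
  proof -
    have "(of_int a * 1 + of_int b * t) * t = of_int c * 1 + of_int d * t"
      using e by simp
    then show ?thesis by (simp add: algebra_simps)
  qed
  ultimately obtain A B C x y z where A: "A \<noteq> 0" and q: "of_int A * (t * t) + of_int B * t + of_int C = 0"
    and bez: "x * A + y * B + z * C = 1"
    by (rule primitive_quadratic)
  have q': "of_int A * (t * t) = of_int (- B) * t + of_int (- C)"
  proof -
    have "of_int A * (t * t) = (of_int A * (t * t) + of_int B * t + of_int C) + (of_int (- B) * t + of_int (- C))"
      by simp
    then show ?thesis unfolding q by simp
  qed
  have ring: "multiplier_ring (lat 1 t) = lat 1 (of_int A * t)"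
  proof
    show "lat 1 (of_int A * t) \<subseteq> multiplier_ring (lat 1 t)"
    proof (rule lat_subset[OF subspace_multiplier_ring[OF subspace_lat]])
      have "of_int A * t * 1 \<in> lat 1 t" using latI[of 0 1 A t] by simp
      moreover have "of_int A * t * t \<in> lat 1 t"
        using latI[of "-C" 1 "-B" t] q' by (simp add: mult.assoc add.commute)
      ultimately show "of_int A * t \<in> multiplier_ring (lat 1 t)" by (rule multiplier_ring_latI)
    qed simp
    show "multiplier_ring (lat 1 t) \<subseteq> lat 1 (of_int A * t)"
    proof
      fix \<alpha> assume \<alpha>: "\<alpha> \<in> multiplier_ring (lat 1 t)"
      have "\<alpha> * 1 \<in> lat 1 t" "\<alpha> * t \<in> lat 1 t"
        by (rule mringD[OF \<alpha>], simp)+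
      then obtain p k e f where 1: "\<alpha> = of_int p + of_int k * t" and 2: "\<alpha> * t = of_int e + of_int f * t"
        unfolding lat_def by auto
      have "of_int A * (\<alpha> * t) = of_int (A * p) * t + of_int k * (of_int A * (t * t))"
        unfolding 1 by (simp add: algebra_simps)
      also have "\<dots> = of_int (- k * C) * 1 + of_int (A * p - k * B) * t"
        unfolding q' by (simp add: algebra_simps)
      finally have "of_int (A * e) * 1 + of_int (A * f) * t = of_int (- k * C) * 1 + of_int (A * p - k * B) * t"
        unfolding 2 by (simp add: algebra_simps)
      note 3 = indep_pair_unique[OF indt this]
      \<comment> \<open>\<open>k * A\<close>, \<open>k * B\<close> and \<open>k * C\<close> are all
        multiples of \<open>A\<close>; by the Bezout relation so is \<open>k\<close>.\<close>
      have "k * (x * A + y * B + z * C) = A * (k * x + y * (p - f) - z * e)"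
      proof -
        have kB: "k * B = A * (p - f)" and kC: "k * C = A * (- e)"
          using 3 by (simp_all add: algebra_simps)
        have "k * (x * A + y * B + z * C) = A * (k * x) + y * (k * B) + z * (k * C)"
          by (simp add: algebra_simps)
        also have "\<dots> = A * (k * x + y * (p - f) - z * e)"
          unfolding kB kC by (simp add: algebra_simps)
        finally show ?thesis .
      qed
      then obtain m where "k = A * m" using bez by auto
      then have "\<alpha> = of_int p * 1 + of_int m * (of_int A * t)" by (simp add: 1)
      then show "\<alpha> \<in> lat 1 (of_int A * t)" using latI by blast
    qed
  qed
  \<comment> \<open>The trace relation: subtract the equations of \<open>t\<close> and its conjugate
    and cancel \<open>t - cnj t\<close>.\<close>
  have tc: "of_int A * cnj t = of_int (- B) - of_int A * t"
  proof -
    have "cnj (of_int A * (t * t) + of_int B * t + of_int C) = 0" unfolding q by simp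
    then have qc: "of_int A * (cnj t * cnj t) + of_int B * cnj t + of_int C = 0" by simp
    have "(t - cnj t) * (of_int A * (t + cnj t) + of_int B)
        = (of_int A * (t * t) + of_int B * t + of_int C) - (of_int A * (cnj t * cnj t) + of_int B * cnj t + of_int C)"
      by (simp add: algebra_simps)
    then have "(t - cnj t) * (of_int A * (t + cnj t) + of_int B) = 0" unfolding q qc by simp
    moreover have "t - cnj t \<noteq> 0" using indt by (auto simp: indep_pair_def complex_eq_iff)
    ultimately have 0: "of_int A * (t + cnj t) + of_int B = 0" by simp
    have "of_int A * cnj t = (of_int A * (t + cnj t) + of_int B) + of_int (- B) - of_int A * t"
      by (simp add: algebra_simps)
    then show ?thesis unfolding 0 by simp
  qed
  have tt: "of_int A * cnj t * t = of_int C"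
  proof -
    have "of_int A * cnj t * t = of_int (- B) * t - of_int A * (t * t)"
      unfolding tc by (simp add: algebra_simps)
    also have "\<dots> = of_int C" unfolding q' by simp
    finally show ?thesis .
  qed
  define J where "J = lat (of_int A / u) (of_int A * cnj t / u)"
  have R: "zmod.subspace (lat 1 (of_int A * t))" by simp
  have "module_prod (lat u v) J = lat 1 (of_int A * t)"
  proof
    have vt: "v = u * t" using nz by (simp add: t_def)
    show "module_prod (lat u v) J \<subseteq> lat 1 (of_int A * t)"
    proof (rule module_prod_subset[OF R])
      fix a b assume "a \<in> lat u v" "b \<in> J"
      then obtain i j m n where ab: "a = of_int i * u + of_int j * v"
        "b = of_int m * (of_int A / u) + of_int n * (of_int A * cnj t / u)"
        unfolding J_def lat_def by blast
      have "a * b = of_int (i * m * A) + of_int (i * n) * (of_int A * cnj t)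
          + of_int (j * m) * (of_int A * t) + of_int (j * n) * (of_int A * cnj t * t)"
        unfolding ab vt using nz by (simp add: field_simps)
      also have "\<dots> = of_int (i * m * A - i * n * B + j * n * C) * 1 + of_int (j * m - i * n) * (of_int A * t)"
        unfolding tt unfolding tc by (simp add: algebra_simps)
      also have "\<dots> \<in> lat 1 (of_int A * t)" by (rule latI)
      finally show "a * b \<in> lat 1 (of_int A * t)" .
    qed
    note add = zmod.subspace_add[OF subspace_module_prod] and scale = zmod.subspace_scale[OF subspace_module_prod]
    have 1: "of_int A \<in> module_prod (lat u v) J" "of_int A * cnj t \<in> module_prod (lat u v) J"
      "of_int A * t \<in> module_prod (lat u v) J" "of_int C \<in> module_prod (lat u v) J"
    proof -
      have J: "of_int A / u \<in> J" "of_int A * cnj t / u \<in> J" by (simp_all add: J_def)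
      show "of_int A \<in> module_prod (lat u v) J"
        using module_prodI[OF lat_gens(1) J(1), of u v] nz by simp
      show "of_int A * cnj t \<in> module_prod (lat u v) J"
        using module_prodI[OF lat_gens(1) J(2), of u v] nz by simp
      show "of_int A * t \<in> module_prod (lat u v) J"
        using module_prodI[OF lat_gens(2)[where u = u and v = v] J(1)] nz by (simp add: vt mult.commute)
      show "of_int C \<in> module_prod (lat u v) J"
        using module_prodI[OF lat_gens(2)[where u = u and v = v] J(2)] nz tt by (simp add: vt mult_ac)
    qed
    \<comment> \<open>The product contains \<open>A\<close>, \<open>C\<close> and, by the trace
      relation, \<open>-B\<close>; primitivity makes 1 an integer combination of these.\<close>
    have "of_int x * of_int A + of_int (- y) * (of_int A * cnj t + of_int A * t) + of_int z * of_int C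
        \<in> module_prod (lat u v) J"
      by (intro add scale 1)
    also have "of_int x * of_int A + of_int (- y) * (of_int A * cnj t + of_int A * t) + of_int z * of_int C
        = (of_int (x * A + y * B + z * C) :: complex)"
      unfolding tc by (simp add: algebra_simps)
    finally have "1 \<in> module_prod (lat u v) J" by (simp add: bez)
    then show "lat 1 (of_int A * t) \<subseteq> module_prod (lat u v) J"
      using 1(3) by (intro lat_subset subspace_module_prod)
  qed
  then show ?thesis
    using that[of A B C J] A q mr ring unfolding J_def t_def by simp
qed


section \<open>Tempered perfect forms\<close>

lemma consists_of_pairsI:
  assumes "finite S" "\<And>v. v \<in> S \<Longrightarrow> - v \<in> S" "x \<in> S" "y \<in> S" "y \<noteq> x" "y \<noteq> - x"
  shows "\<exists>s\<ge>2. consists_of_pairs s S"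
proof -
  let ?P = "(\<lambda>v. {v, - v}) ` S"
  have "{{x, - x}, {y, - y}} \<subseteq> ?P" using assms(3,4) by blast
  then have "card {{x, - x}, {y, - y}} \<le> card ?P" using assms(1) by (intro card_mono) auto
  moreover have "{x, - x} \<noteq> {y, - y}" using assms(5,6) by (auto simp: doubleton_eq_iff)
  ultimately have "card ?P \<ge> 2" by simp
  moreover have "consists_of_pairs (card ?P) S"
    unfolding consists_of_pairs_def using assms(1,2) by (intro exI[of _ ?P]) auto
  ultimately show ?thesis by blast
qed

lemma consists_of_pairsE:
  assumes "consists_of_pairs s S" "s \<ge> 2"
  obtains x y where "x \<in> S" "y \<in> S" "x \<noteq> y" "x \<noteq> - y"
proof -
  obtain P where P: "finite P" "card P = s" "\<And>p. p \<in> P \<Longrightarrow> \<exists>v. p = {v, - v}" "S = \<Union>P"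
    using assms(1) unfolding consists_of_pairs_def by blast
  have "\<not> card P \<le> Suc 0" using P(2) assms(2) by simp
  then obtain p q where pq: "p \<in> P" "q \<in> P" "p \<noteq> q" using card_le_Suc0_iff_eq[OF P(1)] by blast
  obtain x y where xy: "p = {x, - x}" "q = {y, - y}" using P(3) pq by meson
  have "x \<in> S" "y \<in> S" using P(4) pq xy by auto
  moreover have "x \<noteq> y" "x \<noteq> - y" using pq(3) xy by auto
  ultimately show ?thesis by (rule that)
qed

lemma reduced_pair_neg: "reduced_pair u v \<Longrightarrow> reduced_pair u (- v)"
  unfolding reduced_pair_def indep_pair_def by (elim conjE, intro conjI) simp_all

lemma bilinear_comb:
  fixes b :: "complex \<Rightarrow> complex \<Rightarrow> real"
  assumes "bilinear b" "\<forall>x y. b x y = b y x"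
  shows "b (of_real x * u + of_real y * v) (of_real x * u + of_real y * v)
    = x\<^sup>2 * b u u + y\<^sup>2 * b v v + 2 * x * y * b u v"
proof -
  have "b v u = b u v" using assms(2) by blast
  moreover have "b (x *\<^sub>R u + y *\<^sub>R v) (x *\<^sub>R u + y *\<^sub>R v) = x * (x * b u u + y * b u v) + y * (x * b v u + y * b v v)"
    by (simp add: bilinear_ladd[OF assms(1)] bilinear_radd[OF assms(1)]
        bilinear_lmul[OF assms(1)] bilinear_rmul[OF assms(1)] distrib_left distrib_right)
  ultimately show ?thesis by (simp add: scaleR_conv_of_real power2_eq_square algebra_simps)
qed

text \<open>The hypotheses give equal squares of sum and difference, so the two pairs agree up to
  exchange and a common sign; the determinant rules out agreement without exchange.\<close>

lemma swapped_coordinates: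
  fixes a b c d :: int
  assumes "a * b = c * d" "a\<^sup>2 + b\<^sup>2 = c\<^sup>2 + d\<^sup>2" "a * d - b * c \<noteq> 0"
  shows "c = b \<and> d = a \<or> c = - b \<and> d = - a"
proof -
  have "(c + d)\<^sup>2 = (a + b)\<^sup>2" "(c - d)\<^sup>2 = (a - b)\<^sup>2"
    using assms(1,2) by (simp_all add: power2_sum power2_diff)
  then have "c + d = a + b \<or> c + d = - (a + b)" "c - d = a - b \<or> c - d = - (a - b)"
    by (simp_all only: power2_eq_iff)
  moreover have "\<not> (c = a \<and> d = b)" "\<not> (c = - a \<and> d = - b)" using assms(3) by auto
  ultimately show ?thesis by (elim disjE) auto
qed

text \<open>Otherwise \<open>w1\<close> and \<open>w2\<close> would be no longer than the minimal
  vectors of the larger lattice. They would then be minimal in it and generate it, so that the two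
  lattices coincide.\<close>

lemma min_norm_not_in_neighbour:
  assumes "reduced_pair v1 v2" "reduced_pair w1 w2" "neighbour l (lat v1 v2) (lat w1 w2)"
    and "v \<in> lat v1 v2" "norm v = norm v1"
  shows "v \<notin> lat w1 w2"
proof
  assume v: "v \<in> lat w1 w2"
  have M: "lat w1 w2 \<subseteq> lat v1 v2" "lat w1 w2 \<noteq> lat v1 v2"
    using assms(3) by (auto simp: neighbour_def)
  have ind: "indep_pair v1 v2" "indep_pair w1 w2" and eq: "norm w1 = norm w2"
    using assms(1,2) by (auto simp: reduced_pair_def)
  have "v \<noteq> 0" using assms(5) indep_pair_nz[OF ind(1)] by auto
  then have "norm w1 \<le> norm v1" using reduced_pair_min[OF assms(2) v] assms(5) by simp
  have "w1 \<in> lat v1 v2" "w2 \<in> lat v1 v2" using M lat_gens by blast+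
  then have "w1 \<in> min_vectors (lat v1 v2)" "w2 \<in> min_vectors (lat v1 v2)"
    using reduced_pair_min[OF assms(1)] \<open>norm w1 \<le> norm v1\<close> eq indep_pair_nz[OF ind(2)]
    by (auto simp: min_vectors_def intro: order_trans)
  then show False using min_vectors_generate(1)[OF subspace_lat _ _ ind(2)] M(2) by blast
qed

text \<open>The normalisation \<open>norm v1 = 1\<close> is dictated by (i), and under (i)-(iv) the
  two sets can only be all minimal vectors of either lattice. A competing form is known up to
  \<open>b v1 v2\<close>, so uniqueness amounts to determining this one number.\<close>

lemma tempered_perfect_normalised:
  assumes prime: "Factorial_Ring.prime l" and v: "reduced_pair v1 v2" "norm v1 = 1" and w: "reduced_pair w1 w2"
    and nbr: "neighbour l (lat v1 v2) (lat w1 w2)"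
  shows "tempered_perfect_with (lat v1 v2) (lat w1 w2)
    {v \<in> lat v1 v2. norm v = norm v1} {v \<in> lat w1 w2. norm v = norm w1}"
    (is "tempered_perfect_with ?L ?M ?S ?S'")
proof -
  have M: "?M \<subseteq> ?L" using nbr by (auto simp: neighbour_def)
  have ind: "indep_pair v1 v2" "indep_pair w1 w2" and eq: "norm v2 = 1" "norm w2 = norm w1"
    using v w by (auto simp: reduced_pair_def)
  note nz = indep_pair_nz[OF ind(1)] indep_pair_nz[OF ind(2)]
  have gen: "v1 \<in> ?S" "v2 \<in> ?S" "w1 \<in> ?S'" "w2 \<in> ?S'" using v eq by auto
  have SM: "?S \<subseteq> ?L - ?M" using min_norm_not_in_neighbour[OF v(1) w nbr] by blast
  have S'M: "?S' \<subseteq> ?M - {0}" using nz by auto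
  have minL: "norm z \<ge> 1" if "z \<in> ?L" "z \<noteq> 0" for z
    using reduced_pair_min[OF v(1) that] v(2) by simp
  have minM: "norm z \<ge> norm w1" if "z \<in> ?M" "z \<noteq> 0" for z using reduced_pair_min[OF w that] .
  have w1: "norm w1 \<ge> 1" using minL M lat_gens nz by blast
  have sq: "z \<bullet> z = (norm z)\<^sup>2" for z :: complex by (simp add: power2_norm_eq_inner)
  have norm1: "norm z = 1" if "z \<bullet> z = 1" for z :: complex
    using that norm_ge_zero[of z] unfolding sq power2_eq_1_iff by linarith
  have conds: "form_conditions ?L ?M ?S ?S' (\<lambda>v. v \<bullet> v) ((norm w1)\<^sup>2)"
    unfolding form_conditions_def sq
  proof (intro conjI ballI impI)
    fix z assume "z \<in> ?L - ?M" "z \<notin> ?S"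
    moreover have "z \<noteq> 0" using calculation zmod.subspace_0[OF subspace_lat] by auto
    ultimately have "norm z > 1" using minL[of z] v(2) by auto
    then show "(norm z)\<^sup>2 > 1" by (simp add: one_less_power)
  next
    fix z assume "z \<in> ?M - {0}" "z \<notin> ?S'"
    then have "norm z > norm w1" using minM[of z] by auto
    then show "(norm z)\<^sup>2 > (norm w1)\<^sup>2" by (intro power_strict_mono) auto
  qed (use v w1 in auto)
  moreover have "B = (\<lambda>v. v \<bullet> v) \<and> u' = (norm w1)\<^sup>2"
    if B: "pos_def_quadratic_form B" "form_conditions ?L ?M ?S ?S' B u'" for B u'
  proof -
    obtain b where b: "bilinear b" "\<forall>x y. b x y = b y x" "\<And>x. B x = b x x"
      using B(1) unfolding pos_def_quadratic_form_def by blast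
    have B1: "B z = 1" if "z \<in> ?S" for z using B(2) that by (simp add: form_conditions_def)
    have Bu: "B z = u'" if "z \<in> ?S'" for z using B(2) that unfolding form_conditions_def by blast
    have Bc: "B (of_real x * v1 + of_real y * v2) = x\<^sup>2 + y\<^sup>2 + 2 * x * y * b v1 v2" for x y
      unfolding b(3) bilinear_comb[OF b(1,2)] using B1[OF gen(1)] B1[OF gen(2)] by (simp add: b(3))
    have Nc: "(of_real x * v1 + of_real y * v2) \<bullet> (of_real x * v1 + of_real y * v2)
        = x\<^sup>2 + y\<^sup>2 + 2 * x * y * (v1 \<bullet> v2)" for x y
      unfolding sq norm_comb using v eq by simp
    have t: "b v1 v2 = v1 \<bullet> v2"
    proof -
      have "w1 \<in> ?L" "w2 \<in> ?L" using M lat_gens by blast+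
      then obtain p q r s where pq: "w1 = of_int p * v1 + of_int q * v2" and rs: "w2 = of_int r * v1 + of_int s * v2"
        unfolding lat_def by blast
      have Nw: "w1 \<bullet> w1 = w2 \<bullet> w2" unfolding sq eq ..
      have Bw: "B w1 = B w2" using Bu gen by simp
      have 1: "(of_int p)\<^sup>2 + (of_int q)\<^sup>2 + 2 * of_int p * of_int q * (v1 \<bullet> v2) =
          (of_int r)\<^sup>2 + (of_int s)\<^sup>2 + 2 * of_int r * of_int s * (v1 \<bullet> v2)"
        using Nw Nc[of "of_int p" "of_int q"] Nc[of "of_int r" "of_int s"] unfolding pq rs by simp
      have 2: "(of_int p)\<^sup>2 + (of_int q)\<^sup>2 + 2 * of_int p * of_int q * b v1 v2 =
          (of_int r)\<^sup>2 + (of_int s)\<^sup>2 + 2 * of_int r * of_int s * b v1 v2"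
        using Bw Bc[of "of_int p" "of_int q"] Bc[of "of_int r" "of_int s"] unfolding pq rs by simp
      \<comment> \<open>Equality at \<open>w1\<close> and \<open>w2\<close> holds for
        \<open>B\<close> and for the dot product; subtracting the two equations leaves a linear
        condition on the difference of the mixed coefficients.\<close>
      have "of_int (p * q - r * s) * (b v1 v2 - v1 \<bullet> v2) = 0"
        using 1 2 by (simp add: algebra_simps)
      then have "p * q - r * s = 0 \<or> b v1 v2 - v1 \<bullet> v2 = 0"
        by (simp only: mult_eq_0_iff of_int_eq_0_iff)
      then consider "b v1 v2 = v1 \<bullet> v2" | "p * q = r * s" by auto
      then show ?thesis
      proof cases
        case 2
        then have "of_int p * of_int q = (of_int r * of_int s :: real)"
          by (metis of_int_mult)
        then have "(of_int p)\<^sup>2 + (of_int q)\<^sup>2 = ((of_int r)\<^sup>2 + (of_int s)\<^sup>2 :: real)"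
          using 1 by (simp add: mult.assoc)
        then have sqs: "p\<^sup>2 + q\<^sup>2 = r\<^sup>2 + s\<^sup>2"
          by (metis of_int_add of_int_eq_iff of_int_power)
        have det: "\<bar>p * s - q * r\<bar> = int l" by (rule neighbour_det[OF prime nbr pq rs ind(1)])
        then have "p * s - q * r \<noteq> 0" using prime_gt_0_nat[OF prime] by auto
        then have "r = q \<and> s = p \<or> r = - q \<and> s = - p" by (rule swapped_coordinates[OF 2 sqs])
        \<comment> \<open>Replacing \<open>w2\<close> by \<open>- w2\<close> in the second case, the
          coordinates are exchanged without a sign.\<close>
        then obtain z where z: "z = of_int q * v1 + of_int p * v2" "reduced_pair w1 z"
          and det': "\<bar>p * p - q * q\<bar> = int l"
        proof
          assume "r = q \<and> s = p"
          then show ?thesis using that[of w2] rs w det by simp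
        next
          assume "r = - q \<and> s = - p"
          then show ?thesis
            using that[of "- w2"] rs reduced_pair_neg[OF w] det by (simp add: abs_minus_commute)
        qed
        \<comment> \<open>The sign decides whether \<open>v1 + v2\<close> or \<open>v1 - v2\<close>
          has length 1 too; the value 1 of \<open>B\<close> on that vector fixes the mixed
          coefficient.\<close>
        have "2 * (v1 \<bullet> v2) = - 1 \<or> 2 * (v1 \<bullet> v2) = 1"
          using rhombic_sublattice[OF v(1) z(2) pq z(1) prime det'] v(2) by auto
        then show ?thesis
        proof
          assume *: "2 * (v1 \<bullet> v2) = - 1"
          have "norm (v1 + v2) = 1" using Nc[of 1 1] * by (intro norm1) simp
          moreover have "v1 + v2 \<in> ?L" using zmod.subspace_add[OF subspace_lat] by simp
          ultimately have "B (v1 + v2) = 1" using v(2) by (intro B1) simp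
          then show ?thesis using Bc[of 1 1] * by simp
        next
          assume *: "2 * (v1 \<bullet> v2) = 1"
          have "norm (v1 - v2) = 1" using Nc[of 1 "-1"] * by (intro norm1) simp
          moreover have "v1 - v2 \<in> ?L" using zmod.subspace_diff[OF subspace_lat] by simp
          ultimately have "B (v1 - v2) = 1" using v(2) by (intro B1) simp
          then show ?thesis using Bc[of 1 "-1"] * by simp
        qed
      qed
    qed
    have BA: "B z = z \<bullet> z" for z
    proof -
      obtain x y where z: "z = of_real x * v1 + of_real y * v2" using indep_pair_coords[OF ind(1)] .
      show ?thesis unfolding z Bc Nc t ..
    qed
    moreover have "u' = (norm w1)\<^sup>2" using Bu[OF gen(3)] BA sq by metis
    ultimately show ?thesis by blast
  qed
  ultimately show ?thesis
    unfolding tempered_perfect_with_def using SM S'M gen by blast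
qed

lemma doubly_well_rounded_of_neighbours:
  assumes prime: "Factorial_Ring.prime l" and "well_rounded L" "well_rounded M" "neighbour l L M"
  shows "doubly_well_rounded l L M"
proof -
  obtain v1 v2 where v: "reduced_pair v1 v2" "L = lat v1 v2"
    using assms(2) by (auto simp: well_rounded_iff)
  obtain w1 w2 where w: "reduced_pair w1 w2" "M = lat w1 w2"
    using assms(3) by (auto simp: well_rounded_iff)
  have ind: "indep_pair v1 v2" "indep_pair w1 w2" using v w by (auto simp: reduced_pair_def)
  define c where "c = 1 / norm v1"
  have c: "c > 0" using indep_pair_nz[OF ind(1)] by (simp add: c_def)
  define C where "C = complex_of_real c"
  have "C \<noteq> 0" using c by (simp add: C_def)
  have sc: "(*\<^sub>R) c ` T = (*) C ` T" for T :: "complex set" by (simp add: C_def scaleR_conv_of_real)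
  let ?v1 = "C * v1" and ?v2 = "C * v2" and ?w1 = "C * w1" and ?w2 = "C * w2"
  have wr: "reduced_pair ?v1 ?v2" "reduced_pair ?w1 ?w2"
    using reduced_pair_mult[OF \<open>C \<noteq> 0\<close>] v w by blast+
  have "norm ?v1 = 1"
    using indep_pair_nz[OF ind(1)] by (simp add: C_def c_def norm_mult norm_divide)
  have nbr: "neighbour l (lat ?v1 ?v2) (lat ?w1 ?w2)"
    using neighbour_mult[OF \<open>C \<noteq> 0\<close> assms(4)] unfolding v(2) w(2) image_mult_lat .
  have pairs: "\<exists>s\<ge>2. consists_of_pairs s {z \<in> lat x y. norm z = norm x}" if xy: "reduced_pair x y" for x y
  proof (rule consists_of_pairsI)
    have "indep_pair x y" and eq: "norm x = norm y" using xy by (auto simp: reduced_pair_def)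
    show "finite {z \<in> lat x y. norm z = norm x}"
      by (rule finite_subset[OF _ reduced_pair_finite[OF xy, of "norm x"]]) auto
    show "- z \<in> {z \<in> lat x y. norm z = norm x}" if "z \<in> {z \<in> lat x y. norm z = norm x}" for z
      using that zmod.subspace_neg[OF subspace_lat] by auto
    show "x \<in> {z \<in> lat x y. norm z = norm x}" "y \<in> {z \<in> lat x y. norm z = norm x}" using eq by auto
    show "y \<noteq> x" "y \<noteq> - x" using \<open>indep_pair x y\<close> by (auto simp: indep_pair_def)
  qed
  have lats: "is_lattice L" "is_lattice M" using ind v w by (auto simp: is_lattice_iff)
  have idx: "add_index L M = l" by (rule neighbour_imp_index[OF prime v(2) assms(4)])
  have "M \<subseteq> L" using assms(4) by (simp add: neighbour_def)
  obtain s s' where s: "s \<ge> 2" "s' \<ge> 2" "consists_of_pairs s {z \<in> lat ?v1 ?v2. norm z = norm ?v1}"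
    "consists_of_pairs s' {z \<in> lat ?w1 ?w2. norm z = norm ?w1}"
    using pairs[OF wr(1)] pairs[OF wr(2)] by blast
  moreover have "tempered_perfect_with ((*\<^sub>R) c ` L) ((*\<^sub>R) c ` M) {z \<in> lat ?v1 ?v2. norm z = norm ?v1}
      {z \<in> lat ?w1 ?w2. norm z = norm ?w1}"
    unfolding sc v(2) w(2) image_mult_lat
    by (rule tempered_perfect_normalised[OF prime wr(1) \<open>norm ?v1 = 1\<close> wr(2) nbr])
  ultimately have "tempered_form_of_type l s s' L M"
    unfolding tempered_form_of_type_def using prime lats idx \<open>M \<subseteq> L\<close> c by blast
  then show ?thesis unfolding doubly_well_rounded_def using s by blast
qed

text \<open>Condition (ii) bounds the vectors of \<open>L\<close> outside \<open>M\<close>, and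
  \<open>u \<ge> 1\<close> with (iii) and (iv) bounds those inside, so \<open>S\<close> consists of
  minimal vectors of \<open>L\<close>; likewise \<open>S'\<close> for \<open>M\<close>. Vectors of
  equal length from two different pairs are independent.\<close>

lemma doubly_well_roundedD:
  assumes "doubly_well_rounded l L M"
  shows "well_rounded L" "well_rounded M" "neighbour l L M"
proof -
  obtain s s' c S S' u where s: "s \<ge> 2" "s' \<ge> 2" "consists_of_pairs s S" "consists_of_pairs s' S'"
    and c: "c > 0" and prime: "Factorial_Ring.prime l" and lats: "is_lattice L" "is_lattice M"
    and M: "M \<subseteq> L" "add_index L M = l" and S: "S \<subseteq> (*\<^sub>R) c ` L - (*\<^sub>R) c ` M" "S' \<subseteq> (*\<^sub>R) c ` M - {0}"
    and F: "form_conditions ((*\<^sub>R) c ` L) ((*\<^sub>R) c ` M) S S' (\<lambda>v. v \<bullet> v) u"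
    using assms unfolding doubly_well_rounded_def tempered_form_of_type_def tempered_perfect_with_def
    by blast
  obtain p q where L: "indep_pair p q" "L = lat p q" using lats by (auto simp: is_lattice_iff)
  obtain p' q' where M': "indep_pair p' q'" "M = lat p' q'"
    using lats by (auto simp: is_lattice_iff)
  show "neighbour l L M" by (rule index_imp_neighbour[OF prime L(2,1) _ M]) (simp add: M')
  define C where "C = complex_of_real c"
  have "C \<noteq> 0" using c by (simp add: C_def)
  have sc: "(*\<^sub>R) c ` T = (*) C ` T" for T :: "complex set" by (simp add: C_def scaleR_conv_of_real)
  have sub: "zmod.subspace ((*) C ` L)" "zmod.subspace ((*) C ` M)"
    by (simp_all add: L(2) M'(2) image_mult_lat)
  have C1: "(*) (1 / C) ` (*) C ` T = T" for T using \<open>C \<noteq> 0\<close> by (simp add: image_image)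
  note S = S[unfolded sc] and F = F[unfolded sc form_conditions_def]
  have sq: "z \<bullet> z = (norm z)\<^sup>2" for z :: complex by (simp add: power2_norm_eq_inner)
  \<comment> \<open>One argument serves \<open>L\<close> with \<open>S\<close> and common value 1,
    and \<open>M\<close> with \<open>S'\<close> and common value \<open>u\<close>.\<close>
  have wr: "well_rounded T" if T: "zmod.subspace ((*) C ` T)" "R \<subseteq> (*) C ` T - {0}"
      "consists_of_pairs k R" "k \<ge> 2" "\<And>x. x \<in> R \<Longrightarrow> x \<bullet> x = m"
      "\<And>x. x \<in> (*) C ` T \<Longrightarrow> x \<noteq> 0 \<Longrightarrow> x \<bullet> x \<ge> m" for T R k m
  proof -
    obtain x y where xy: "x \<in> R" "y \<in> R" "x \<noteq> y" "x \<noteq> - y" using consists_of_pairsE[OF T(3,4)] .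
    have le: "norm x \<le> norm z" if "x \<in> R" "z \<in> (*) C ` T" "z \<noteq> 0" for x z
    proof -
      have "(norm x)\<^sup>2 \<le> (norm z)\<^sup>2" using T(5)[OF that(1)] T(6)[OF that(2,3)] by (simp add: sq)
      then show ?thesis by (simp add: abs_le_square_iff)
    qed
    then have min: "x \<in> min_vectors ((*) C ` T)" if "x \<in> R" for x
      using that T(2) by (auto simp: min_vectors_def)
    have "norm x = norm y" using le xy T(2) by (intro antisym) blast+
    then have "indep_pair x y" using xy(3,4) by (rule norm_eq_imp_indep_pair)
    note min_vectors_generate[OF T(1) min[OF xy(1)] min[OF xy(2)] this]
    then have "well_rounded ((*) C ` T)" by (auto simp: well_rounded_iff)
    from well_rounded_mult[OF _ this, of "1 / C"] show ?thesis
      unfolding C1 using \<open>C \<noteq> 0\<close> by simp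
  qed
  have S1: "x \<bullet> x = 1" if "x \<in> S" for x
    using F that by (simp del: image_iff)
  have L1: "x \<bullet> x \<ge> 1" if "x \<in> (*) C ` L" "x \<notin> (*) C ` M" for x
  proof (cases "x \<in> S")
    case False
    then have "x \<bullet> x > 1" using conjunct1[OF conjunct2[OF F]] that by blast
    then show ?thesis by simp
  qed (simp add: S1)
  have u: "u \<ge> 1" using F by (elim conjE)
  have S'u: "x \<bullet> x = u" if "x \<in> S'" for x
    using conjunct1[OF conjunct2[OF conjunct2[OF conjunct2[OF F]]]] that by (rule bspec)
  have Mu: "x \<bullet> x \<ge> u" if "x \<in> (*) C ` M" "x \<noteq> 0" for x
  proof (cases "x \<in> S'")
    case False
    then have "x \<bullet> x > u"
      using conjunct2[OF conjunct2[OF conjunct2[OF conjunct2[OF F]]]] that by blast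
    then show ?thesis by simp
  qed (simp add: S'u)
  show "well_rounded L"
  proof (rule wr[OF sub(1) _ s(3,1) S1])
    show "S \<subseteq> (*) C ` L - {0}"
      using S(1) zmod.subspace_0[OF sub(2)] by blast
    show "x \<bullet> x \<ge> 1" if "x \<in> (*) C ` L" "x \<noteq> 0" for x
    proof (cases "x \<in> (*) C ` M")
      case True
      from Mu[OF this that(2)] u show ?thesis by linarith
    qed (rule L1[OF that(1)])
  qed
  show "well_rounded M"
    by (rule wr[OF sub(2) S(2) s(4,2) S'u Mu])
qed


section \<open>Ideals of imaginary quadratic orders\<close>

abbreviation \<C>R :: "complex ring" where "\<C>R \<equiv> ring_of_type_algebra"

lemma ring_of_type_algebra_simps [simp]:
  "carrier \<C>R = UNIV" "x \<otimes>\<^bsub>\<C>R\<^esub> y = x * y" "x \<oplus>\<^bsub>\<C>R\<^esub> y = x + y" "\<one>\<^bsub>\<C>R\<^esub> = 1" "\<zero>\<^bsub>\<C>R\<^esub> = 0"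
  by (simp_all add: ring_of_type_algebra_def)

lemma field_complex: "field \<C>R"
  by (rule field_from_type_algebra)

lemma a_inv_complex [simp]: "\<ominus>\<^bsub>\<C>R\<^esub> x = - x"
proof -
  interpret field \<C>R by (rule field_complex)
  show ?thesis by (rule minus_equality) auto
qed

lemma m_inv_complex: "x \<noteq> 0 \<Longrightarrow> inv\<^bsub>\<C>R\<^esub> x = inverse x"
proof -
  assume "x \<noteq> 0"
  interpret field \<C>R by (rule field_complex)
  show ?thesis by (rule comm_inv_char) (use \<open>x \<noteq> 0\<close> in auto)
qed

lemma subfield_closed:
  assumes "subfield K \<C>R"
  shows "1 \<in> K" "x \<in> K \<Longrightarrow> y \<in> K \<Longrightarrow> x * y \<in> K" "x \<in> K \<Longrightarrow> x \<noteq> 0 \<Longrightarrow> inverse x \<in> K"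
proof -
  interpret field \<C>R by (rule field_complex)
  note sub = subringE[OF subfieldE(1)[OF assms]]
  show "1 \<in> K" using sub(3) by simp
  show "x \<in> K \<Longrightarrow> y \<in> K \<Longrightarrow> x * y \<in> K" using sub(6)[of x y] by simp
  show "x \<in> K \<Longrightarrow> x \<noteq> 0 \<Longrightarrow> inverse x \<in> K"
    using subfield_m_inv(1)[OF assms, of x] m_inv_complex[of x] by simp
qed

lemma of_rat_as_real: "(of_rat p :: complex) = of_real (of_rat p)"
  by (cases p) (simp add: of_rat_rat)

text \<open>A multiplier \<alpha> is the quotient of \<open>\<alpha> * x\<close> by
  \<open>x\<close>, both of which lie in \<open>K\<close>.\<close>

lemma coefficient_ring_eq_multiplier_ring:
  assumes "subfield K \<C>R" "L \<subseteq> K" "x \<in> L" "x \<noteq> 0"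
  shows "coefficient_ring K L = multiplier_ring L"
proof -
  have "\<alpha> \<in> K" if "\<alpha> \<in> multiplier_ring L" for \<alpha>
  proof -
    have "(\<alpha> * x) * inverse x \<in> K"
      using mringD[OF that assms(3)] assms subfield_closed[OF assms(1)] by blast
    then show ?thesis using assms(4) by (simp add: mult.assoc)
  qed
  then show ?thesis by (auto simp: coefficient_ring_def multiplier_ring_def)
qed

lemma proper_ideal_class_mem:
  assumes "\<C> \<in> proper_ideal_classes K R" "L \<in> \<C>"
  shows "L \<in> proper_fractional_ideals K R"
  using assms unfolding proper_ideal_classes_def by (auto elim: quotientE)

lemma fractional_ideal_subset: "fractional_ideal K L \<Longrightarrow> L \<subseteq> K"
  unfolding fractional_ideal_def using qvec.span_superset by blast

lemma fractional_ideal_subspace: "fractional_ideal K L \<Longrightarrow> zmod.subspace L"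
  unfolding fractional_ideal_def by (metis zmod.subspace_span)

lemma order_nonreal:
  assumes "imaginary_quadratic_field K" "is_order K R"
  obtains \<mu> where "\<mu> \<in> R" "Im \<mu> \<noteq> 0"
proof -
  have "\<not> R \<subseteq> \<real>"
  proof
    assume "R \<subseteq> \<real>"
    moreover have "qvec.subspace \<real>"
      by (rule qvec.subspaceI) (auto simp: of_rat_as_real)
    ultimately have "qvec.span R \<subseteq> \<real>" by (rule qvec.span_minimal)
    then show False
      using assms by (simp add: imaginary_quadratic_field_def is_order_def fractional_ideal_def)
  qed
  then show ?thesis using that unfolding subset_iff complex_is_Real_iff by blast
qed

lemma well_rounded_ideal_pair_imp_doubly_well_rounded:
  assumes prime: "Factorial_Ring.prime l" and K: "imaginary_quadratic_field K" and R: "is_order K R"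
    and pair: "well_rounded_ideal_pair l K R \<aa> \<pp>"
  shows "doubly_well_rounded l \<aa> (\<pp> \<cdot>\<^bsub>order_ring R\<^esub> \<aa>)"
proof -
  let ?pa = "\<pp> \<cdot>\<^bsub>order_ring R\<^esub> \<aa>"
  have sf: "subfield K \<C>R" using K by (simp add: imaginary_quadratic_field_def)
  have wr: "well_rounded \<aa>" "well_rounded ?pa" and \<aa>: "\<aa> \<in> proper_fractional_ideals K R"
    and \<pp>: "primeideal \<pp> (order_ring R)" "\<pp> \<in> proper_fractional_ideals K R" "add_index R \<pp> = l"
    using pair proper_ideal_class_mem
    unfolding well_rounded_ideal_pair_def well_rounded_class_def by blast+
  have zsub: "zmod.subspace \<aa>" "zmod.subspace \<pp>"
    using \<aa> \<pp>(2) fractional_ideal_subspace by (auto simp: proper_fractional_ideals_def)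
  obtain u v where uv: "reduced_pair u v" "\<aa> = lat u v" using wr by (auto simp: well_rounded_iff)
  have ind: "indep_pair u v" using uv by (simp add: reduced_pair_def)
  have "\<aa> \<subseteq> K" using \<aa> fractional_ideal_subset by (auto simp: proper_fractional_ideals_def)
  \<comment> \<open>Properness of \<aa> identifies the order with its multiplier ring, and for the
    latter an inverse lattice and a basis are available.\<close>
  then have Rm: "R = multiplier_ring \<aa>"
    using coefficient_ring_eq_multiplier_ring[OF sf _ _ indep_pair_nz(1)[OF ind]] \<aa> uv(2)
    by (auto simp: proper_fractional_ideals_def)
  obtain \<mu> where "\<mu> \<in> R" "Im \<mu> \<noteq> 0" using order_nonreal[OF K R] .
  then obtain A J where A: "A \<noteq> 0" "multiplier_ring \<aa> = lat 1 (of_int A * (v / u))"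
    and J: "module_prod \<aa> J = multiplier_ring \<aa>"
    using lattice_invertible[OF ind] Rm uv(2) by metis
  have Rl: "R = lat 1 (of_int A * (v / u))" using A Rm by simp
  have indR: "indep_pair 1 (of_int A * (v / u))"
    using indep_pair_ratio_nonreal[OF ind] A(1) Im_of_real_mult[of "of_int A" "v / u"] by (simp add: indep_pair_def)
  interpret P: primeideal \<pp> "order_ring R" by (rule \<pp>(1))
  have pR: "\<pp> \<subseteq> R" using P.a_subset by (simp add: ring_of_type_algebra_def)
  have "neighbour l R \<pp>" by (rule index_imp_neighbour[OF prime Rl indR zsub(2) pR \<pp>(3)])
  moreover have "module_prod R R = R"
    by (rule module_prod_multiplier_ring)
      (auto simp: Rl[symmetric] Rm subspace_multiplier_ring zsub(1)
        multiplier_ring_def[of "multiplier_ring _"] intro: mult_multiplier_ring)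
  moreover have "module_prod \<pp> R = \<pp>"
  proof (rule module_prod_multiplier_ring[OF zsub(2)])
    show "R \<subseteq> multiplier_ring \<pp>"
      using P.I_l_closed by (auto simp: multiplier_ring_def ring_of_type_algebra_def)
    show "1 \<in> R" by (simp add: Rm)
  qed
  ultimately have "neighbour l (module_prod R \<aa>) (module_prod \<pp> \<aa>)"
    using neighbour_module_prod[of l R \<pp> \<aa> J R] J Rm by metis
  moreover have "module_prod R \<aa> = \<aa>"
    using module_prod_multiplier_ring[OF zsub(1), of R] by (simp add: Rm module_prod_commute)
  moreover have "?pa = module_prod \<pp> \<aa>" by (rule ideal_prod_eq_module_prod[OF zsub(2,1)])
  ultimately show ?thesis
    using doubly_well_rounded_of_neighbours[OF prime wr] by simp
qed

section \<open>The field generated by a quadratic number\<close>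

definition quadratic_field :: "complex \<Rightarrow> complex set" where
  "quadratic_field t = {of_rat p + of_rat q * t | p q. True}"

lemma quadratic_fieldI: "of_rat p + of_rat q * t \<in> quadratic_field t"
  unfolding quadratic_field_def by blast

lemma quadratic_field_eq_span: "quadratic_field t = qvec.span {1, t}"
proof
  show "quadratic_field t \<subseteq> qvec.span {1, t}"
  proof
    fix z assume "z \<in> quadratic_field t"
    then obtain p q where "z = of_rat p + of_rat q * t" unfolding quadratic_field_def by blast
    then have z: "z = of_rat p * 1 + of_rat q * t" by simp
    show "z \<in> qvec.span {1, t}"
      unfolding z by (intro qvec.span_add qvec.span_scale qvec.span_base) auto
  qed
  have "qvec.subspace (quadratic_field t)"
  proof (rule qvec.subspaceI)
    show "0 \<in> quadratic_field t" using quadratic_fieldI[of 0 0 t] by simp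
  next
    fix x y assume "x \<in> quadratic_field t" "y \<in> quadratic_field t"
    then obtain p q r s where "x = of_rat p + of_rat q * t" "y = of_rat r + of_rat s * t"
      unfolding quadratic_field_def by blast
    then have "x + y = of_rat (p + r) + of_rat (q + s) * t" by (simp add: of_rat_add algebra_simps)
    then show "x + y \<in> quadratic_field t" using quadratic_fieldI by metis
  next
    fix c x assume "x \<in> quadratic_field t"
    then obtain p q where "x = of_rat p + of_rat q * t" unfolding quadratic_field_def by blast
    then have "of_rat c * x = of_rat (c * p) + of_rat (c * q) * t"
      by (simp add: of_rat_mult algebra_simps)
    then show "of_rat c * x \<in> quadratic_field t" using quadratic_fieldI by metis
  qed
  moreover have "{1, t} \<subseteq> quadratic_field t"
    using quadratic_fieldI[of 1 0 t] quadratic_fieldI[of 0 1 t] by simp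
  ultimately show "qvec.span {1, t} \<subseteq> quadratic_field t" by (rule qvec.span_minimal[rotated])
qed

lemma quadratic_field_unique:
  assumes "Im t \<noteq> 0" "of_rat p + of_rat q * t = of_rat r + of_rat s * t"
  shows "p = r" "q = s"
proof -
  have "indep_pair 1 t" using assms(1) by (simp add: indep_pair_def)
  moreover have "of_real (of_rat p) * 1 + of_real (of_rat q) * t = of_real (of_rat r) * 1 + of_real (of_rat s) * t"
    using assms(2) by (simp add: of_rat_as_real)
  ultimately have "of_rat p = (of_rat r :: real)" "of_rat q = (of_rat s :: real)"
    using indep_pair_unique_real by blast+
  then show "p = r" "q = s" by simp_all
qed

lemma dim_quadratic_field: "Im t \<noteq> 0 \<Longrightarrow> qvec.dim (quadratic_field t) = 2"
proof -
  assume t: "Im t \<noteq> 0"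
  then have "t \<noteq> 1" by auto
  have "f s = 0" if S: "S \<subseteq> {1, t}" "(\<Sum>x\<in>S. of_rat (f x) * x) = (0 :: complex)" "s \<in> S" for S f s
  proof -
    define g where "g x = (if x \<in> S then f x else 0)" for x
    have "(\<Sum>x\<in>S. of_rat (f x) * x) = (\<Sum>x\<in>{1, t}. of_rat (g x) * x)"
      using S by (intro sum.mono_neutral_cong_left) (auto simp: g_def)
    then have "of_rat (g 1) + of_rat (g t) * t = of_rat 0 + of_rat 0 * t"
      using S \<open>t \<noteq> 1\<close> by simp
    then have "g 1 = 0" "g t = 0" using quadratic_field_unique[OF t] by blast+
    then show "f s = 0" using S by (auto simp: g_def split: if_splits)
  qed
  then have "qvec.independent {1, t}" unfolding qvec.dependent_explicit by blast
  then have "qvec.dim (quadratic_field t) = card {1, t}"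
    by (intro qvec.dim_eq_card) (simp_all add: quadratic_field_eq_span qvec.span_span)
  then show ?thesis using \<open>t \<noteq> 1\<close> by simp
qed

text \<open>The coordinate determinant \<open>D\<close> with respect to 1 and \<open>t\<close> is
  nonzero because \<open>x\<close> and \<open>y\<close> are independent even over the reals;
  Cramer's rule then recovers 1 and \<open>t\<close>.\<close>

lemma quadratic_field_span_of_independent:
  assumes "x \<in> quadratic_field t" "y \<in> quadratic_field t" "indep_pair x y" "x \<in> S" "y \<in> S" "S \<subseteq> quadratic_field t"
  shows "qvec.span S = quadratic_field t"
proof
  show "qvec.span S \<subseteq> quadratic_field t"
    using assms(6) qvec.span_minimal[of S "quadratic_field t"] by (simp add: quadratic_field_eq_span)
  obtain p q r s where x: "x = of_rat p + of_rat q * t" and y: "y = of_rat r + of_rat s * t"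
    using assms(1,2) unfolding quadratic_field_def by blast
  define D where "D = p * s - q * r"
  have D: "of_rat D = (of_rat p * of_rat s - of_rat q * of_rat r :: complex)"
    by (simp add: D_def of_rat_diff of_rat_mult)
  have "D \<noteq> 0"
  proof
    assume "D = 0"
    then have "of_rat p * of_rat s = (of_rat q * of_rat r :: complex)" using D by simp
    then have "of_real (of_rat s) * x + of_real (- of_rat q) * y = of_real 0 * x + of_real 0 * y"
      "of_real (of_rat r) * x + of_real (- of_rat p) * y = of_real 0 * x + of_real 0 * y"
      unfolding x y by (simp_all add: algebra_simps flip: of_rat_as_real)
    from indep_pair_unique_real[OF assms(3) this(1)] indep_pair_unique_real[OF assms(3) this(2)]
    have "p = 0" "q = 0" by simp_all
    then show False using indep_pair_nz[OF assms(3)] x by simp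
  qed
  have S: "x \<in> qvec.span S" "y \<in> qvec.span S" using assms(4,5) by (simp_all add: qvec.span_base)
  have "of_rat s * x - of_rat q * y = of_rat D" "of_rat p * y - of_rat r * x = of_rat D * t"
    unfolding x y D by (simp_all add: algebra_simps)
  moreover have "of_rat s * x - of_rat q * y \<in> qvec.span S" "of_rat p * y - of_rat r * x \<in> qvec.span S"
    by (intro qvec.span_diff qvec.span_scale S)+
  ultimately have "of_rat D \<in> qvec.span S" "of_rat D * t \<in> qvec.span S" by simp_all
  then have "of_rat (1 / D) * of_rat D \<in> qvec.span S" "of_rat (1 / D) * (of_rat D * t) \<in> qvec.span S"
    by (blast intro: qvec.span_scale)+
  then have "1 \<in> qvec.span S" "t \<in> qvec.span S"
    using \<open>D \<noteq> 0\<close> by (simp_all add: of_rat_divide)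
  then show "quadratic_field t \<subseteq> qvec.span S"
    unfolding quadratic_field_eq_span by (intro qvec.span_minimal) auto
qed

text \<open>The equation reduces \<open>t * t\<close> to a rational combination of 1 and
  \<open>t\<close>, and the rational trace puts the conjugate of \<open>t\<close> into the field.
  Inverses come from the norm: \<open>x * cnj x\<close> is real, and the only real elements are
  rational.\<close>

lemma quadratic_field_imaginary:
  assumes A: "A \<noteq> 0" and q: "of_int A * (t * t) + of_int B * t + of_int C = 0" and t: "Im t \<noteq> 0"
  shows "imaginary_quadratic_field (quadratic_field t)" "cnj t \<in> quadratic_field t"
    "\<And>x y. x \<in> quadratic_field t \<Longrightarrow> y \<in> quadratic_field t \<Longrightarrow> x * y \<in> quadratic_field t"
proof -
  note add = qvec.span_add[of _ "{1, t}", folded quadratic_field_eq_span]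
    and scale = qvec.span_scale[of _ "{1, t}", folded quadratic_field_eq_span]
    and neg = qvec.span_neg[of _ "{1, t}", folded quadratic_field_eq_span]
  have rat: "of_rat p \<in> quadratic_field t" for p using quadratic_fieldI[of p 0 t] by simp
  have tq: "t \<in> quadratic_field t" using quadratic_fieldI[of 0 1 t] by simp
  have t2: "t * t = of_rat (- of_int C / of_int A) + of_rat (- of_int B / of_int A) * t"
  proof -
    have "of_int A * (t * t) = (of_int A * (t * t) + of_int B * t + of_int C) + (- of_int B * t - of_int C)"
      by simp
    then have "of_int A * (t * t) = - of_int B * t - of_int C" unfolding q by simp
    then have "t * t = (- of_int B * t - of_int C) / of_int A"
      using A by (simp add: eq_divide_eq mult.commute)
    also have "\<dots> = of_rat (- of_int C / of_int A) + of_rat (- of_int B / of_int A) * t"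
      by (simp add: of_rat_divide of_rat_minus diff_divide_distrib)
    finally show ?thesis .
  qed
  show mult: "x * y \<in> quadratic_field t" if "x \<in> quadratic_field t" "y \<in> quadratic_field t" for x y
  proof -
    obtain p q r s where xy: "x = of_rat p + of_rat q * t" "y = of_rat r + of_rat s * t"
      using \<open>x \<in> quadratic_field t\<close> \<open>y \<in> quadratic_field t\<close> unfolding quadratic_field_def by blast
    have "x * y = of_rat p * of_rat r + (of_rat p * (of_rat s * t)
        + (of_rat r * (of_rat q * t) + of_rat q * (of_rat s * (t * t))))"
      unfolding xy by (simp add: algebra_simps)
    also have "\<dots> \<in> quadratic_field t"
      unfolding t2 by (intro add scale rat tq)
    finally show ?thesis .
  qed
  have sum: "t + cnj t = of_rat (- of_int B / of_int A)"
  proof -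
    let ?b = "of_rat (- of_int B / of_int A) :: complex" and ?c = "of_rat (- of_int C / of_int A) :: complex"
    have "cnj (t * t) = cnj (?c + ?b * t)" by (simp only: t2)
    then have 2: "cnj t * cnj t = ?c + ?b * cnj t"
      by (simp only: complex_cnj_mult complex_cnj_add of_rat_as_real complex_cnj_complex_of_real)
    have "(t - cnj t) * (t + cnj t - ?b) = (t * t) - (cnj t * cnj t) - ?b * (t - cnj t)"
      by (simp only: algebra_simps)
    also have "\<dots> = 0" unfolding t2 2 by (simp add: right_diff_distrib)
    finally show ?thesis using t by (auto simp: complex_eq_iff)
  qed
  have "cnj t = of_rat (- of_int B / of_int A) + - t" using sum by (simp add: algebra_simps)
  then show cnj: "cnj t \<in> quadratic_field t" using add[OF rat neg[OF tq]] by simp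
  have inv: "inverse x \<in> quadratic_field t" if x: "x \<in> quadratic_field t" "x \<noteq> 0" for x
  proof -
    obtain p q where xe: "x = of_rat p + of_rat q * t"
      using x(1) unfolding quadratic_field_def by blast
    have cx: "cnj x = of_rat p + of_rat q * cnj t"
      unfolding xe by (simp add: of_rat_as_real)
    then have cq: "cnj x \<in> quadratic_field t" by (simp add: add scale rat cnj)
    obtain r s where rs: "x * cnj x = of_rat r + of_rat s * t"
      using mult[OF x(1) cq] unfolding quadratic_field_def by blast
    have "Im (of_rat r + of_rat s * t) = 0" unfolding rs[symmetric] by simp
    then have "s = 0" using t by (simp add: of_rat_as_real)
    then have xr: "x * cnj x = of_rat r" using rs by simp
    have "inverse x = cnj x / (x * cnj x)" using x(2) by (simp add: inverse_eq_divide)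
    then have "inverse x = of_rat (1 / r) * cnj x" unfolding xr by (simp add: of_rat_divide)
    then show ?thesis using scale[OF cq] by simp
  qed
  interpret field \<C>R by (rule field_complex)
  have "subfield (quadratic_field t) \<C>R"
  proof (rule subfieldI')
    show "subring (quadratic_field t) \<C>R"
      by (rule subringI) (use mult add neg rat[of 1] in auto)
    show "inv\<^bsub>\<C>R\<^esub> k \<in> quadratic_field t" if "k \<in> quadratic_field t - {\<zero>\<^bsub>\<C>R\<^esub>}" for k
      using that inv by (simp add: m_inv_complex)
  qed
  moreover have "\<not> quadratic_field t \<subseteq> \<real>" using tq t by (auto simp: complex_is_Real_iff)
  ultimately show "imaginary_quadratic_field (quadratic_field t)"
    using dim_quadratic_field[OF t] by (simp add: imaginary_quadratic_field_def)
qed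


section \<open>Orders as rings, prime ideals and proper ideals\<close>

lemma subring_multiplier_ring:
  assumes "zmod.subspace L"
  shows "subring (multiplier_ring L) \<C>R"
proof -
  interpret field \<C>R by (rule field_complex)
  note sub = subspace_multiplier_ring[OF assms]
  show ?thesis
    by (rule subringI) (use zmod.subspace_add[OF sub] zmod.subspace_neg[OF sub] mult_multiplier_ring in auto)
qed

lemma cring_order_ring:
  assumes "zmod.subspace L" "R = multiplier_ring L"
  shows "cring (order_ring R)"
proof -
  have sub: "zmod.subspace R" and one: "1 \<in> R" and mult: "\<And>x y. x \<in> R \<Longrightarrow> y \<in> R \<Longrightarrow> x * y \<in> R"
    using subspace_multiplier_ring[OF assms(1)] mult_multiplier_ring by (auto simp: assms(2))
  show ?thesis
  proof (rule cringI)
    show "abelian_group (order_ring R)"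
    proof (rule abelian_groupI)
      fix x assume "x \<in> carrier (order_ring R)"
      then show "\<exists>y\<in>carrier (order_ring R). y \<oplus>\<^bsub>order_ring R\<^esub> x = \<zero>\<^bsub>order_ring R\<^esub>"
        using zmod.subspace_neg[OF sub] by (intro bexI[of _ "- x"]) auto
    qed (use zmod.subspace_add[OF sub] zmod.subspace_0[OF sub] in \<open>auto simp: algebra_simps\<close>)
    show "comm_monoid (order_ring R)"
      by (rule comm_monoidI) (use one mult in \<open>auto simp: algebra_simps\<close>)
  qed (auto simp: algebra_simps)
qed

lemma ideal_order_ring:
  assumes "zmod.subspace L" "R = multiplier_ring L" "zmod.subspace I" "I \<subseteq> R" "R \<subseteq> multiplier_ring I"
  shows "ideal I (order_ring R)"
proof (rule idealI)
  have sub: "zmod.subspace R" using subspace_multiplier_ring[OF assms(1)] by (simp add: assms(2))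
  show "ring (order_ring R)" using cring_order_ring[OF assms(1,2)] by (simp add: cring_def)
  show "subgroup I (add_monoid (order_ring R))" by (rule subgroup_add_order_ring[OF sub assms(3,4)])
  have mult: "x * a \<in> I" if "a \<in> I" "x \<in> R" for a x using that assms(5) mringD by blast
  show "x \<otimes>\<^bsub>order_ring R\<^esub> a \<in> I" "a \<otimes>\<^bsub>order_ring R\<^esub> x \<in> I"
    if "a \<in> I" "x \<in> carrier (order_ring R)" for a x
    using mult[of a x] that by (auto simp: mult.commute)
qed

text \<open>A neighbour of \<open>R\<close> is maximal already as a subgroup, so for
  \<open>x\<close> outside \<open>P\<close> there is a relation \<open>1 = m + k * x\<close> with
  \<open>m\<close> in \<open>P\<close> and an integer \<open>k\<close>; multiplying it by
  \<open>y\<close> puts \<open>y\<close> into \<open>P\<close>.\<close>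

lemma primeideal_order_ring:
  assumes "zmod.subspace L" "R = multiplier_ring L" "R \<subseteq> multiplier_ring P"
    and "neighbour l R P" "Factorial_Ring.prime l" "R = lat u v"
  shows "primeideal P (order_ring R)"
proof (rule primeidealI)
  have P: "zmod.subspace P" "P \<subseteq> R" "P \<noteq> R" using assms(4) by (auto simp: neighbour_def)
  show "ideal P (order_ring R)" by (rule ideal_order_ring[OF assms(1,2) P(1,2) assms(3)])
  show "cring (order_ring R)" by (rule cring_order_ring[OF assms(1,2)])
  show "carrier (order_ring R) \<noteq> P" using P by auto
  fix x y assume "x \<in> carrier (order_ring R)" "y \<in> carrier (order_ring R)" "x \<otimes>\<^bsub>order_ring R\<^esub> y \<in> P"
  then have xy: "x \<in> R" "y \<in> R" "x * y \<in> P" by auto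
  show "x \<in> P \<or> y \<in> P"
  proof (cases "x \<in> P")
    case False
    let ?Q = "{m + of_int k * x | m k. m \<in> P}"
    have sub: "zmod.subspace R" using subspace_multiplier_ring[OF assms(1)] by (simp add: assms(2))
    have "m = m + of_int 0 * x" for m by simp
    then have "P \<subseteq> ?Q" by blast
    moreover have "?Q \<subseteq> R"
      using xy(1) P(2) zmod.subspace_add[OF sub] zmod.subspace_scale[OF sub] by blast
    moreover have "0 + of_int 1 * x \<in> ?Q" using zmod.subspace_0[OF P(1)] by blast
    then have "?Q \<noteq> P" using False by auto
    ultimately have "?Q = R"
      using neighbour_maximal[OF assms(5,6,4) subspace_adjoin[OF P(1)]] by blast
    moreover have "1 \<in> R" by (simp add: assms(2))
    ultimately obtain m k where mk: "1 = m + of_int k * x" "m \<in> P" by blast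
    have "y = (m + of_int k * x) * y" by (simp flip: mk(1))
    also have "\<dots> = y * m + of_int k * (x * y)" by (simp add: algebra_simps)
    also have "\<dots> \<in> P"
    proof -
      have "y * m \<in> P" using xy(2) mk(2) assms(3) mringD by blast
      then show ?thesis using xy(3) zmod.subspace_add[OF P(1)] zmod.subspace_scale[OF P(1)] by blast
    qed
    finally show ?thesis ..
  qed simp
qed

lemma well_rounded_class_exists:
  assumes "I \<in> proper_fractional_ideals K R" "well_rounded I" "1 \<in> K"
  shows "\<exists>\<C>\<in>proper_ideal_classes K R. well_rounded_class \<C> \<and> I \<in> \<C>"
proof -
  let ?r = "{(I, J). I \<in> proper_fractional_ideals K R \<and> J \<in> proper_fractional_ideals K R \<and>
              (\<exists>\<gamma>\<in>K. \<gamma> \<noteq> 0 \<and> J = (*) \<gamma> ` I)}"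
  have "?r `` {I} \<in> proper_ideal_classes K R"
    unfolding proper_ideal_classes_def using assms(1) by (rule quotientI)
  moreover have "well_rounded_class (?r `` {I})"
    unfolding well_rounded_class_def using well_rounded_mult[OF _ assms(2)] by auto
  moreover have "(I, I) \<in> ?r"
    unfolding mem_Collect_eq prod.case using assms(1,3) by (intro conjI bexI[of _ 1]) simp_all
  then have "I \<in> ?r `` {I}" by blast
  ultimately show ?thesis by blast
qed

lemma proper_fractional_idealI:
  assumes "subfield (quadratic_field t) \<C>R" "finite B" "T = zmod.span B" "B \<subseteq> quadratic_field t"
    and "x \<in> T" "y \<in> T" "indep_pair x y" "multiplier_ring T = R"
  shows "T \<in> proper_fractional_ideals (quadratic_field t) R"
proof -
  have "zmod.subspace (quadratic_field t)"
  proof (rule zmod.subspaceI)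
    note sub = qvec.subspace_span[of "{1, t}", folded quadratic_field_eq_span]
    show "0 \<in> quadratic_field t" by (rule qvec.subspace_0[OF sub])
    show "x + y \<in> quadratic_field t" if "x \<in> quadratic_field t" "y \<in> quadratic_field t" for x y
      using that by (rule qvec.subspace_add[OF sub])
    show "of_int k * x \<in> quadratic_field t" if "x \<in> quadratic_field t" for k x
      using qvec.subspace_scale[OF sub that, of "of_int k"] by simp
  qed
  then have T: "T \<subseteq> quadratic_field t"
    unfolding assms(3) using assms(4) by (intro zmod.span_minimal)
  have "qvec.span T = quadratic_field t"
    using quadratic_field_span_of_independent[of x t y T] T assms(5-7) by blast
  then have "fractional_ideal (quadratic_field t) T"
    unfolding fractional_ideal_def using assms(2,3) by blast
  moreover have "coefficient_ring (quadratic_field t) T = R"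
    using coefficient_ring_eq_multiplier_ring[OF assms(1) T assms(5)] indep_pair_nz[OF assms(7)] assms(8) by simp
  ultimately show ?thesis by (simp add: proper_fractional_ideals_def)
qed

lemma module_prod_lat: "module_prod (lat a b) (lat c d) = zmod.span {a * c, a * d, b * c, b * d}"
proof
  let ?S = "{a * c, a * d, b * c, b * d}"
  show "module_prod (lat a b) (lat c d) \<subseteq> zmod.span ?S"
  proof (rule module_prod_subset[OF zmod.subspace_span])
    fix x y assume "x \<in> lat a b" "y \<in> lat c d"
    then obtain i j m n where "x = of_int i * a + of_int j * b" "y = of_int m * c + of_int n * d"
      unfolding lat_def by blast
    then have "x * y = of_int (i * m) * (a * c) + (of_int (i * n) * (a * d)
        + (of_int (j * m) * (b * c) + of_int (j * n) * (b * d)))"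
      by (simp add: algebra_simps)
    then show "x * y \<in> zmod.span ?S"
      by (simp only:) (intro zmod.span_add zmod.span_scale zmod.span_base; simp)
  qed
  show "zmod.span ?S \<subseteq> module_prod (lat a b) (lat c d)"
    by (rule zmod.span_minimal) (auto intro!: module_prodI)
qed

lemma complex_mult_similarity:
  fixes w :: complex
  assumes "w \<noteq> 0"
  shows "\<exists>f c. orthogonal_transformation f \<and> c > 0 \<and> (\<lambda>z. c *\<^sub>R f z) = (*) w"
proof (intro exI conjI)
  show "orthogonal_transformation (\<lambda>z. (w / of_real (norm w)) * z)"
    unfolding orthogonal_transformation
  proof
    show "linear (\<lambda>z. (w / of_real (norm w)) * z)"
      by (rule linearI) (simp_all add: distrib_left)
    show "\<forall>v. norm ((w / of_real (norm w)) * v) = norm v"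
      using assms by (simp add: norm_mult norm_divide)
  qed
  show "norm w > 0" using assms by simp
  show "(\<lambda>z. norm w *\<^sub>R ((w / of_real (norm w)) * z)) = (*) w"
    using assms by (simp add: scaleR_conv_of_real fun_eq_iff)
qed

section \<open>Recovering the order and the ideals from a doubly well-rounded form\<close>

lemma doubly_well_rounded_imp_ideal_pair:
  assumes prime: "Factorial_Ring.prime l" and dwr: "doubly_well_rounded l L M"
  shows "\<exists>K \<O> \<aa> \<pp>. imaginary_quadratic_field K \<and> is_order K \<O> \<and> well_rounded_ideal_pair l K \<O> \<aa> \<pp> \<and>
    (\<exists>w. w \<noteq> 0 \<and> L = (*) w ` \<aa> \<and> M = (*) w ` (\<pp> \<cdot>\<^bsub>order_ring \<O>\<^esub> \<aa>))"
proof -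
  note nbr = doubly_well_roundedD(3)[OF dwr]
  obtain v1 v2 where v: "reduced_pair v1 v2" "L = lat v1 v2"
    using doubly_well_roundedD(1)[OF dwr] by (auto simp: well_rounded_iff)
  obtain w1 w2 where w: "reduced_pair w1 w2" "M = lat w1 w2"
    using doubly_well_roundedD(2)[OF dwr] by (auto simp: well_rounded_iff)
  have ind: "indep_pair v1 v2" "indep_pair w1 w2" using v w by (auto simp: reduced_pair_def)
  have l: "l > 0" using prime prime_gt_0_nat by blast
  obtain \<mu> where \<mu>: "\<mu> \<in> multiplier_ring L" "Im \<mu> \<noteq> 0" and LM: "multiplier_ring L \<subseteq> multiplier_ring M"
    using well_rounded_neighbour_multiplier_ring[OF prime v(1) w(1)] nbr v(2) w(2) by blast
  have "neighbour l M ((*) (of_nat l) ` L)" by (rule neighbour_swap[OF nbr _ l]) (simp add: v(2))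
  moreover have "reduced_pair (of_nat l * v1) (of_nat l * v2)"
    using reduced_pair_mult[OF _ v(1)] l by simp
  ultimately have "multiplier_ring M \<subseteq> multiplier_ring ((*) (of_nat l) ` L)"
    using well_rounded_neighbour_multiplier_ring[OF prime w(1)] unfolding v(2) w(2) image_mult_lat by blast
  then have mrM: "multiplier_ring M = multiplier_ring L"
    using multiplier_ring_mult[of "of_nat l" L] l LM by auto
  define t where "t = v2 / v1"
  have t: "Im t \<noteq> 0" using indep_pair_ratio_nonreal[OF ind(1)] by (simp add: t_def)
  have \<mu>': "\<mu> \<in> multiplier_ring (lat v1 v2)" using \<mu>(1) v(2) by simp
  obtain A B C where A: "A \<noteq> 0" and "of_int A * ((v2 / v1) * (v2 / v1)) + of_int B * (v2 / v1) + of_int C = 0"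
    and "multiplier_ring (lat v1 v2) = lat 1 (of_int A * (v2 / v1))"
    by (rule lattice_invertible[OF ind(1) \<mu>' \<mu>(2)]) (rule that; assumption)
  then have q: "of_int A * (t * t) + of_int B * t + of_int C = 0" and R: "multiplier_ring L = lat 1 (of_int A * t)"
    by (simp_all only: t_def v(2))
  define R where "R = multiplier_ring L"
  \<comment> \<open>This factor turns \<open>v1\<close>, \<open>v2\<close> into \<open>A\<close>,
    \<open>A * t\<close>, both in the order generated by 1 and \<open>A * t\<close>; thus \<aa>
    becomes an ideal inside the order and not merely a fractional one.\<close>
  define s where "s = of_int A / v1"
  have s: "s \<noteq> 0" using A indep_pair_nz[OF ind(1)] by (simp add: s_def)
  define \<aa> \<bb> where "\<aa> = (*) s ` L" and "\<bb> = (*) s ` M"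
  have \<aa>: "\<aa> = lat (s * v1) (s * v2)" and \<bb>: "\<bb> = lat (s * w1) (s * w2)"
    by (simp_all add: \<aa>_def \<bb>_def v(2) w(2) image_mult_lat)
  have sv: "s * v1 = of_int A" "s * v2 = of_int A * t"
    using indep_pair_nz[OF ind(1)] by (simp_all add: s_def t_def)
  have mr: "multiplier_ring \<aa> = R" "multiplier_ring \<bb> = R"
    by (simp_all add: \<aa>_def \<bb>_def multiplier_ring_mult[OF s] mrM R_def)
  have nbr\<aa>: "neighbour l \<aa> \<bb>" unfolding \<aa>_def \<bb>_def by (rule neighbour_mult[OF s nbr])
  have ind\<aa>: "indep_pair (s * v1) (s * v2)" "indep_pair (s * w1) (s * w2)"
    using ind indep_pair_mult[OF s] by simp_all
  have zsub: "zmod.subspace \<aa>" "zmod.subspace \<bb>" "zmod.subspace R" "zmod.subspace L"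
    by (simp_all add: \<aa> \<bb> v(2) R_def subspace_multiplier_ring)
  note F = quadratic_field_imaginary[OF A q t]
  have sf: "subfield (quadratic_field t) \<C>R" using F(1) by (simp add: imaginary_quadratic_field_def)
  have int: "of_int k \<in> quadratic_field t" for k using quadratic_fieldI[of "of_int k" 0 t] by simp
  have tq: "t \<in> quadratic_field t" using quadratic_fieldI[of 0 1 t] by simp
  have rt: "s * v2 / (s * v1) = t" using s by (simp add: t_def)
  have \<mu>'': "\<mu> \<in> multiplier_ring (lat (s * v1) (s * v2))" using \<mu>(1) mr(1) by (simp add: \<aa> R_def)
  obtain A' J where J: "J = lat (of_int A' / (s * v1)) (of_int A' * cnj (s * v2 / (s * v1)) / (s * v1))"
    and "module_prod (lat (s * v1) (s * v2)) J = multiplier_ring (lat (s * v1) (s * v2))"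
    by (rule lattice_invertible[OF ind\<aa>(1) \<mu>'' \<mu>(2)]) (rule that; assumption)
  then have \<aa>J: "module_prod \<aa> J = R" unfolding \<aa>[symmetric] mr(1) by simp
  note J = J[unfolded rt]
  \<comment> \<open>The scaling by \<open>s\<close> cancels here, as \<open>J\<close> is inverse to
    the scaled lattice \<aa>.\<close>
  define \<pp> where "\<pp> = module_prod \<bb> J"
  have J\<aa>: "module_prod J \<aa> = R" using \<aa>J by (simp add: module_prod_commute)
  have \<aa>R: "module_prod \<aa> R = \<aa>" and \<bb>R: "module_prod \<bb> R = \<bb>"
    using module_prod_multiplier_ring[OF zsub(1)] module_prod_multiplier_ring[OF zsub(2)] mr by (simp_all add: R_def)
  have \<pp>\<aa>: "module_prod \<pp> \<aa> = \<bb>" by (simp add: \<pp>_def module_prod_assoc J\<aa> \<bb>R)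
  have nbr\<pp>: "neighbour l R \<pp>"
    using neighbour_module_prod[OF nbr\<aa> J\<aa> \<aa>R \<bb>R] by (simp add: \<aa>J \<pp>_def)
  \<comment> \<open>A multiplier of \<pp> also multiplies \<pp>\<aa> = \<bb>, whose multiplier ring
    is \<open>R\<close>; conversely \<open>R\<close> acts on the factor \<bb> of \<pp>.\<close>
  have mr\<pp>: "multiplier_ring \<pp> = R"
  proof
    show "multiplier_ring \<pp> \<subseteq> R"
    proof
      fix \<alpha> assume \<alpha>: "\<alpha> \<in> multiplier_ring \<pp>"
      have "\<alpha> * z \<in> \<bb>" if "z \<in> \<bb>" for z
      proof (rule module_prod_vimage[of \<bb> \<pp> \<aa> \<alpha> z])
        show "\<alpha> * (x * y) \<in> \<bb>" if "x \<in> \<pp>" "y \<in> \<aa>" for x y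
          using module_prodI[OF mringD[OF \<alpha> that(1)] that(2)] by (simp add: \<pp>\<aa> mult.assoc)
      qed (use zsub that \<pp>\<aa> in auto)
      then show "\<alpha> \<in> R" using mr(2) by (auto simp: multiplier_ring_def)
    qed
    show "R \<subseteq> multiplier_ring \<pp>"
    proof
      fix \<alpha> assume "\<alpha> \<in> R"
      then have \<alpha>: "\<alpha> \<in> multiplier_ring \<bb>" using mr(2) by simp
      have "\<alpha> * z \<in> \<pp>" if "z \<in> \<pp>" for z
        unfolding \<pp>_def
      proof (rule module_prod_vimage[OF subspace_module_prod _ that[unfolded \<pp>_def]])
        show "\<alpha> * (x * y) \<in> module_prod \<bb> J" if "x \<in> \<bb>" "y \<in> J" for x y
          using module_prodI[OF mringD[OF \<alpha> that(1)] that(2)] by (simp add: mult.assoc)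
      qed
      then show "\<alpha> \<in> multiplier_ring \<pp>" by (simp add: multiplier_ring_def)
    qed
  qed
  have Rl: "R = lat 1 (of_int A * t)" using R by (simp add: R_def)
  have indR: "indep_pair 1 (of_int A * t)"
    using t A Im_of_real_mult[of "of_int A" t] by (simp add: indep_pair_def)
  have At: "of_int A * t \<in> quadratic_field t" by (rule F(3)[OF int tq])
  have "\<aa> \<subseteq> R" unfolding \<aa> sv
  proof (rule lat_subset[OF zsub(3)])
    show "of_int A \<in> R" "of_int A * t \<in> R"
      using latI[of A 1 0 "of_int A * t"] by (simp_all add: Rl)
  qed
  have \<bb>\<aa>: "\<bb> \<subseteq> \<aa>" using nbr\<aa> by (simp add: neighbour_def)
  have order: "is_order (quadratic_field t) R"
  proof -
    have "R \<in> proper_fractional_ideals (quadratic_field t) (multiplier_ring R)"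
      by (rule proper_fractional_idealI[OF sf, of "{1, of_int A * t}" R 1 "of_int A * t"])
        (use At int[of 1] indR in \<open>auto simp: Rl lat_eq_span[symmetric]\<close>)
    then show ?thesis
      using subring_multiplier_ring[OF zsub(4)] by (simp add: is_order_def proper_fractional_ideals_def R_def)
  qed
  have \<aa>p: "\<aa> \<in> proper_fractional_ideals (quadratic_field t) R"
    by (rule proper_fractional_idealI[OF sf, of "{s * v1, s * v2}" \<aa> "s * v1" "s * v2"])
      (use At int ind\<aa> mr in \<open>auto simp: \<aa> sv lat_eq_span[symmetric]\<close>)
  have \<aa>q: "\<aa> \<subseteq> quadratic_field t"
    using \<aa>p fractional_ideal_subset by (auto simp: proper_fractional_ideals_def)
  have \<bb>gen: "s * w1 \<in> quadratic_field t" "s * w2 \<in> quadratic_field t"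
    using \<bb>\<aa> \<aa>q \<bb> lat_gens by blast+
  have \<bb>p: "\<bb> \<in> proper_fractional_ideals (quadratic_field t) R"
    by (rule proper_fractional_idealI[OF sf, of "{s * w1, s * w2}" \<bb> "s * w1" "s * w2"])
      (use \<bb>gen ind\<aa> mr in \<open>auto simp: \<bb> lat_eq_span[symmetric]\<close>)
  have inv: "inverse x \<in> quadratic_field t" if "x \<in> quadratic_field t" for x
    using subfield_closed(3)[OF sf that] that by (cases "x = 0") auto
  have \<pp>p: "\<pp> \<in> proper_fractional_ideals (quadratic_field t) R"
  proof -
    let ?c = "of_int A' / (s * v1)" and ?d = "of_int A' * cnj t / (s * v1)"
    have cd: "?c \<in> quadratic_field t" "?d \<in> quadratic_field t"
      unfolding sv divide_inverse by (intro F(3) int inv F(2))+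
    \<comment> \<open>\<open>lR\<close> lies in \<pp> and supplies two independent elements, so
      \<pp> spans the field.\<close>
    have "of_nat l * x \<in> \<pp>" if "x \<in> lat 1 (of_int A * t)" for x
      using nbr\<pp> that by (simp add: neighbour_def Rl)
    then have lp: "of_nat l * 1 \<in> \<pp>" "of_nat l * (of_int A * t) \<in> \<pp>"
      using lat_gens by blast+
    have indl: "indep_pair (of_nat l * 1) (of_nat l * (of_int A * t))"
      using indR l by (subst indep_pair_mult) simp_all
    have span: "\<pp> = zmod.span {s * w1 * ?c, s * w1 * ?d, s * w2 * ?c, s * w2 * ?d}"
      by (simp only: \<pp>_def \<bb> J module_prod_lat)
    have sub: "{s * w1 * ?c, s * w1 * ?d, s * w2 * ?c, s * w2 * ?d} \<subseteq> quadratic_field t"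
      unfolding insert_subset using F(3) \<bb>gen cd by blast
    show ?thesis
      by (rule proper_fractional_idealI[OF sf _ span sub lp indl mr\<pp>]) simp
  qed
  have wr: "well_rounded \<aa>" "well_rounded \<bb>"
    using doubly_well_roundedD(1,2)[OF dwr] well_rounded_mult[OF s] by (simp_all add: \<aa>_def \<bb>_def)
  have idp: "\<pp> \<cdot>\<^bsub>order_ring R\<^esub> \<aa> = \<bb>"
    using ideal_prod_eq_module_prod[of \<pp> \<aa> R] zsub \<pp>\<aa> by (simp add: \<pp>_def)
  have one: "1 \<in> quadratic_field t" using int[of 1] by simp
  have "well_rounded_ideal_pair l (quadratic_field t) R \<aa> \<pp>"
    unfolding well_rounded_ideal_pair_def idp
  proof (intro conjI)
    show "ideal \<aa> (order_ring R)"
      by (rule ideal_order_ring[OF zsub(4) R_def zsub(1) \<open>\<aa> \<subseteq> R\<close>]) (simp add: mr)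
    show "primeideal \<pp> (order_ring R)"
      by (rule primeideal_order_ring[OF zsub(4) R_def _ nbr\<pp> prime Rl]) (simp add: mr\<pp>)
    show "add_index R \<pp> = l" by (rule neighbour_imp_index[OF prime Rl nbr\<pp>])
  qed (use well_rounded_class_exists[OF \<aa>p wr(1) one] well_rounded_class_exists[OF \<bb>p wr(2) one] \<pp>p in auto)
  moreover have "L = (*) (1 / s) ` \<aa>" "M = (*) (1 / s) ` (\<pp> \<cdot>\<^bsub>order_ring R\<^esub> \<aa>)"
    unfolding idp unfolding \<aa>_def \<bb>_def using s by (simp_all add: image_image)
  ultimately show ?thesis using F(1) order s by (metis divide_eq_0_iff zero_neq_one)
qed

theorem corollary5:
  fixes l :: nat
  assumes "Factorial_Ring.prime l"
  shows
    "(\<forall>K \<O> \<aa> \<pp>.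
        imaginary_quadratic_field K \<and> is_order K \<O> \<and> well_rounded_ideal_pair l K \<O> \<aa> \<pp> \<longrightarrow>
          doubly_well_rounded l \<aa> (\<pp> \<cdot>\<^bsub>order_ring \<O>\<^esub> \<aa>)) \<and>
     (\<forall>L M. doubly_well_rounded l L M \<longrightarrow>
        (\<exists>K \<O> \<aa> \<pp>.
           imaginary_quadratic_field K \<and> is_order K \<O> \<and> well_rounded_ideal_pair l K \<O> \<aa> \<pp> \<and>
           (\<exists>f c. orthogonal_transformation f \<and> c > 0 \<and>
              L = (\<lambda>z. c *\<^sub>R f z) ` \<aa> \<and>
              M = (\<lambda>z. c *\<^sub>R f z) ` (\<pp> \<cdot>\<^bsub>order_ring \<O>\<^esub> \<aa>))))"
proof (intro conjI allI impI)
  show "doubly_well_rounded l \<aa> (\<pp> \<cdot>\<^bsub>order_ring \<O>\<^esub> \<aa>)"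
    if "imaginary_quadratic_field K \<and> is_order K \<O> \<and> well_rounded_ideal_pair l K \<O> \<aa> \<pp>" for K \<O> \<aa> \<pp>
    using well_rounded_ideal_pair_imp_doubly_well_rounded[OF assms] that by blast
next
  fix L M assume "doubly_well_rounded l L M"
  from doubly_well_rounded_imp_ideal_pair[OF assms this] obtain K \<O> \<aa> \<pp> w where
    pair: "imaginary_quadratic_field K" "is_order K \<O>" "well_rounded_ideal_pair l K \<O> \<aa> \<pp>"
    and w: "w \<noteq> 0" "L = (*) w ` \<aa>" "M = (*) w ` (\<pp> \<cdot>\<^bsub>order_ring \<O>\<^esub> \<aa>)"
    by blast
  \<comment> \<open>Multiplication by \<open>w\<close> is the rotation by \<open>w / |w|\<close>
    followed by the homothety with factor \<open>|w|\<close>, so the orthogonal transformation can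
    be taken to be a rotation.\<close>
  obtain f c where fc: "orthogonal_transformation f" "c > 0" "(\<lambda>z. c *\<^sub>R f z) = (*) w"
    using complex_mult_similarity[OF w(1)] by blast
  have "orthogonal_transformation f \<and> c > 0 \<and> L = (\<lambda>z. c *\<^sub>R f z) ` \<aa> \<and>
      M = (\<lambda>z. c *\<^sub>R f z) ` (\<pp> \<cdot>\<^bsub>order_ring \<O>\<^esub> \<aa>)"
    unfolding fc(3) using fc(1,2) w by blast
  then show "\<exists>K \<O> \<aa> \<pp>.
      imaginary_quadratic_field K \<and> is_order K \<O> \<and> well_rounded_ideal_pair l K \<O> \<aa> \<pp> \<and>
      (\<exists>f c. orthogonal_transformation f \<and> c > 0 \<and>
         L = (\<lambda>z. c *\<^sub>R f z) ` \<aa> \<and>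
         M = (\<lambda>z. c *\<^sub>R f z) ` (\<pp> \<cdot>\<^bsub>order_ring \<O>\<^esub> \<aa>))"
    using pair by blast
qed

end
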